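(* Let $X$ be a regular diffusion on $I=[0,1]$ with generator $A=\frac12 b(x)\frac{d^2}{dx^2}+a(x)\frac{d}{dx}$, and assume that each of the boundary points of $I$ is either (instantaneously) reflecting or entrance for $X$. Assume further that $b\in C^1(I^\circ)$. If $X^*$ is a strong stationary dual of $X$, then the generator $A^*$ of $X^*$ has the form $$(A^*f)(x)=\left(\frac12 b'(x)-a(x)+b(x)\frac{\pi(x)}{\Pi(x)}\right)f'(x)+\frac12 b(x)f''(x)$$ for $x\in I^\circ$ and $f\in\mathcal{D}_{A^*}$. Moreover, $0$ is an entrance boundary for $X^*$. If $1$ is a reflecting boundary of $X$, then $1$ is a regular absorbing boundary of $X^*$. If $1$ is an entrance boundary of $X$, then $1$ is an exit boundary of $X^*$.
   Context: Diffusions. $I=[0,1]$, $I^\circ=(0,1)$; $a,b\in C(I^\circ)$ with $b>0$ on $I^\circ$. $X$ is a time-homogeneous Feller diffusion on $I$ with initial distribution $\Pi_0$ and generator $A$ with domain $\mathcal{D}_A$. Regular means $\mathbb{P}(T_y<\infty\mid X_0=x)>0$ for all $x,y\in I^\circ$, where $T_y$ is the hitting time of $y$. A scale function $S$ is defined by $S'(x)=s(x)=\exp\{-\int^x \frac{2a(y)}{b(y)}dy\}$; the speed measure $M(dx)$ on $I^\circ$ has density $m(x)=1/(s(x)b(x))$, and $M(\cdot)$ also denotes the speed function. Expressions at boundary points are interpreted as limits. Boundary classification. With $x\in I^\circ$ fixed, at $0$ put $N(0)=\int_{(0,x]}[S(x)-S(\eta)]M(d\eta)$, $\Sigma(0)=\int_{(0,x]}[M(x)-M(\eta)]dS(\eta)$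 (analogously, $N(1)=\int_{[x,1)}[S(\eta)-S(x)]M(d\eta)$, $\Sigma(1)=\int_{[x,1)}[M(\eta)-M(x)]dS(\eta)$). A boundary is entrance if $N<\infty,\Sigma=\infty$; exit if $N=\infty,\Sigma<\infty$; natural if $N=\Sigma=\infty$; regular if $N<\infty,\Sigma<\infty$. A regular boundary $0$ is (instantaneously) reflecting if $f\in\mathcal{D}_A$ implies $\frac{df}{dS}^+(0)=\lim_{x\downarrow0}\frac{f'(x)}{s(x)}=0$, and a boundary is absorbing if $f\in\mathcal{D}_A$ implies $Af=0$ there (similarly at $1$). When each boundary is reflecting or entrance, $\mathcal{D}_A$ is the set of $f\in C(I)\cap C^2(I^\circ)$ with $Af\in C(I)$ and, in addition, $\frac{df}{dS}^+(0)=0$ if $0$ is reflecting and $\frac{df}{dS}^-(1)=0$ if $1$ is reflecting. $M$ is then a finite measure; its normalization to a probability measure is the unique invariant distribution $\Pi(dx)$, with density $\pi>0$ on $I^\circ$, and $\Pi(x)=\int_0^x\pi(y)\,dy$. Strong stationary dual. Let $\mathcal{F}[0,1]$ be the bounded measurable real functions on $[0,1]$, and for a measure $\mu$ write $(\mu,f)=\int f\,d\mu$. For $f\in\mathcal{F}[0,1]$ let $(\Lambda f)(x)=\int_0^x\frac{\pi(y)}{\Pi(x)}f(y)\,dy$ for $x>0$ and $(\Lambda f)(0)=f(0)$. Let $X^*$ be a second Feller diffusion on $I$ with initial distribution $\Pi_0^*$ and generator $A^*$ (of the form $\frac12 b^*\frac{d^2}{dx^2}+a^*\frac{d}{dx}$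 on $I^\circ$ with $a^*,b^*\in C(I^\circ)$, $b^*>0$) with domain $\mathcal{D}_{A^*}$. $X^*$ is a strong stationary dual of $X$ if (i) $\Lambda$ maps $\mathcal{D}_A$ into $\mathcal{D}_{A^*}$; (ii) $\Lambda A=A^*\Lambda$ as operators on $\mathcal{D}_A$; (iii) $(\Pi_0,f)=(\Pi_0^*,\Lambda f)$ for all $f\in\mathcal{F}[0,1]$. *)

theory Defs
  imports "HOL-Probability.Probability"
begin

abbreviation unit_borel :: "real measure"
  where "unit_borel \<equiv> restrict_space borel {0..1}"

text \<open>
  A time-homogeneous process on \<open>[0,1]\<close> is given as a Markov family: the sample paths \<open>path\<close> live on
  one measurable space \<open>events\<close> (only its sigma-algebra is used), and \<open>law \<mu>\<close> is the probability
  under which the initial distribution is \<open>\<mu>\<close>. Conditioning on \<open>X\<^sub>0 = x\<close> means passing to the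
  law started in the point mass at \<open>x\<close>; the process itself has the law \<open>law init\<close>. The coefficients
  \<open>drift\<close> and \<open>diffusivity\<close> are \<open>a\<close> and \<open>b\<close> in \<open>A = (1/2) b d\<^sup>2/dx\<^sup>2 + a d/dx\<close>;
  their values outside the open interval \<open>(0,1)\<close> are irrelevant.
\<close>

record 'w diffusion =
  events :: "'w measure"
  law :: "real measure \<Rightarrow> 'w measure"
  path :: "real \<Rightarrow> 'w \<Rightarrow> real"
  trans_kernel :: "real \<Rightarrow> real \<Rightarrow> real measure"
  init :: "real measure"
  drift :: "real \<Rightarrow> real"
  diffusivity :: "real \<Rightarrow> real"


subsection \<open>Feller diffusions and their generators\<close>

definition natural_filtration :: "'w diffusion \<Rightarrow> real \<Rightarrow> 'w measure" where
  "natural_filtration X t =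
     sigma (space (events X))
       {path X u -` B \<inter> space (events X) | u B. 0 \<le> u \<and> u \<le> t \<and> B \<in> sets unit_borel}"

definition markov_law :: "'w diffusion \<Rightarrow> 'w measure \<Rightarrow> bool" where
  "markov_law X P \<longleftrightarrow>
     (\<forall>s\<ge>0. \<forall>t\<ge>0. \<forall>B\<in>sets unit_borel.
        AE \<omega> in P. real_cond_exp P (natural_filtration X s)
                      (\<lambda>\<omega>. indicator B (path X (s + t) \<omega>)) \<omega>
                    = measure (trans_kernel X t (path X s \<omega>)) B)"

definition markov_family :: "'w diffusion \<Rightarrow> bool" where
  "markov_family X \<longleftrightarrow>
     (\<forall>t\<ge>0. path X t \<in> events X \<rightarrow>\<^sub>M unit_borel) \<and>
     (\<forall>\<omega>\<in>space (events X). continuous_on {0..} (\<lambda>t. path X t \<omega>)) \<and>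
     (\<forall>\<mu>\<in>space (prob_algebra unit_borel).
        prob_space (law X \<mu>) \<and> sets (law X \<mu>) = sets (events X) \<and>
        distr (law X \<mu>) unit_borel (path X 0) = \<mu> \<and> markov_law X (law X \<mu>))"

definition semigroup_op :: "'w diffusion \<Rightarrow> real \<Rightarrow> (real \<Rightarrow> real) \<Rightarrow> real \<Rightarrow> real" where
  "semigroup_op X t f x = (\<integral>y. f y \<partial>trans_kernel X t x)"

definition feller_semigroup :: "'w diffusion \<Rightarrow> bool" where
  "feller_semigroup X \<longleftrightarrow>
     (\<forall>t\<ge>0. trans_kernel X t \<in> unit_borel \<rightarrow>\<^sub>M prob_algebra unit_borel) \<and>
     (\<forall>x\<in>{0..1}. trans_kernel X 0 x = return unit_borel x) \<and>
     (\<forall>s\<ge>0. \<forall>t\<ge>0. \<forall>x\<in>{0..1}.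
        trans_kernel X (s + t) x = trans_kernel X s x \<bind> trans_kernel X t) \<and>
     (\<forall>f. continuous_on {0..1} f \<longrightarrow>
        (\<forall>t\<ge>0. continuous_on {0..1} (semigroup_op X t f)) \<and>
        uniform_limit {0..1} (\<lambda>t. semigroup_op X t f) f (at_right 0))"

text \<open>
  The domain of the infinitesimal generator, as the strong derivative at \<open>0\<close> of the semigroup on
  \<open>C[0,1]\<close>. Elements of \<open>C[0,1]\<close> are represented by functions on the reals whose values outside
  \<open>[0,1]\<close> are unconstrained and play no role.
\<close>

definition gen_dom :: "'w diffusion \<Rightarrow> (real \<Rightarrow> real) set" where
  "gen_dom X = {f. continuous_on {0..1} f \<and>
     (\<exists>g. continuous_on {0..1} g \<and>
          uniform_limit {0..1} (\<lambda>t x. (semigroup_op X t f x - f x) / t) g (at_right 0))}"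

definition gen :: "'w diffusion \<Rightarrow> (real \<Rightarrow> real) \<Rightarrow> real \<Rightarrow> real" where
  "gen X f x = Lim (at_right 0) (\<lambda>t. (semigroup_op X t f x - f x) / t)"

definition C2_on_interior :: "(real \<Rightarrow> real) \<Rightarrow> bool" where
  "C2_on_interior f \<longleftrightarrow>
     f C1_differentiable_on {0<..<1} \<and> deriv f C1_differentiable_on {0<..<1}"

definition feller_diffusion :: "'w diffusion \<Rightarrow> bool" where
  "feller_diffusion X \<longleftrightarrow>
     markov_family X \<and> feller_semigroup X \<and>
     init X \<in> space (prob_algebra unit_borel) \<and>
     continuous_on {0<..<1} (drift X) \<and> continuous_on {0<..<1} (diffusivity X) \<and>
     (\<forall>x\<in>{0<..<1}. 0 < diffusivity X x) \<and>
     (\<forall>f\<in>gen_dom X. C2_on_interior f \<and>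
        (\<forall>x\<in>{0<..<1}. gen X f x
           = 1/2 * diffusivity X x * deriv (deriv f) x + drift X x * deriv f x))"

definition hitting_time :: "'w diffusion \<Rightarrow> real \<Rightarrow> 'w \<Rightarrow> ereal" where
  "hitting_time X y \<omega> = (INF t\<in>{t. 0 \<le> t \<and> path X t \<omega> = y}. ereal t)"

definition regular_diffusion :: "'w diffusion \<Rightarrow> bool" where
  "regular_diffusion X \<longleftrightarrow>
     (\<forall>x\<in>{0<..<1}. \<forall>y\<in>{0<..<1}.
        0 < measure (law X (return unit_borel x))
              {\<omega>\<in>space (events X). hitting_time X y \<omega> < \<infinity>})"


subsection \<open>Scale, speed and boundary classification\<close>

text \<open>
  The scale density and the scale and speed functions are normalised at the base point \<open>1/2\<close>; another
  base point rescales \<open>s\<close> and \<open>m\<close> by inverse positive constants and shifts \<open>S\<close> and \<open>M\<close>.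
\<close>

definition scale_density :: "'w diffusion \<Rightarrow> real \<Rightarrow> real" where
  "scale_density X x =
     exp (- (LBINT y=ereal (1/2)..ereal x. 2 * drift X y / diffusivity X y))"

definition speed_density :: "'w diffusion \<Rightarrow> real \<Rightarrow> real" where
  "speed_density X x = 1 / (scale_density X x * diffusivity X x)"

definition scale_fun :: "'w diffusion \<Rightarrow> real \<Rightarrow> real" where
  "scale_fun X x = (LBINT y=ereal (1/2)..ereal x. scale_density X y)"

definition speed_fun :: "'w diffusion \<Rightarrow> real \<Rightarrow> real" where
  "speed_fun X x = (LBINT y=ereal (1/2)..ereal x. speed_density X y)"

definition scale_measure :: "'w diffusion \<Rightarrow> real measure" where
  "scale_measure X =
     density (restrict_space lborel {0<..<1}) (\<lambda>x. ennreal (scale_density X x))"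

definition speed_measure :: "'w diffusion \<Rightarrow> real measure" where
  "speed_measure X =
     density (restrict_space lborel {0<..<1}) (\<lambda>x. ennreal (speed_density X x))"

datatype boundary = Lower | Upper

fun endpoint :: "boundary \<Rightarrow> real" where
  "endpoint Lower = 0"
| "endpoint Upper = 1"

fun inward_filter :: "boundary \<Rightarrow> real filter" where
  "inward_filter Lower = at_right 0"
| "inward_filter Upper = at_left 1"

fun feller_N :: "'w diffusion \<Rightarrow> boundary \<Rightarrow> real \<Rightarrow> ennreal" where
  "feller_N X Lower x =
     (\<integral>\<^sup>+\<eta>\<in>{0<..x}. ennreal (scale_fun X x - scale_fun X \<eta>) \<partial>speed_measure X)"
| "feller_N X Upper x =
     (\<integral>\<^sup>+\<eta>\<in>{x..<1}. ennreal (scale_fun X \<eta> - scale_fun X x) \<partial>speed_measure X)"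

fun feller_Sigma :: "'w diffusion \<Rightarrow> boundary \<Rightarrow> real \<Rightarrow> ennreal" where
  "feller_Sigma X Lower x =
     (\<integral>\<^sup>+\<eta>\<in>{0<..x}. ennreal (speed_fun X x - speed_fun X \<eta>) \<partial>scale_measure X)"
| "feller_Sigma X Upper x =
     (\<integral>\<^sup>+\<eta>\<in>{x..<1}. ennreal (speed_fun X \<eta> - speed_fun X x) \<partial>scale_measure X)"

text \<open>
  Finiteness of \<open>N\<close> and \<open>\<Sigma>\<close> does not depend on the interior point \<open>x\<close>; the definitions below
  quantify over all of them.
\<close>

definition entrance_boundary :: "'w diffusion \<Rightarrow> boundary \<Rightarrow> bool" where
  "entrance_boundary X e \<longleftrightarrow>
     (\<forall>x\<in>{0<..<1}. feller_N X e x < \<infinity> \<and> feller_Sigma X e x = \<infinity>)"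

definition exit_boundary :: "'w diffusion \<Rightarrow> boundary \<Rightarrow> bool" where
  "exit_boundary X e \<longleftrightarrow>
     (\<forall>x\<in>{0<..<1}. feller_N X e x = \<infinity> \<and> feller_Sigma X e x < \<infinity>)"

definition regular_boundary :: "'w diffusion \<Rightarrow> boundary \<Rightarrow> bool" where
  "regular_boundary X e \<longleftrightarrow>
     (\<forall>x\<in>{0<..<1}. feller_N X e x < \<infinity> \<and> feller_Sigma X e x < \<infinity>)"

definition reflecting_boundary :: "'w diffusion \<Rightarrow> boundary \<Rightarrow> bool" where
  "reflecting_boundary X e \<longleftrightarrow>
     regular_boundary X e \<and>
     (\<forall>f\<in>gen_dom X. ((\<lambda>x. deriv f x / scale_density X x) \<longlongrightarrow> 0) (inward_filter e))"

definition absorbing_boundary :: "'w diffusion \<Rightarrow> boundary \<Rightarrow> bool" where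
  "absorbing_boundary X e \<longleftrightarrow> (\<forall>f\<in>gen_dom X. gen X f (endpoint e) = 0)"


subsection \<open>Invariant distribution and strong stationary duality\<close>

text \<open>
  The invariant distribution is the speed measure normalised to a probability measure; this is
  meaningful when the total speed is finite, as it is for reflecting or entrance boundaries.
\<close>

definition stat_density :: "'w diffusion \<Rightarrow> real \<Rightarrow> real" where
  "stat_density X x = speed_density X x / measure (speed_measure X) {0<..<1}"

definition stat_cdf :: "'w diffusion \<Rightarrow> real \<Rightarrow> real" where
  "stat_cdf X x = (LBINT y=0..ereal x. stat_density X y)"

definition link :: "'w diffusion \<Rightarrow> (real \<Rightarrow> real) \<Rightarrow> real \<Rightarrow> real" where
  "link X f x =
     (if x = 0 then f 0
      else (LBINT y=0..ereal x. stat_density X y / stat_cdf X x * f y))"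

definition bounded_measurable :: "(real \<Rightarrow> real) set" where
  "bounded_measurable = {f. f \<in> borel_measurable unit_borel \<and> bounded (f ` {0..1})}"

definition strong_stationary_dual :: "'v diffusion \<Rightarrow> 'w diffusion \<Rightarrow> bool" where
  "strong_stationary_dual Xs X \<longleftrightarrow>
     feller_diffusion Xs \<and>
     (\<forall>f\<in>gen_dom X. link X f \<in> gen_dom Xs) \<and>
     (\<forall>f\<in>gen_dom X. \<forall>x\<in>{0..1}. link X (gen X f) x = gen Xs (link X f) x) \<and>
     (\<forall>f\<in>bounded_measurable. (\<integral>x. f x \<partial>init X) = (\<integral>x. link X f x \<partial>init Xs))"

end

theory Submission
  imports Defs "HOL-Real_Asymp.Real_Asymp"
begin

text \<open>
  For \<open>f\<close> in the domain of \<open>A\<close> the flux \<open>f'/s\<close> vanishes at both boundaries (at an entrance boundary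
  because \<open>f\<close> is bounded while the scale is infinite), so that \<open>\<Lambda>Af = (1/2) b (\<pi>/\<Pi>) f'\<close>. Comparing
  this with \<open>A\<^sup>*\<Lambda>f\<close> determines the coefficients of \<open>A\<^sup>*\<close>, provided that the domain of \<open>A\<close> is rich
  enough. It contains suitable \<open>C\<^sup>2\<close> step functions: the resolvent shows that \<open>1 - A\<close> maps its domain
  onto \<open>C[0,1]\<close>, and a maximum principle shows that \<open>1 - A\<close> is injective on all \<open>C\<^sup>2\<close> functions
  with vanishing flux. The dual diffusion then has scale density \<open>K \<pi>/\<Pi>\<^sup>2\<close> and speed density
  proportional to \<open>\<Pi>\<^sup>2 s\<close>, from which the boundary classification is read off. For absorption at 1,
  take \<open>g = \<Lambda>f\<close> with \<open>f\<close> a step function: \<open>A\<^sup>*g(1) = 0\<close>, the strict maximum of \<open>g\<close> is at 1, and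
  every \<open>k\<close> in the domain of \<open>A\<^sup>*\<close> satisfies \<open>\<bar>k(1) - k\<bar> \<le> C (g(1) - g)\<close>, hence \<open>A\<^sup>*k(1) = 0\<close>.
\<close>

section \<open>Resolvent of a Feller semigroup\<close>

text \<open>The obstacle is that both domains are given through the semigroups only: it is known how
  A acts on its domain, not which functions lie in it. Resolvent images supply the members. At a
  point x the relation \<Lambda>A = A*\<Lambda> sees f only through the two numbers f(x) -
  \<Lambda>f(x) and f'(x), because (\<Lambda>f)' = (\<pi>/\<Pi>)(f - \<Lambda>f); two independent
  choices of this pair fix both coefficients. Since \<pi>/\<Pi>^2 is the derivative of -1/\<Pi>, the
  dual scale is infinite at 0 and finite at 1. Near 1, where \<Pi> is bounded away from 0, passing
  to the dual interchanges scale and speed up to constants; this turns entrance into exit. In the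
  absorption argument, A*g(1) = 0 because it is the stationary mean of Af. The constant C exists
  because the dual flux of k stays bounded near 1 while g' is at least a multiple of the dual scale
  density there. Integrating the domination against the transition kernel started at 1 and dividing
  by t bounds the difference quotient of k at 1 in absolute value by -C times that of g, which tends
  to 0.\<close>

lemma continuous_bounded_interval:
  assumes "continuous_on {0..1} (h :: real \<Rightarrow> real)"
  shows "\<exists>B\<ge>0. \<forall>x\<in>{0..1}. \<bar>h x\<bar> \<le> B"
proof -
  have "bounded (h ` {0..1})"
    using assms by (intro compact_imp_bounded compact_continuous_image) auto
  then obtain B where "\<forall>x\<in>{0..1}. \<bar>h x\<bar> \<le> B"
    by (auto simp: bounded_iff)
  then show ?thesis
    by (intro exI[of _ "max 0 B"]) (auto simp: le_max_iff_disj)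
qed

text \<open>Only the semigroup is assumed, so that the resolvent theory serves \<open>X\<close> and
  the semigroup facts serve \<open>Xs\<close> as well.\<close>

locale feller_process =
  fixes X :: "'w diffusion"
  assumes feller: "feller_semigroup X"
begin

lemma kernel_prob:
  assumes "0 \<le> t" "x \<in> {0..1}"
  shows "prob_space (trans_kernel X t x)"
    and "sets (trans_kernel X t x) = sets unit_borel"
    and "space (trans_kernel X t x) = {0..1}"
proof -
  have "trans_kernel X t \<in> unit_borel \<rightarrow>\<^sub>M prob_algebra unit_borel"
    using feller assms by (auto simp: feller_semigroup_def)
  then have *: "trans_kernel X t x \<in> space (prob_algebra unit_borel)"
    by (rule measurable_space) (use assms in \<open>auto simp: space_restrict_space\<close>)
  show "prob_space (trans_kernel X t x)" "sets (trans_kernel X t x) = sets unit_borel"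
    using * by (auto simp: space_prob_algebra)
  then show "space (trans_kernel X t x) = {0..1}"
    by (metis sets_eq_imp_space_eq space_restrict_space2 sets.Int_space_eq1 atLeastAtMost_borel sets_lborel
        Int_UNIV_right space_borel space_restrict_space)
qed

lemma measurable_kernel:
  assumes "0 \<le> t" "x \<in> {0..1}" "continuous_on {0..1} (h :: real \<Rightarrow> real)"
  shows "h \<in> borel_measurable (trans_kernel X t x)"
proof -
  have "h \<in> borel_measurable unit_borel"
    using assms(3) by (rule borel_measurable_continuous_on_restrict)
  then show ?thesis
    using kernel_prob(2)[OF assms(1,2)] by (simp cong: measurable_cong_sets)
qed

lemma integrable_kernel:
  assumes "0 \<le> t" "x \<in> {0..1}" "continuous_on {0..1} (h :: real \<Rightarrow> real)"
  shows "integrable (trans_kernel X t x) h"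
proof -
  interpret prob_space "trans_kernel X t x" by (rule kernel_prob[OF assms(1,2)])
  obtain B where "0 \<le> B" and B: "\<And>x. x \<in> {0..1} \<Longrightarrow> \<bar>h x\<bar> \<le> B"
    using continuous_bounded_interval[OF assms(3)] by (auto simp del: atLeastAtMost_iff)
  from B show ?thesis
    using measurable_kernel[OF assms] kernel_prob(3)[OF assms(1,2)]
    by (intro integrable_const_bound[where B=B]) auto
qed

section \<open>Transition operators as positive contractions\<close>

lemma semigroup_op_diff:
  assumes "0 \<le> t" "x \<in> {0..1}" "continuous_on {0..1} h" "continuous_on {0..1} k"
  shows "semigroup_op X t (\<lambda>y. h y - k y) x = semigroup_op X t h x - semigroup_op X t k x"
  unfolding semigroup_op_def using assms by (intro Bochner_Integration.integral_diff integrable_kernel)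

lemma semigroup_op_const:
  assumes "0 \<le> t" "x \<in> {0..1}"
  shows "semigroup_op X t (\<lambda>y. c) x = c"
proof -
  interpret prob_space "trans_kernel X t x" by (rule kernel_prob[OF assms])
  show ?thesis unfolding semigroup_op_def by (simp add: prob_space)
qed

lemma semigroup_op_mono:
  assumes "0 \<le> t" "x \<in> {0..1}" "continuous_on {0..1} h" "continuous_on {0..1} k"
    and "\<And>y. y \<in> {0..1} \<Longrightarrow> h y \<le> k y"
  shows "semigroup_op X t h x \<le> semigroup_op X t k x"
  unfolding semigroup_op_def using assms kernel_prob(3)[OF assms(1,2)]
  by (intro integral_mono integrable_kernel) auto

lemma semigroup_op_cmult:
  "semigroup_op X t (\<lambda>y. c * h y) x = c * semigroup_op X t h x"
  unfolding semigroup_op_def by (cases "c = 0") auto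

lemma semigroup_op_bound:
  assumes "0 \<le> t" "x \<in> {0..1}" "continuous_on {0..1} h" "\<And>y. y \<in> {0..1} \<Longrightarrow> \<bar>h y\<bar> \<le> B"
  shows "\<bar>semigroup_op X t h x\<bar> \<le> B"
proof -
  have "semigroup_op X t h x \<le> semigroup_op X t (\<lambda>_. B) x"
    using assms(4) by (intro semigroup_op_mono assms continuous_intros) (auto simp: abs_le_iff)
  moreover have "semigroup_op X t (\<lambda>_. - B) x \<le> semigroup_op X t h x"
    using assms(4) by (intro semigroup_op_mono assms continuous_intros) (auto simp: abs_le_iff minus_le_iff)
  ultimately show ?thesis using assms by (simp add: semigroup_op_const abs_le_iff)
qed

lemma continuous_on_semigroup_op:
  "0 \<le> t \<Longrightarrow> continuous_on {0..1} h \<Longrightarrow> continuous_on {0..1} (semigroup_op X t h)"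
  using feller by (auto simp: feller_semigroup_def)

lemma semigroup_op_add:
  assumes "0 \<le> s" "0 \<le> t" "x \<in> {0..1}" "continuous_on {0..1} h"
  shows "semigroup_op X (s + t) h x = semigroup_op X s (semigroup_op X t h) x"
proof -
  interpret prob_space "trans_kernel X s x" by (rule kernel_prob[OF assms(1,3)])
  obtain B where "0 \<le> B" and B: "\<And>x. x \<in> {0..1} \<Longrightarrow> \<bar>h x\<bar> \<le> B"
    using continuous_bounded_interval[OF assms(4)] by (auto simp del: atLeastAtMost_iff)
  have sp: "space unit_borel = {0..1}" by (simp add: space_restrict_space)
  have "trans_kernel X t \<in> unit_borel \<rightarrow>\<^sub>M prob_algebra unit_borel"
    using feller assms by (auto simp: feller_semigroup_def)
  then have "trans_kernel X t \<in> unit_borel \<rightarrow>\<^sub>M subprob_algebra unit_borel"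
    by (rule measurable_prob_algebraD)
  then have m: "trans_kernel X t \<in> trans_kernel X s x \<rightarrow>\<^sub>M subprob_algebra unit_borel"
    using kernel_prob(2)[OF assms(1,3)] by (simp cong: measurable_cong_sets)
  have "trans_kernel X (s + t) x = trans_kernel X s x \<bind> trans_kernel X t"
    using feller assms by (auto simp: feller_semigroup_def)
  moreover have "integral\<^sup>L (trans_kernel X s x \<bind> trans_kernel X t) h
      = (\<integral>y. integral\<^sup>L (trans_kernel X t y) h \<partial>trans_kernel X s x)"
  proof (rule integral_bind[OF _ _ m])
    show "h \<in> borel_measurable unit_borel"
      using assms(4) by (rule borel_measurable_continuous_on_restrict)
    show "\<bar>h x\<bar> \<le> B" if "x \<in> space unit_borel" for x
      using B that sp by auto
    show "finite_measure (trans_kernel X s x)" by unfold_locales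
    show "AE y in trans_kernel X s x. emeasure (trans_kernel X t y) (space (trans_kernel X t y)) \<le> ennreal 1"
      using kernel_prob(1)[OF assms(2)] kernel_prob(3)[OF assms(1,3)]
      by (auto simp: prob_space.emeasure_space_1)
  qed
  ultimately show ?thesis unfolding semigroup_op_def by simp
qed

text \<open>For s < t the difference of the operators at s and t is the operator at s applied to the
  increment over the time t - s. Contractivity therefore carries the uniform continuity at time 0 to
  all times with the same d.\<close>

lemma semigroup_op_uniformly_continuous_time:
  assumes h: "continuous_on {0..1} h" and "0 < e"
  obtains d where "0 < d"
    and "\<And>s t x. 0 \<le> s \<Longrightarrow> 0 \<le> t \<Longrightarrow> \<bar>s - t\<bar> < d \<Longrightarrow> x \<in> {0..1} \<Longrightarrow>
           \<bar>semigroup_op X s h x - semigroup_op X t h x\<bar> \<le> e"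
proof -
  have "uniform_limit {0..1} (\<lambda>t. semigroup_op X t h) h (at_right 0)"
    using feller h by (auto simp: feller_semigroup_def)
  from uniform_limitD[OF this \<open>0 < e\<close>]
  obtain d where d: "0 < d" "\<And>t x. 0 < t \<Longrightarrow> t < d \<Longrightarrow> x \<in> {0..1} \<Longrightarrow> \<bar>semigroup_op X t h x - h x\<bar> < e"
    unfolding eventually_at_right_field dist_real_def by blast
  have le: "\<bar>semigroup_op X s h x - semigroup_op X t h x\<bar> \<le> e"
    if "0 \<le> s" "s < t" "t - s < d" "x \<in> {0..1}" for s t x
  proof -
    have c: "continuous_on {0..1} (semigroup_op X (t - s) h)"
      using that h by (intro continuous_on_semigroup_op) auto
    have "semigroup_op X t h x = semigroup_op X s (semigroup_op X (t - s) h) x"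
      using semigroup_op_add[of s "t - s" x h] that h by simp
    then have "semigroup_op X t h x - semigroup_op X s h x
        = semigroup_op X s (\<lambda>y. semigroup_op X (t - s) h y - h y) x"
      using semigroup_op_diff[OF \<open>0 \<le> s\<close> that(4) c h] by simp
    also have "\<bar>\<dots>\<bar> \<le> e"
      using that d(2)[of "t - s"]
      by (intro semigroup_op_bound continuous_intros c h) (auto intro: less_imp_le)
    finally show ?thesis by (simp add: abs_minus_commute)
  qed
  show ?thesis
  proof
    fix s t x :: real assume a: "0 \<le> s" "0 \<le> t" "\<bar>s - t\<bar> < d" "x \<in> {0..1}"
    then show "\<bar>semigroup_op X s h x - semigroup_op X t h x\<bar> \<le> e"
      using le[of s t x] le[of t s x] \<open>0 < e\<close> by (cases s t rule: linorder_cases) (auto simp: abs_minus_commute)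
  qed (fact d)
qed

text \<open>Clamping both arguments turns the semigroup into a globally continuous function of time and
  position, which settles all measurability questions.\<close>

definition flow :: "(real \<Rightarrow> real) \<Rightarrow> real \<Rightarrow> real \<Rightarrow> real" where
  "flow h t x = semigroup_op X (max 0 t) h (max 0 (min 1 x))"

lemma flow_eq: "0 \<le> t \<Longrightarrow> x \<in> {0..1} \<Longrightarrow> flow h t x = semigroup_op X t h x"
  by (simp add: flow_def)

lemma flow_bound:
  "continuous_on {0..1} h \<Longrightarrow> (\<And>y. y \<in> {0..1} \<Longrightarrow> \<bar>h y\<bar> \<le> B) \<Longrightarrow> \<bar>flow h t x\<bar> \<le> B"
  unfolding flow_def by (rule semigroup_op_bound) auto

text \<open>The modulus of continuity in time is uniform in the position, so it suffices to combine
  it with continuity in the position at the single time t; each contributes e/2.\<close>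

lemma continuous_flow:
  assumes h: "continuous_on {0..1} h"
  shows "continuous_on UNIV (\<lambda>(t, x). flow h t x)"
  unfolding continuous_on_eq_continuous_within
proof (safe)
  fix t x :: real
  let ?c = "\<lambda>x::real. max 0 (min 1 x)"
  show "isCont (\<lambda>(t, x). flow h t x) (t, x)"
    unfolding continuous_at_eps_delta
  proof (intro allI impI)
    fix e :: real assume "0 < e"
    obtain d where d: "0 < d" "\<And>s t x. 0 \<le> s \<Longrightarrow> 0 \<le> t \<Longrightarrow> \<bar>s - t\<bar> < d \<Longrightarrow> x \<in> {0..1} \<Longrightarrow>
           \<bar>semigroup_op X s h x - semigroup_op X t h x\<bar> \<le> e/2"
      by (rule semigroup_op_uniformly_continuous_time[OF h, of "e/2"]) (use \<open>0 < e\<close> in auto)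
    have "continuous_on UNIV (\<lambda>y. semigroup_op X (max 0 t) h (?c y))"
      by (rule continuous_on_compose2[OF continuous_on_semigroup_op[OF _ h]])
         (auto intro!: continuous_intros)
    then have "isCont (\<lambda>y. flow h t y) x"
      by (simp add: flow_def[abs_def] continuous_on_eq_continuous_at)
    then obtain d' where d': "0 < d'" "\<And>y. \<bar>y - x\<bar> < d' \<Longrightarrow> \<bar>flow h t y - flow h t x\<bar> < e/2"
      unfolding continuous_at_eps_delta dist_real_def using \<open>0 < e\<close> by (meson half_gt_zero)
    have "\<bar>flow h s y - flow h t x\<bar> < e" if "\<bar>s - t\<bar> < d" "\<bar>y - x\<bar> < d'" for s y
    proof -
      have "\<bar>flow h s y - flow h t y\<bar> \<le> e/2"
        unfolding flow_def by (rule d(2)) (use that in auto)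
      with d'(2)[OF that(2)] show ?thesis by linarith
    qed
    moreover have "\<bar>fst p - t\<bar> < min d d'" "\<bar>snd p - x\<bar> < min d d'" if "dist p (t, x) < min d d'" for p
      using dist_fst_le[of p "(t,x)"] dist_snd_le[of p "(t,x)"] that by (auto simp: dist_real_def)
    ultimately show "\<exists>d>0. \<forall>x'. dist x' (t, x) < d \<longrightarrow>
        dist (case x' of (t, x) \<Rightarrow> flow h t x) (case (t, x) of (t, x) \<Rightarrow> flow h t x) < e"
      using d(1) d'(1) by (intro exI[of _ "min d d'"]) (force simp: dist_real_def split: prod.splits)
  qed
qed

lemma measurable_flow:
  assumes "continuous_on {0..1} h"
  shows "(\<lambda>(t, x). flow h t x) \<in> borel_measurable (borel \<Otimes>\<^sub>M borel)"
  using borel_measurable_continuous_onI[OF continuous_flow[OF assms]] by (simp add: borel_prod)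

text \<open>The Laplace transform of the semigroup at rate 1, that is, the inverse of 1 - A. A
  single positive rate is enough to produce members of the domain.\<close>

definition resolvent :: "(real \<Rightarrow> real) \<Rightarrow> real \<Rightarrow> real" where
  "resolvent h x = (\<integral>t. indicator {0..} t * exp (- t) * flow h t x \<partial>lborel)"

section \<open>Existence and continuity of the resolvent\<close>

lemma integral_exp_minus:
  "has_bochner_integral lborel (\<lambda>t::real. indicator {0..} t * exp (- t)) 1"
proof (rule has_bochner_integral_nn_integral)
  have "((\<lambda>t::real. - exp (- t)) \<longlongrightarrow> 0) at_top"
    by real_asymp
  then have "(\<integral>\<^sup>+t. ennreal (exp (- t)) * indicator {0::real..} t \<partial>lborel) = ennreal (0 - (- exp (- 0)))"
    by (intro nn_integral_FTC_atLeast) (auto intro!: derivative_eq_intros)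
  then show "(\<integral>\<^sup>+t. ennreal (indicator {0..} t * exp (- t)) \<partial>lborel) = ennreal 1"
    by (simp add: ennreal_mult' ennreal_indicator mult.commute)
qed auto

lemma integrable_resolvent:
  assumes "continuous_on {0..1} h"
  shows "integrable lborel (\<lambda>t. indicator {0..} t * exp (- t) * flow h t x)"
proof -
  obtain B where "0 \<le> B" and B: "\<And>x. x \<in> {0..1} \<Longrightarrow> \<bar>h x\<bar> \<le> B"
    using continuous_bounded_interval[OF assms] by (auto simp del: atLeastAtMost_iff)
  have "integrable lborel (\<lambda>t. B * (indicator {0..} t * exp (- t)))"
    using integral_exp_minus by (intro integrable_mult_right) (auto simp: has_bochner_integral_iff)
  then show ?thesis
  proof (rule Bochner_Integration.integrable_bound)
    have "(\<lambda>t. case (t, x) of (t, x) \<Rightarrow> flow h t x) \<in> borel_measurable borel"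
      by (rule measurable_compose[OF _ measurable_flow[OF assms]]) simp
    then show "(\<lambda>t. indicator {0..} t * exp (- t) * flow h t x) \<in> borel_measurable lborel"
      by simp
    show "AE t in lborel. norm (indicator {0..} t * exp (- t) * flow h t x)
        \<le> norm (B * (indicator {0..} t * exp (- t)))"
      using flow_bound[OF assms B, of _ x]
      by (intro AE_I2) (auto simp: abs_mult indicator_def mult.commute intro: order_trans[OF _ abs_ge_self])
  qed
qed

lemma continuous_resolvent:
  assumes h: "continuous_on {0..1} h"
  shows "continuous_on {0..1} (resolvent h)"
  unfolding continuous_on_def
proof
  fix x :: real assume "x \<in> {0..1}"
  obtain B where "0 \<le> B" and B: "\<And>x. x \<in> {0..1} \<Longrightarrow> \<bar>h x\<bar> \<le> B"
    using continuous_bounded_interval[OF assms] by (auto simp del: atLeastAtMost_iff)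
  show "(resolvent h \<longlongrightarrow> resolvent h x) (at x within {0..1})"
    unfolding tendsto_at_iff_sequentially
  proof safe
    fix y assume y: "y \<longlonglongrightarrow> x"
    show "(resolvent h \<circ> y) \<longlonglongrightarrow> resolvent h x"
      unfolding resolvent_def o_def
    proof (rule integral_dominated_convergence[where w="\<lambda>t. B * (indicator {0..} t * exp (- t))"])
      show "integrable lborel (\<lambda>t. B * (indicator {0..} t * exp (- t)))"
        using integral_exp_minus by (intro integrable_mult_right) (auto simp: has_bochner_integral_iff)
      show "AE t in lborel. norm (indicator {0..} t * exp (- t) * flow h t (y i))
        \<le> B * (indicator {0..} t * exp (- t))" for i
        using flow_bound[OF h B, of _ "y i"]
        by (intro AE_I2) (auto simp: abs_mult indicator_def mult.commute)
      have "isCont (\<lambda>y. flow h t y) x" for t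
      proof -
        have "continuous_on UNIV (\<lambda>y. case (t, y) of (t, x) \<Rightarrow> flow h t x)"
          by (rule continuous_on_compose2[OF continuous_flow[OF h]]) (auto intro!: continuous_intros)
        then show ?thesis
          by (simp add: continuous_on_eq_continuous_at)
      qed
      then have "(\<lambda>i. flow h t (y i)) \<longlonglongrightarrow> flow h t x" for t
        by (rule isCont_tendsto_compose[OF _ y])
      then show "AE t in lborel. (\<lambda>i. indicator {0..} t * exp (- t) * flow h t (y i))
         \<longlonglongrightarrow> indicator {0..} t * exp (- t) * flow h t x"
        by (intro AE_I2 tendsto_intros)
    qed (rule borel_measurable_integrable[OF integrable_resolvent[OF h]])+
  qed
qed

text \<open>By Fubini and the semigroup law, the operator at time e turns the flow at time t into
  the flow at time e + t. Substituting back gives the factor exp e and removes the times in [0,e)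
  from the Laplace integral.\<close>

lemma semigroup_op_resolvent:
  assumes h: "continuous_on {0..1} h" and "0 < e" "x \<in> {0..1}"
  shows "semigroup_op X e (resolvent h) x
       = exp e * (resolvent h x - (\<integral>t. indicator {0..<e} t * exp (- t) * flow h t x \<partial>lborel))"
proof -
  obtain B where "0 \<le> B" and B: "\<And>x. x \<in> {0..1} \<Longrightarrow> \<bar>h x\<bar> \<le> B"
    using continuous_bounded_interval[OF h] by (auto simp del: atLeastAtMost_iff)
  let ?K = "trans_kernel X e x"
  let ?f = "\<lambda>y t. indicator {0..} t * exp (- t) * flow h t y"
  have e: "0 \<le> e" using \<open>0 < e\<close> by simp
  interpret K: prob_space ?K by (rule kernel_prob[OF e assms(3)])
  interpret P: pair_sigma_finite lborel ?K
    by (simp add: pair_sigma_finite_def lborel.sigma_finite_measure_axioms K.sigma_finite_measure_axioms)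
  have [measurable_cong]: "sets ?K = sets unit_borel" by (rule kernel_prob[OF e assms(3)])
  have "(\<lambda>y. y) \<in> unit_borel \<rightarrow>\<^sub>M borel"
    by (intro measurable_restrict_space1) simp
  then have [measurable]: "(\<lambda>y. y) \<in> ?K \<rightarrow>\<^sub>M borel"
    by (simp cong: measurable_cong_sets)
  have fm[measurable]: "(\<lambda>p. flow h (fst p) (snd p)) \<in> borel_measurable (lborel \<Otimes>\<^sub>M ?K)"
  proof -
    have "(\<lambda>p. (fst p, (\<lambda>y. y) (snd p))) \<in> lborel \<Otimes>\<^sub>M ?K \<rightarrow>\<^sub>M borel \<Otimes>\<^sub>M borel"
      by measurable
    from measurable_compose[OF this measurable_flow[OF h]] show ?thesis by simp
  qed
  have "integrable (lborel \<Otimes>\<^sub>M ?K) (\<lambda>(t, y). B * (indicator {0..} t * exp (- t)))"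
  proof (rule P.Fubini_integrable)
    have "integrable lborel (\<lambda>t. B * (indicator {0..} t * exp (- t)))"
      using integral_exp_minus by (intro integrable_mult_right) (auto simp: has_bochner_integral_iff)
    from integrable_norm[OF this]
    show "integrable lborel (\<lambda>t. \<integral>y. norm (case (t, y) of (t, y) \<Rightarrow> B * (indicator {0..} t * exp (- t))) \<partial>?K)"
      by (simp add: K.prob_space)
  qed auto
  then have int: "integrable (lborel \<Otimes>\<^sub>M ?K) (\<lambda>(t, y). ?f y t)"
  proof (rule Bochner_Integration.integrable_bound)
    show "(\<lambda>(t, y). ?f y t) \<in> borel_measurable (lborel \<Otimes>\<^sub>M ?K)"
      unfolding case_prod_beta by measurable
    show "AE p in lborel \<Otimes>\<^sub>M ?K. norm (case p of (t, y) \<Rightarrow> ?f y t)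
        \<le> norm (case p of (t, y) \<Rightarrow> B * (indicator {0..} t * exp (- t)))"
      using flow_bound[OF h B] \<open>0 \<le> B\<close>
      by (intro AE_I2) (auto simp: abs_mult indicator_def mult.commute)
  qed
  have "semigroup_op X e (resolvent h) x = (\<integral>y. \<integral>t. ?f y t \<partial>lborel \<partial>?K)"
    by (simp add: semigroup_op_def resolvent_def)
  also have "\<dots> = (\<integral>t. \<integral>y. ?f y t \<partial>?K \<partial>lborel)"
    using P.Fubini_integral[OF int] by simp
  also have "\<dots> = (\<integral>t. indicator {0..} t * exp (- t) * flow h (e + t) x \<partial>lborel)"
  proof (intro Bochner_Integration.integral_cong refl)
    fix t :: real
    have "(\<integral>y. flow h t y \<partial>?K) = flow h (e + t) x" if "0 \<le> t"
    proof -
      have "(\<integral>y. flow h t y \<partial>?K) = semigroup_op X e (semigroup_op X t h) x"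
        unfolding semigroup_op_def[of X e]
        using that kernel_prob(3)[OF e assms(3)]
        by (intro Bochner_Integration.integral_cong) (auto simp: flow_eq)
      with that e assms show ?thesis
        by (simp add: flow_eq semigroup_op_add)
    qed
    then show "(\<integral>y. ?f y t \<partial>?K) = indicator {0..} t * exp (- t) * flow h (e + t) x"
      by (cases "0 \<le> t") (auto simp: indicator_def)
  qed
  \<comment> \<open>The argument is written \<open>e + 1 * t\<close> to match the affine
    substitution rule \<open>lborel_integral_real_affine\<close>.\<close>
  also have "\<dots> = (\<integral>t. exp e * (indicator {e..} (e + 1 * t) * exp (- (e + 1 * t)) * flow h (e + 1 * t) x) \<partial>lborel)"
  proof (intro Bochner_Integration.integral_cong refl)
    fix t :: real
    have "exp e * exp (- (e + 1 * t)) = exp (- t)" by (simp add: mult_exp_exp)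
    then have "exp e * (i * exp (- (e + 1 * t)) * r) = i * exp (- t) * r" for i r
      by (metis mult.assoc mult.commute)
    then show "indicator {0..} t * exp (- t) * flow h (e + t) x
        = exp e * (indicator {e..} (e + 1 * t) * exp (- (e + 1 * t)) * flow h (e + 1 * t) x)"
      by (simp only: ) (simp add: indicator_def)
  qed
  also have "\<dots> = exp e * (\<integral>t. indicator {e..} t * exp (- t) * flow h t x \<partial>lborel)"
    using lborel_integral_real_affine[of 1 "\<lambda>t. indicator {e..} t * exp (- t) * flow h t x" e] by simp
  also have "(\<integral>t. indicator {e..} t * exp (- t) * flow h t x \<partial>lborel)
     = resolvent h x - (\<integral>t. indicator {0..<e} t * exp (- t) * flow h t x \<partial>lborel)"
  proof -
    have "integrable lborel (\<lambda>t. indicator {0..<e} t * (indicator {0..} t * exp (- t) * flow h t x))"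
      using integrable_real_mult_indicator[OF _ integrable_resolvent[OF h, of x], of "{0..<e}"]
      by (simp add: mult.commute)
    moreover have "indicator {0..<e} t * (indicator {0..} t * exp (- t) * flow h t x)
        = indicator {0..<e} t * exp (- t) * flow h t x" for t :: real
      by (auto simp: indicator_def)
    ultimately have i: "integrable lborel (\<lambda>t. indicator {0..<e} t * exp (- t) * flow h t x)"
      by simp
    have "indicator {e..} t * exp (- t) * flow h t x
        = indicator {0..} t * exp (- t) * flow h t x - indicator {0..<e} t * exp (- t) * flow h t x" for t
      using e by (auto simp: indicator_def)
    then show ?thesis
      unfolding resolvent_def using Bochner_Integration.integral_diff[OF integrable_resolvent[OF h, of x] i]
      by simp
  qed
  finally show ?thesis .
qed

text \<open>The quotient is the average of exp(-u) times the flow over [0,t). Both factors are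
  controlled uniformly in x for small u: the flow is within \<epsilon>/2 of h by strong continuity,
  and the exponential costs at most (1 - exp(-u)) B.\<close>

lemma resolvent_difference_quotient:
  assumes h: "continuous_on {0..1} h" and "0 < \<epsilon>"
  shows "\<forall>\<^sub>F t in at_right 0. \<forall>x\<in>{0..1}.
     \<bar>(\<integral>u. indicator {0..<t} u * exp (- u) * flow h u x \<partial>lborel) / t - h x\<bar> \<le> \<epsilon>"
proof -
  obtain B where "0 \<le> B" and B: "\<And>x. x \<in> {0..1} \<Longrightarrow> \<bar>h x\<bar> \<le> B"
    using continuous_bounded_interval[OF h] by (auto simp del: atLeastAtMost_iff)
  have k0: "semigroup_op X 0 h x = h x" if "x \<in> {0..1}" for x
  proof -
    have "trans_kernel X 0 x = return unit_borel x"
      using feller that by (auto simp: feller_semigroup_def)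
    then show ?thesis
      unfolding semigroup_op_def
      using integral_return[OF _ borel_measurable_continuous_on_restrict[OF h], of x] that
      by (simp only: space_restrict_space space_borel Int_UNIV_right)
  qed
  obtain d where d: "0 < d" "\<And>s t x. 0 \<le> s \<Longrightarrow> 0 \<le> t \<Longrightarrow> \<bar>s - t\<bar> < d \<Longrightarrow> x \<in> {0..1} \<Longrightarrow>
         \<bar>semigroup_op X s h x - semigroup_op X t h x\<bar> \<le> \<epsilon>/2"
    by (rule semigroup_op_uniformly_continuous_time[OF h, of "\<epsilon>/2"]) (use \<open>0 < \<epsilon>\<close> in auto)
  have "((\<lambda>u::real. (1 - exp (- u)) * B) \<longlongrightarrow> 0) (at_right 0)"
    by (auto intro!: tendsto_eq_intros)
  then have "\<forall>\<^sub>F u in at_right 0. (1 - exp (- u)) * B < \<epsilon>/2"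
    using \<open>0 < \<epsilon>\<close> by (intro order_tendstoD(2)) auto
  then obtain d' where d': "0 < d'" "\<And>u. 0 < u \<Longrightarrow> u < d' \<Longrightarrow> (1 - exp (- u)) * B < \<epsilon>/2"
    unfolding eventually_at_right_field by auto
  have *: "\<bar>exp (- u) * flow h u x - h x\<bar> \<le> \<epsilon>" if "0 \<le> u" "u < min d d'" "x \<in> {0..1}" for u x
  proof -
    have 1: "\<bar>flow h u x - h x\<bar> \<le> \<epsilon>/2"
      using d(2)[of u 0 x] that k0 by (simp add: flow_eq)
    have "\<bar>exp (- u) * flow h u x - flow h u x\<bar> = (1 - exp (- u)) * \<bar>flow h u x\<bar>"
    proof -
      have "exp (- u) * flow h u x - flow h u x = - ((1 - exp (- u)) * flow h u x)"
        by (simp add: algebra_simps)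
      moreover have "0 \<le> 1 - exp (- u)" using that by simp
      ultimately show ?thesis by (simp only: abs_minus_cancel abs_mult abs_of_nonneg)
    qed
    also have "\<dots> \<le> (1 - exp (- u)) * B"
      using that flow_bound[OF h B] by (intro mult_left_mono) auto
    also have "\<dots> \<le> \<epsilon>/2"
      using d'(2)[of u] that \<open>0 < \<epsilon>\<close> by (cases "u = 0") (auto intro: less_imp_le)
    finally show ?thesis using 1 by linarith
  qed
  have "\<bar>(\<integral>u. indicator {0..<t} u * exp (- u) * flow h u x \<partial>lborel) / t - h x\<bar> \<le> \<epsilon>"
    if t: "0 < t" "t < min d d'" and x: "x \<in> {0..1}" for t x
  proof -
    have "integrable lborel (\<lambda>u. indicator {0..<t} u * (indicator {0..} u * exp (- u) * flow h u x))"
      using integrable_real_mult_indicator[OF _ integrable_resolvent[OF h, of x], of "{0..<t}"]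
      by (simp add: mult.commute)
    moreover have "indicator {0..<t} u * (indicator {0..} u * exp (- u) * flow h u x)
        = indicator {0..<t} u * exp (- u) * flow h u x" for u :: real
      by (auto simp: indicator_def)
    ultimately have i: "integrable lborel (\<lambda>u. indicator {0..<t} u * exp (- u) * flow h u x)"
      by simp
    have c: "has_bochner_integral lborel (\<lambda>u. indicator {0..<t} u * c) (t * c)" for c :: real
      using has_bochner_integral_mult_left[OF has_bochner_integral_real_indicator[of "{0..<t}" lborel], of c] t
      by simp
    have "(\<integral>u. indicator {0..<t} u * exp (- u) * flow h u x \<partial>lborel) \<le> (\<integral>u. indicator {0..<t} u * (h x + \<epsilon>) \<partial>lborel)"
    proof (intro integral_mono i)
      show "integrable lborel (\<lambda>u. indicator {0..<t} u * (h x + \<epsilon>))"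
        using c by (rule integrable.intros)
      show "indicator {0..<t} u * exp (- u) * flow h u x \<le> indicator {0..<t} u * (h x + \<epsilon>)" for u
        using *[of u x] t x by (auto simp: indicator_def abs_le_iff)
    qed
    moreover have "(\<integral>u. indicator {0..<t} u * (h x - \<epsilon>) \<partial>lborel) \<le> (\<integral>u. indicator {0..<t} u * exp (- u) * flow h u x \<partial>lborel)"
    proof (intro integral_mono i)
      show "integrable lborel (\<lambda>u. indicator {0..<t} u * (h x - \<epsilon>))"
        using c by (rule integrable.intros)
      show "indicator {0..<t} u * (h x - \<epsilon>) \<le> indicator {0..<t} u * exp (- u) * flow h u x" for u
        using *[of u x] t x by (auto simp: indicator_def abs_le_iff)
    qed
    moreover note has_bochner_integral_integral_eq[OF c, of "h x + \<epsilon>"]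
      has_bochner_integral_integral_eq[OF c, of "h x - \<epsilon>"]
    ultimately have "h x - \<epsilon> \<le> (\<integral>u. indicator {0..<t} u * exp (- u) * flow h u x \<partial>lborel) / t"
      "(\<integral>u. indicator {0..<t} u * exp (- u) * flow h u x \<partial>lborel) / t \<le> h x + \<epsilon>"
      using t by (simp_all only: pos_le_divide_eq pos_divide_le_eq mult.commute[of t])
    then show ?thesis by linarith
  qed
  moreover have "0 < min d d'" using d(1) d'(1) by simp
  ultimately show ?thesis
    unfolding eventually_at_right_field by blast
qed

lemma resolvent_generator_limit:
  assumes h: "continuous_on {0..1} h"
  shows "uniform_limit {0..1} (\<lambda>t x. (semigroup_op X t (resolvent h) x - resolvent h x) / t)
           (\<lambda>x. resolvent h x - h x) (at_right 0)"
proof (rule uniform_limitI)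
  fix \<epsilon> :: real assume "0 < \<epsilon>"
  obtain B where "0 \<le> B" and B: "\<And>x. x \<in> {0..1} \<Longrightarrow> \<bar>resolvent h x\<bar> \<le> B"
    using continuous_bounded_interval[OF continuous_resolvent[OF h]] by (auto simp del: atLeastAtMost_iff)
  obtain B' where "0 \<le> B'" and B': "\<And>x. x \<in> {0..1} \<Longrightarrow> \<bar>h x\<bar> \<le> B'"
    using continuous_bounded_interval[OF h] by (auto simp del: atLeastAtMost_iff)
  let ?J = "\<lambda>t x. (\<integral>u. indicator {0..<t} u * exp (- u) * flow h u x \<partial>lborel) / t"
  have "((\<lambda>t::real. \<bar>(exp t - 1) / t - 1\<bar> * B + \<bar>exp t - 1\<bar> * B') \<longlongrightarrow> 0) (at_right 0)"
    by real_asymp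
  then have 1: "\<forall>\<^sub>F t in at_right 0. \<bar>(exp t - 1) / t - 1\<bar> * B + \<bar>exp t - 1\<bar> * B' < \<epsilon>/2"
    using \<open>0 < \<epsilon>\<close> by (intro order_tendstoD(2)) auto
  have "((\<lambda>t::real. exp t) \<longlongrightarrow> 1) (at_right 0)"
    by (auto intro!: tendsto_eq_intros)
  then have 2: "\<forall>\<^sub>F t in at_right 0. exp t < (2 :: real)"
    by (intro order_tendstoD(2)) auto
  \<comment> \<open>A quarter of \<epsilon>, because this error enters below with the factor exp t,
    which is less than 2.\<close>
  have 3: "\<forall>\<^sub>F t in at_right 0. \<forall>x\<in>{0..1}. \<bar>?J t x - h x\<bar> \<le> \<epsilon>/4"
    using resolvent_difference_quotient[OF h, of "\<epsilon>/4"] \<open>0 < \<epsilon>\<close> by simp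
  show "\<forall>\<^sub>F t in at_right 0. \<forall>x\<in>{0..1}.
    dist ((semigroup_op X t (resolvent h) x - resolvent h x) / t) (resolvent h x - h x) < \<epsilon>"
    using 1 2 3 eventually_at_right_less[of 0]
  proof eventually_elim
    case (elim t)
    show ?case
    proof
      fix x :: real assume x: "x \<in> {0..1}"
      \<comment> \<open>The error splits into three terms that vanish uniformly: the first two have
        bounded functions with scalar coefficients tending to 0, the third is the averaging
        error.\<close>
      have eq: "(semigroup_op X t (resolvent h) x - resolvent h x) / t - (resolvent h x - h x)
         = ((exp t - 1) / t - 1) * resolvent h x - (exp t - 1) * h x - exp t * (?J t x - h x)"
      proof -
        have "(exp t * (r - j) - r) / t - (r - y) = ((exp t - 1) / t - 1) * r - (exp t - 1) * y - exp t * (j / t - y)"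
          for r j y :: real
          using elim(4) by (simp add: field_simps)
        then show ?thesis
          using semigroup_op_resolvent[OF h elim(4) x] by (simp only:)
      qed
      have "\<bar>((exp t - 1) / t - 1) * resolvent h x - (exp t - 1) * h x - exp t * (?J t x - h x)\<bar>
         \<le> \<bar>(exp t - 1) / t - 1\<bar> * \<bar>resolvent h x\<bar> + \<bar>exp t - 1\<bar> * \<bar>h x\<bar> + exp t * \<bar>?J t x - h x\<bar>"
      proof -
        have tri: "abs (p - q - r) \<le> abs p + abs q + abs r" for p q r :: real
          by linarith
        show ?thesis
          by (rule order_trans[OF tri]) (simp only: abs_mult abs_exp_cancel order_refl)
      qed
      also have "\<dots> \<le> \<bar>(exp t - 1) / t - 1\<bar> * B + \<bar>exp t - 1\<bar> * B' + 2 * (\<epsilon>/4)"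
      proof -
        have "exp t \<le> 2" "\<bar>?J t x - h x\<bar> \<le> \<epsilon>/4" using elim(2,3) x by (simp, blast)
        then show ?thesis
          by (intro add_mono mult_mono B[OF x] B'[OF x] order_refl abs_ge_zero) simp_all
      qed
      also have "\<dots> < \<epsilon>" using elim(1) by simp
      finally show "dist ((semigroup_op X t (resolvent h) x - resolvent h x) / t) (resolvent h x - h x) < \<epsilon>"
        by (simp only: dist_real_def eq)
    qed
  qed
qed

lemma gen_eq:
  assumes "uniform_limit {0..1} (\<lambda>t x. (semigroup_op X t f x - f x) / t) g (at_right 0)"
    and "x \<in> {0..1}"
  shows "gen X f x = g x"
  unfolding gen_def using tendsto_uniform_limitI[OF assms] by (intro tendsto_Lim) auto

text \<open>This is (1 - A) R = 1: every continuous h is attained by 1 - A. It is the source of all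
  members of the domain constructed later.\<close>

lemma resolvent_equation:
  assumes h: "continuous_on {0..1} h"
  shows "resolvent h \<in> gen_dom X"
    and "x \<in> {0..1} \<Longrightarrow> gen X (resolvent h) x = resolvent h x - h x"
proof -
  show "resolvent h \<in> gen_dom X"
    unfolding gen_dom_def using resolvent_generator_limit[OF h] continuous_resolvent[OF h] h
    by (auto intro!: exI[of _ "\<lambda>x. resolvent h x - h x"] continuous_intros)
  show "x \<in> {0..1} \<Longrightarrow> gen X (resolvent h) x = resolvent h x - h x"
    using gen_eq[OF resolvent_generator_limit[OF h]] .
qed

lemma gen_domD:
  assumes "f \<in> gen_dom X"
  shows "continuous_on {0..1} f" "continuous_on {0..1} (gen X f)"
    and "x \<in> {0..1} \<Longrightarrow> ((\<lambda>t. (semigroup_op X t f x - f x) / t) \<longlongrightarrow> gen X f x) (at_right 0)"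
proof -
  from assms obtain g where g: "continuous_on {0..1} g"
    "uniform_limit {0..1} (\<lambda>t x. (semigroup_op X t f x - f x) / t) g (at_right 0)"
    by (auto simp: gen_dom_def)
  show "continuous_on {0..1} f" using assms by (auto simp: gen_dom_def)
  show "continuous_on {0..1} (gen X f)"
    by (rule continuous_on_eq[OF g(1)]) (simp add: gen_eq[OF g(2)])
  show "x \<in> {0..1} \<Longrightarrow> ((\<lambda>t. (semigroup_op X t f x - f x) / t) \<longlongrightarrow> gen X f x) (at_right 0)"
    using tendsto_uniform_limitI[OF g(2)] gen_eq[OF g(2)] by simp
qed

end

section \<open>Primitives and Feller's boundary integrals\<close>

lemma measurable_on_unit_interval:
  fixes g :: "real \<Rightarrow> real"
  assumes "continuous_on {0<..<1} g" "A \<subseteq> {0<..<1}" "A \<in> sets borel"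
  shows "(\<lambda>x. ennreal (g x) * indicator A x) \<in> borel_measurable borel"
proof -
  have "(\<lambda>x. indicator {0<..<1} x *\<^sub>R g x) \<in> borel_measurable borel"
    using assms(1) by (rule borel_measurable_continuous_on_indicator[rotated]) simp
  then have "(\<lambda>x. ennreal (indicator {0<..<1} x *\<^sub>R g x) * indicator A x) \<in> borel_measurable borel"
    using assms(3) by measurable
  also have "(\<lambda>x. ennreal (indicator {0<..<1} x *\<^sub>R g x) * indicator A x) = (\<lambda>x. ennreal (g x) * indicator A x)"
    using assms(2) by (intro ext) (auto split: split_indicator)
  finally show ?thesis .
qed

lemma measurable_on_unit_interval_lborel:
  fixes g :: "real \<Rightarrow> real"
  assumes "continuous_on {0<..<1} g" "A \<subseteq> {0<..<1}" "A \<in> sets borel"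
  shows "(\<lambda>x. ennreal (g x) * indicator A x) \<in> borel_measurable lborel"
  using measurable_on_unit_interval[OF assms] by simp

text \<open>Common frame for the pairs scale density and scale function, speed density and speed
  function, stationary density and distribution function, and for their mirror images. The primitive
  is fixed only up to a constant and may be unbounded at both ends.\<close>

locale density_primitive =
  fixes f F :: "real \<Rightarrow> real"
  assumes cont: "continuous_on {0<..<1} f"
    and pos: "\<And>x. x \<in> {0<..<1} \<Longrightarrow> 0 < f x"
    and prim: "\<And>x. x \<in> {0<..<1} \<Longrightarrow> (F has_real_derivative f x) (at x)"
begin

lemma prim_less: "0 < a \<Longrightarrow> a < b \<Longrightarrow> b < 1 \<Longrightarrow> F a < F b"
  by (rule DERIV_pos_imp_increasing) (auto intro!: prim pos exI)

lemma prim_le: "0 < a \<Longrightarrow> a \<le> b \<Longrightarrow> b < 1 \<Longrightarrow> F a \<le> F b"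
  using prim_less[of a b] by (cases "a = b") auto

lemma continuous_prim: "continuous_on {0<..<1} F"
  by (meson DERIV_isCont continuous_at_imp_continuous_on prim)

lemma nn_integral_prim:
  assumes "0 < a" "a \<le> b" "b < 1"
  shows "(\<integral>\<^sup>+x\<in>{a..b}. ennreal (f x) \<partial>lborel) = ennreal (F b - F a)"
proof -
  let ?f = "\<lambda>x. indicator {0<..<1} x *\<^sub>R f x"
  have "?f \<in> borel_measurable borel"
    using cont by (rule borel_measurable_continuous_on_indicator[rotated]) simp
  then have "(\<integral>\<^sup>+x. ennreal (?f x) * indicator {a..b} x \<partial>lborel) = ennreal (F b - F a)"
    using assms by (intro nn_integral_FTC_Icc) (auto intro!: prim less_imp_le pos)
  moreover have "ennreal (?f x) * indicator {a..b} x = ennreal (f x) * indicator {a..b} x" for x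
    using assms by (auto simp: indicator_def)
  ultimately show ?thesis by simp
qed

lemma nn_integral_lower_ge:
  assumes "0 < y" "y \<le> x" "x < 1"
  shows "ennreal (F x - F y) \<le> (\<integral>\<^sup>+\<eta>\<in>{0<..x}. ennreal (f \<eta>) \<partial>lborel)"
  unfolding nn_integral_prim[OF assms, symmetric] using assms
  by (intro nn_integral_mono mult_left_mono) (auto simp: indicator_def)

lemma nn_integral_upper_ge:
  assumes "0 < x" "x \<le> y" "y < 1"
  shows "ennreal (F y - F x) \<le> (\<integral>\<^sup>+\<eta>\<in>{x..<1}. ennreal (f \<eta>) \<partial>lborel)"
  unfolding nn_integral_prim[OF assms, symmetric] using assms
  by (intro nn_integral_mono mult_left_mono) (auto simp: indicator_def)

text \<open>On compact subintervals the integral is an increment of \<open>F\<close>; Fatou's lemma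
  along intervals exhausting (0,x] passes the uniform bound to the half-open interval.\<close>

lemma nn_integral_lower_le:
  assumes "0 < x" "x < 1" and B: "\<And>y. 0 < y \<Longrightarrow> y \<le> x \<Longrightarrow> F x - F y \<le> B"
  shows "(\<integral>\<^sup>+\<eta>\<in>{0<..x}. ennreal (f \<eta>) \<partial>lborel) \<le> ennreal B"
proof -
  \<comment> \<open>\<open>Suc n\<close> keeps the left end x/(n+1) inside (0,x] for every n,
    including n = 0.\<close>
  let ?g = "\<lambda>n \<eta>. ennreal (f \<eta>) * indicator {x / real (Suc n)..x} \<eta>"
  have "(\<lambda>n. ?g n \<eta>) \<longlonglongrightarrow> ennreal (f \<eta>) * indicator {0<..x} \<eta>" for \<eta>
  proof (rule tendsto_eventually)
    show "\<forall>\<^sub>F n in sequentially. ?g n \<eta> = ennreal (f \<eta>) * indicator {0<..x} \<eta>"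
    proof (cases "0 < \<eta>")
      case True
      have "(\<lambda>n. x / real (Suc n)) \<longlonglongrightarrow> 0"
        by (intro LIMSEQ_Suc[where f="\<lambda>n. x / real n"] lim_const_over_n)
      then have "\<forall>\<^sub>F n in sequentially. x / real (Suc n) < \<eta>"
        using True by (rule order_tendstoD(2))
      then show ?thesis
        by eventually_elim (use True in \<open>auto simp: indicator_def\<close>)
    next
      case False
      then have "\<not> x / real (Suc n) \<le> \<eta>" for n
        using \<open>0 < x\<close> by (auto simp: not_le not_less intro: le_less_trans)
      then show ?thesis using False by (auto simp: indicator_def)
    qed
  qed
  then have "(\<integral>\<^sup>+\<eta>. ennreal (f \<eta>) * indicator {0<..x} \<eta> \<partial>lborel) = (\<integral>\<^sup>+\<eta>. liminf (\<lambda>n. ?g n \<eta>) \<partial>lborel)"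
    by (intro nn_integral_cong) (metis lim_imp_Liminf trivial_limit_sequentially)
  also have "\<dots> \<le> liminf (\<lambda>n. \<integral>\<^sup>+\<eta>. ?g n \<eta> \<partial>lborel)"
  proof (intro nn_integral_liminf)
    fix n
    have "0 < x / real (Suc n)" using assms by simp
    then have "{x / real (Suc n)..x} \<subseteq> {0<..<1}"
      using assms(2) by (auto intro: less_le_trans)
    then show "?g n \<in> borel_measurable lborel"
      by (intro measurable_on_unit_interval_lborel[OF cont]) auto
  qed
  also have "\<dots> \<le> ennreal B"
  proof (intro Liminf_le trivial_limit_sequentially always_eventually allI)
    fix n
    have "0 < x / real (Suc n)" "x / real (Suc n) \<le> x"
      using assms by (auto simp: divide_le_eq)
    then show "(\<integral>\<^sup>+\<eta>. ?g n \<eta> \<partial>lborel) \<le> ennreal B"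
      using assms(2) B by (subst nn_integral_prim) (auto intro!: ennreal_leI)
  qed
  finally show ?thesis .
qed

lemma nn_integral_lower_split:
  assumes "0 < y" "y \<le> x" "x < 1"
  shows "(\<integral>\<^sup>+\<eta>\<in>{0<..x}. ennreal (f \<eta>) \<partial>lborel)
    \<le> (\<integral>\<^sup>+\<eta>\<in>{0<..y}. ennreal (f \<eta>) \<partial>lborel) + ennreal (F x - F y)"
proof -
  have "(\<integral>\<^sup>+\<eta>\<in>{0<..x}. ennreal (f \<eta>) \<partial>lborel)
     \<le> (\<integral>\<^sup>+\<eta>. ennreal (f \<eta>) * indicator {0<..y} \<eta> + ennreal (f \<eta>) * indicator {y..x} \<eta> \<partial>lborel)"
    using assms by (intro nn_integral_mono) (auto simp: indicator_def)
  also have "\<dots> = (\<integral>\<^sup>+\<eta>\<in>{0<..y}. ennreal (f \<eta>) \<partial>lborel) + (\<integral>\<^sup>+\<eta>\<in>{y..x}. ennreal (f \<eta>) \<partial>lborel)"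
    using assms
    by (intro nn_integral_add measurable_on_unit_interval_lborel[OF cont]) auto
  finally show ?thesis using nn_integral_prim[OF assms] by simp
qed

end

text \<open>With \<open>F\<close> a primitive of \<open>f\<close>, Feller's \<open>N\<close> and \<open>\<Sigma>\<close> at the lower boundary are the cases
  \<open>(w, f) = (m, s)\<close> and \<open>(w, f) = (s, m)\<close> of the following functional.\<close>

definition lower_functional :: "(real \<Rightarrow> real) \<Rightarrow> (real \<Rightarrow> real) \<Rightarrow> real \<Rightarrow> ennreal" where
  "lower_functional w F x = (\<integral>\<^sup>+\<eta>\<in>{0<..x}. ennreal (w \<eta>) * ennreal (F x - F \<eta>) \<partial>lborel)"

definition upper_functional :: "(real \<Rightarrow> real) \<Rightarrow> (real \<Rightarrow> real) \<Rightarrow> real \<Rightarrow> ennreal" where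
  "upper_functional w F x = (\<integral>\<^sup>+\<eta>\<in>{x..<1}. ennreal (w \<eta>) * ennreal (F \<eta> - F x) \<partial>lborel)"

lemma nn_integral_reflect:
  fixes g :: "real \<Rightarrow> real"
  assumes "continuous_on {0<..<1} g" "0 < x" "x < 1"
  shows "(\<integral>\<^sup>+\<eta>\<in>{x..<1}. ennreal (g \<eta>) \<partial>lborel) = (\<integral>\<^sup>+\<eta>\<in>{0<..1 - x}. ennreal (g (1 - \<eta>)) \<partial>lborel)"
proof -
  have "(\<lambda>\<eta>. ennreal (g \<eta>) * indicator {x..<1} \<eta>) \<in> borel_measurable borel"
    by (rule measurable_on_unit_interval[OF assms(1)]) (use assms in auto)
  from nn_integral_real_affine[OF this, of "-1" 1] show ?thesis
    by (auto simp: indicator_def intro!: nn_integral_cong)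
qed

text \<open>Carries results from the lower boundary to the upper one. The sign in front of the
  reflected primitive makes it increasing again.\<close>

lemma density_primitive_reflect:
  assumes "density_primitive f F"
  shows "density_primitive (\<lambda>x. f (1 - x)) (\<lambda>x. - F (1 - x))"
proof -
  interpret density_primitive f F by fact
  show ?thesis
  proof
    show "continuous_on {0<..<1} (\<lambda>x. f (1 - x))"
      by (rule continuous_on_compose2[OF cont]) (auto intro!: continuous_intros)
    show "((\<lambda>x. - F (1 - x)) has_real_derivative f (1 - x)) (at x)" if "x \<in> {0<..<1}" for x
      using that by (auto intro!: derivative_eq_intros DERIV_chain2[of F "f (1 - x)" "\<lambda>x. 1 - x"] prim)
  qed (use pos in auto)
qed

lemma upper_functional_reflect:
  assumes "density_primitive w W" "density_primitive f F" "0 < x" "x < 1"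
  shows "upper_functional w F x = lower_functional (\<lambda>x. w (1 - x)) (\<lambda>x. - F (1 - x)) (1 - x)"
proof -
  have 1: "upper_functional w F x = (\<integral>\<^sup>+\<eta>\<in>{x..<1}. ennreal (w \<eta> * (F \<eta> - F x)) \<partial>lborel)"
    unfolding upper_functional_def using assms density_primitive.pos[OF assms(1)]
    by (intro nn_integral_cong) (auto simp: indicator_def ennreal_mult' less_imp_le)
  have 2: "lower_functional (\<lambda>x. w (1 - x)) (\<lambda>x. - F (1 - x)) (1 - x)
     = (\<integral>\<^sup>+\<eta>\<in>{0<..1 - x}. ennreal (w (1 - \<eta>) * (F (1 - \<eta>) - F x)) \<partial>lborel)"
    unfolding lower_functional_def using assms density_primitive.pos[OF assms(1)]
    by (intro nn_integral_cong) (auto simp: indicator_def ennreal_mult' less_imp_le)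
  show ?thesis
    unfolding 1 2 using assms density_primitive.cont[OF assms(1)] density_primitive.continuous_prim[OF assms(2)]
    by (intro nn_integral_reflect[of "\<lambda>\<eta>. w \<eta> * (F \<eta> - F x)"] continuous_intros)
qed

text \<open>On (0,x/2] the factor F(x) - F(\<eta>) is at least the positive constant F(x) - F(x/2),
  so w has finite mass there; the remaining compact interval always has finite mass.\<close>

lemma lower_functional_finiteD:
  assumes "density_primitive w W" "density_primitive f F" "0 < x" "x < 1"
    and fin: "lower_functional w F x < \<infinity>"
  shows "(\<integral>\<^sup>+\<eta>\<in>{0<..x}. ennreal (w \<eta>) \<partial>lborel) < \<infinity>"
proof -
  interpret w: density_primitive w W by fact
  interpret f: density_primitive f F by fact
  define y where "y = x / 2"
  have y: "0 < y" "y < x" using assms by (auto simp: y_def)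
  let ?c = "ennreal (F x - F y)"
  have c: "?c \<noteq> 0" using f.prim_less[of y x] y assms by simp
  have "?c * (\<integral>\<^sup>+\<eta>\<in>{0<..y}. ennreal (w \<eta>) \<partial>lborel) = (\<integral>\<^sup>+\<eta>. ?c * (ennreal (w \<eta>) * indicator {0<..y} \<eta>) \<partial>lborel)"
    using y assms
    by (intro nn_integral_cmult[symmetric] measurable_on_unit_interval_lborel[OF w.cont]) auto
  also have "\<dots> \<le> lower_functional w F x"
    unfolding lower_functional_def
  proof (intro nn_integral_mono)
    fix \<eta>
    show "?c * (ennreal (w \<eta>) * indicator {0<..y} \<eta>) \<le> ennreal (w \<eta>) * ennreal (F x - F \<eta>) * indicator {0<..x} \<eta>"
    proof (cases "\<eta> \<in> {0<..y}")
      case True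
      then have "F \<eta> \<le> F y" using y assms by (intro f.prim_le) auto
      then have "?c \<le> ennreal (F x - F \<eta>)" by (intro ennreal_leI) simp
      then show ?thesis using True y by (auto simp: indicator_def mult.commute intro: mult_left_mono)
    qed (auto simp: indicator_def)
  qed
  finally have "?c * (\<integral>\<^sup>+\<eta>\<in>{0<..y}. ennreal (w \<eta>) \<partial>lborel) < \<infinity>" using fin by (rule le_less_trans)
  then have "(\<integral>\<^sup>+\<eta>\<in>{0<..y}. ennreal (w \<eta>) \<partial>lborel) < \<infinity>"
    using c by (auto simp: ennreal_mult_less_top)
  then have "(\<integral>\<^sup>+\<eta>\<in>{0<..y}. ennreal (w \<eta>) \<partial>lborel) + ennreal (W x - W y) < \<infinity>"
    by simp
  then show ?thesis
    using w.nn_integral_lower_split[of y x] y assms by (auto intro: le_less_trans)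
qed

text \<open>The factor F(x) - F(\<eta>) never exceeds the mass of f on (0,x], so the functional is
  at most the product of the two masses. With f = m and w = s, an infinite \<Sigma> and a finite
  speed mass give an infinite scale.\<close>

lemma lower_functional_infiniteD:
  assumes "density_primitive w W" "density_primitive f F" "0 < x" "x < 1"
    and fin: "(\<integral>\<^sup>+\<eta>\<in>{0<..x}. ennreal (f \<eta>) \<partial>lborel) < \<infinity>" and inf: "lower_functional w F x = \<infinity>"
  shows "(\<integral>\<^sup>+\<eta>\<in>{0<..x}. ennreal (w \<eta>) \<partial>lborel) = \<infinity>"
proof (rule ccontr)
  interpret w: density_primitive w W by fact
  interpret f: density_primitive f F by fact
  let ?c = "\<integral>\<^sup>+\<eta>\<in>{0<..x}. ennreal (f \<eta>) \<partial>lborel"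
  assume "\<not> ?thesis"
  then have "?c * (\<integral>\<^sup>+\<eta>\<in>{0<..x}. ennreal (w \<eta>) \<partial>lborel) < \<infinity>"
    using fin by (auto simp: ennreal_mult_less_top less_top)
  moreover have "lower_functional w F x \<le> (\<integral>\<^sup>+\<eta>. ?c * (ennreal (w \<eta>) * indicator {0<..x} \<eta>) \<partial>lborel)"
    unfolding lower_functional_def
  proof (intro nn_integral_mono)
    fix \<eta>
    show "ennreal (w \<eta>) * ennreal (F x - F \<eta>) * indicator {0<..x} \<eta> \<le> ?c * (ennreal (w \<eta>) * indicator {0<..x} \<eta>)"
    proof (cases "\<eta> \<in> {0<..x}")
      case True
      then have "ennreal (F x - F \<eta>) \<le> ?c" using assms by (intro f.nn_integral_lower_ge) auto
      then show ?thesis using True by (auto simp: mult.commute intro: mult_left_mono)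
    qed (auto simp: indicator_def)
  qed
  moreover have "(\<integral>\<^sup>+\<eta>. ?c * (ennreal (w \<eta>) * indicator {0<..x} \<eta>) \<partial>lborel) = ?c * (\<integral>\<^sup>+\<eta>\<in>{0<..x}. ennreal (w \<eta>) \<partial>lborel)"
    using assms
    by (intro nn_integral_cmult measurable_on_unit_interval_lborel[OF w.cont]) auto
  ultimately show False using inf by simp
qed

lemma upper_functional_finiteD:
  assumes "density_primitive w W" "density_primitive f F" "0 < x" "x < 1"
    and "upper_functional w F x < \<infinity>"
  shows "(\<integral>\<^sup>+\<eta>\<in>{x..<1}. ennreal (w \<eta>) \<partial>lborel) < \<infinity>"
  using lower_functional_finiteD[OF assms(1,2)[THEN density_primitive_reflect], of "1 - x"] assms
  by (simp add: upper_functional_reflect[OF assms(1,2)] nn_integral_reflect density_primitive.cont)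

lemma upper_functional_infiniteD:
  assumes "density_primitive w W" "density_primitive f F" "0 < x" "x < 1"
    and "(\<integral>\<^sup>+\<eta>\<in>{x..<1}. ennreal (f \<eta>) \<partial>lborel) < \<infinity>" "upper_functional w F x = \<infinity>"
  shows "(\<integral>\<^sup>+\<eta>\<in>{x..<1}. ennreal (w \<eta>) \<partial>lborel) = \<infinity>"
  using lower_functional_infiniteD[OF assms(1,2)[THEN density_primitive_reflect], of "1 - x"] assms
  by (simp add: upper_functional_reflect[OF assms(1,2)] nn_integral_reflect density_primitive.cont)

text \<open>An unbounded primitive means infinite mass of w near 0, which
  \<open>lower_functional_finiteD\<close> excludes for a finite functional.\<close>

lemma lower_functional_infiniteI:
  assumes "density_primitive w W" "density_primitive f F" "0 < x" "x < 1"
    and unb: "\<And>B. \<exists>y\<in>{0<..<x}. B < W x - W y"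
  shows "lower_functional w F x = \<infinity>"
proof (rule ccontr)
  interpret w: density_primitive w W by fact
  assume "lower_functional w F x \<noteq> \<infinity>"
  then have "(\<integral>\<^sup>+\<eta>\<in>{0<..x}. ennreal (w \<eta>) \<partial>lborel) < \<infinity>"
    using lower_functional_finiteD[OF assms(1-4)] by (simp add: less_top)
  then obtain B where B: "(\<integral>\<^sup>+\<eta>\<in>{0<..x}. ennreal (w \<eta>) \<partial>lborel) = ennreal B" "0 \<le> B"
    by (auto elim: less_top_ennreal[THEN iffD1, THEN exE])
  obtain y where y: "y \<in> {0<..<x}" "B < W x - W y" using unb by blast
  then have "ennreal (W x - W y) \<le> ennreal B"
    using w.nn_integral_lower_ge[of y x] assms B by auto
  then show False using y B(2) by (simp add: ennreal_le_iff)
qed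

lemma continuous_LBINT:
  fixes f :: "real \<Rightarrow> real"
  assumes f: "set_integrable lborel {0<..<1} f"
  shows "continuous_on {0..1} (\<lambda>x. LBINT y=0..ereal x. f y)"
proof -
  \<comment> \<open>Adding the two endpoints, a null set, gives integrability on the closed
    interval, whatever the values of f there.\<close>
  have "set_integrable lborel ({0<..<1} \<union> {0, 1}) f"
  proof (intro set_integrable_Un f)
    show "set_integrable lborel {0, 1} f"
      unfolding set_integrable_def
      by (rule integrable_discrete_difference[where X="{0,1}", THEN iffD1, OF _ _ _ _ integrable_zero]) (auto simp: indicator_def)
  qed auto
  moreover have "{0<..<1} \<union> {0, 1} = {0..1::real}" by auto
  ultimately have i: "set_integrable lborel {0..1} f" by simp
  have "continuous_on {0..1} (\<lambda>x. integral {0..x} f)"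
    using set_borel_integral_eq_integral(1)[OF i] by (rule indefinite_integral_continuous_1)
  then show ?thesis
  proof (rule continuous_on_eq)
    fix x :: real assume "x \<in> {0..1}"
    then show "integral {0..x} f = (LBINT y=0..ereal x. f y)"
      using set_integrable_subset[OF i, of "{0..x}"]
      by (subst zero_ereal_def, subst interval_integral_eq_integral) auto
  qed
qed

lemma DERIV_LBINT:
  fixes f :: "real \<Rightarrow> real"
  assumes f: "continuous_on {0<..<1} f" and "c \<in> {0<..<1}" "x \<in> {0<..<1}"
  shows "((\<lambda>u. LBINT y=ereal c..ereal u. f y) has_real_derivative f x) (at x)"
proof -
  define a b where "a = min c x / 2" and "b = (1 + max c x) / 2"
  have ab: "0 < a" "a < c" "a < x" "x < b" "c < b" "b < 1"
    using assms by (auto simp: a_def b_def)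
  have "continuous_on {a..b} f"
    using f by (rule continuous_on_subset) (use ab in auto)
  then have "((\<lambda>u. LBINT y=c..u. f y) has_vector_derivative f x) (at x within {a..b})"
    using ab by (intro interval_integral_FTC2) auto
  moreover have "at x within {a..b} = at x"
    using ab by (intro at_within_interior) auto
  ultimately show ?thesis
    by (simp add: has_real_derivative_iff_has_vector_derivative)
qed

text \<open>The integrand may be singular at 0, so the integral is split at 1/2: the first piece is
  a constant and the second falls under \<open>DERIV_LBINT\<close>.\<close>

lemma DERIV_LBINT_0:
  fixes f :: "real \<Rightarrow> real"
  assumes f: "continuous_on {0<..<1} f" and i: "set_integrable lborel {0<..<1} f" and "x \<in> {0<..<1}"
  shows "((\<lambda>u. LBINT y=0..ereal u. f y) has_real_derivative f x) (at x)"
proof -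
  have "((\<lambda>u. (LBINT y=0..ereal (1/2). f y) + (LBINT y=ereal (1/2)..ereal u. f y)) has_real_derivative f x) (at x)"
    by (auto intro!: derivative_eq_intros DERIV_LBINT[OF f] \<open>x \<in> _\<close>)
  then show ?thesis
  proof (rule DERIV_cong_ev[OF refl _ refl, THEN iffD1, rotated])
    have "\<forall>\<^sub>F u in nhds x. u \<in> {0<..<1}"
      using assms(3) by (intro eventually_nhds_in_open) auto
    then show "\<forall>\<^sub>F u in nhds x. (LBINT y=0..ereal (1/2). f y) + (LBINT y=ereal (1/2)..ereal u. f y)
       = (LBINT y=0..ereal u. f y)"
    proof eventually_elim
      case (elim u)
      have "interval_lebesgue_integrable lborel (min 0 (min (ereal (1/2)) (ereal u))) (max 0 (max (ereal (1/2)) (ereal u))) f"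
        unfolding interval_lebesgue_integrable_def
        using elim by (auto intro!: set_integrable_subset[OF i] simp: einterval_def zero_ereal_def min_def max_def split: if_splits)
      then show ?case by (rule interval_integral_sum)
    qed
  qed
qed

section \<open>Flux, maximum principle and step functions\<close>

lemma filterlim_reflect:
  "filterlim (\<lambda>x::real. 1 - x) (at_left 1) (at_right 0)"
  "filterlim (\<lambda>x::real. 1 - x) (at_right 0) (at_left 1)"
proof -
  have "((\<lambda>x::real. 1 - x) \<longlongrightarrow> 1) (at_right 0)" "((\<lambda>x::real. 1 - x) \<longlongrightarrow> 0) (at_left 1)"
    by (auto intro!: tendsto_eq_intros)
  moreover have "\<forall>\<^sub>F x in at_right 0. 1 - x < (1::real)" "\<forall>\<^sub>F x in at_left 1. 0 < 1 - (x::real)"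
    by (auto simp: eventually_at_filter)
  ultimately show "filterlim (\<lambda>x::real. 1 - x) (at_left 1) (at_right 0)"
    "filterlim (\<lambda>x::real. 1 - x) (at_right 0) (at_left 1)"
    by (auto simp: filterlim_at elim: eventually_mono)
qed

lemma DERIV_reflect:
  fixes f :: "real \<Rightarrow> real"
  assumes "(f has_real_derivative D) (at (1 - x))"
  shows "((\<lambda>x. f (1 - x)) has_real_derivative - D) (at x)"
proof -
  have "((\<lambda>x::real. 1 - x) has_real_derivative - 1) (at x)"
    by (auto intro!: derivative_eq_intros)
  from DERIV_chain2[where f=f and g="\<lambda>x. 1 - x", OF assms this] show ?thesis by simp
qed

text \<open>Suppose the flux \<phi> is at least \<epsilon> in absolute value at points arbitrarily
  close to 0. As \<phi>' is bounded by 2 C m and M converges, the flux keeps its sign and stays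
  above \<epsilon>/2 from such a point down to 0. Then f changes at least \<epsilon>/2 times as much
  as S, which is impossible for bounded f and unbounded S.\<close>

lemma flux_vanishes_lower:
  fixes \<phi> f h :: "real \<Rightarrow> real"
  assumes S: "density_primitive s S" and M: "density_primitive m M"
    and f: "\<And>x. x \<in> {0<..<1} \<Longrightarrow> (f has_real_derivative s x * \<phi> x) (at x)"
    and \<phi>: "\<And>x. x \<in> {0<..<1} \<Longrightarrow> (\<phi> has_real_derivative 2 * m x * h x) (at x)"
    and B: "\<And>x. x \<in> {0<..<1} \<Longrightarrow> \<bar>f x\<bar> \<le> B"
    and C: "\<And>x. x \<in> {0<..<1} \<Longrightarrow> \<bar>h x\<bar> \<le> C"
    and L: "(M \<longlongrightarrow> L) (at_right 0)"
    and c: "c \<in> {0<..<1}" and unb: "\<And>K. \<exists>y\<in>{0<..<c}. K < S c - S y"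
  shows "(\<phi> \<longlongrightarrow> 0) (at_right 0)"
proof (rule tendstoI, rule ccontr)
  interpret S: density_primitive s S by fact
  interpret M: density_primitive m M by fact
  have BC: "0 \<le> B" "0 \<le> C" using B[of "1/2"] C[of "1/2"] by auto
  fix \<epsilon> :: real assume "0 < \<epsilon>" and *: "\<not> (\<forall>\<^sub>F x in at_right 0. dist (\<phi> x) 0 < \<epsilon>)"
  \<comment> \<open>M varies by at most 2\<eta> below \<delta>, so the flux varies by at most 4 C
    \<eta>, which is at most \<epsilon>/2. The summand 1 covers the case C = 0.\<close>
  define \<eta> where "\<eta> = \<epsilon> / 8 / (C + 1)"
  have "0 < \<eta>" using \<open>0 < \<epsilon>\<close> BC by (simp add: \<eta>_def)
  have "C * \<eta> \<le> (C + 1) * \<eta>" using \<open>0 < \<eta>\<close> by (simp add: algebra_simps)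
  also have "\<dots> = \<epsilon> / 8" 
  proof -
    have "C + 1 \<noteq> 0" using BC by simp
    from nonzero_eq_divide_eq[OF this, THEN iffD1, OF \<eta>_def] show ?thesis by (simp only: mult.commute)
  qed
  finally have C\<eta>: "C * \<eta> \<le> \<epsilon> / 8" .
  obtain \<delta> where \<delta>: "0 < \<delta>" "\<And>x. 0 < x \<Longrightarrow> x < \<delta> \<Longrightarrow> \<bar>M x - L\<bar> < \<eta>"
    using tendstoD[OF L \<open>0 < \<eta>\<close>] unfolding eventually_at_right_field dist_real_def by auto
  have "\<not> (\<forall>x>0. x < min \<delta> 1 \<longrightarrow> \<bar>\<phi> x\<bar> < \<epsilon>)"
  proof
    assume "\<forall>x>0. x < min \<delta> 1 \<longrightarrow> \<bar>\<phi> x\<bar> < \<epsilon>"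
    then have "\<forall>\<^sub>F x in at_right 0. dist (\<phi> x) 0 < \<epsilon>"
      unfolding eventually_at_right_field dist_real_def using \<delta>(1) by (intro exI[of _ "min \<delta> 1"]) simp
    with * show False ..
  qed
  then obtain x0 where x0: "0 < x0" "x0 < \<delta>" "x0 < 1" "\<epsilon> \<le> \<bar>\<phi> x0\<bar>" by (auto simp: not_less)
  define \<sigma> where "\<sigma> = sgn (\<phi> x0)"
  have \<sigma>: "\<sigma> * \<phi> x0 = \<bar>\<phi> x0\<bar>" "\<bar>\<sigma>\<bar> = 1"
    using x0 \<open>0 < \<epsilon>\<close> by (auto simp: \<sigma>_def sgn_if)
  have \<sigma>\<phi>: "\<epsilon> / 2 \<le> \<sigma> * \<phi> y" if y: "0 < y" "y \<le> x0" for y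
  proof -
    have "\<sigma> * \<phi> x0 - 2 * C * M x0 \<le> \<sigma> * \<phi> y - 2 * C * M y"
    proof (rule DERIV_nonpos_imp_nonincreasing[OF y(2)])
      fix x assume x: "y \<le> x" "x \<le> x0"
      then have xx: "x \<in> {0<..<1}" using y x0 by auto
      have "\<bar>\<sigma> * h x\<bar> \<le> C" using C[OF xx] \<sigma> by (simp add: abs_mult)
      then have "2 * m x * (\<sigma> * h x - C) \<le> 0"
        using M.pos[OF xx] by (auto simp: abs_le_iff mult_le_0_iff)
      moreover have "((\<lambda>x. \<sigma> * \<phi> x - 2 * C * M x) has_real_derivative 2 * m x * (\<sigma> * h x - C)) (at x)"
        by (auto intro!: derivative_eq_intros \<phi>[OF xx] M.prim[OF xx] simp: algebra_simps)
      ultimately show "\<exists>z. ((\<lambda>x. \<sigma> * \<phi> x - 2 * C * M x) has_real_derivative z) (at x) \<and> z \<le> 0" by blast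
    qed
    moreover have "M x0 - M y \<le> 2 * \<eta>"
      using \<delta>(2)[of x0] \<delta>(2)[of y] x0 y by (auto simp: abs_less_iff)
    then have "C * (M x0 - M y) \<le> C * (2 * \<eta>)" using BC by (intro mult_left_mono)
    ultimately show ?thesis using C\<eta> \<sigma> x0 by (simp add: algebra_simps)
  qed
  have bound: "S x0 - S y \<le> 4 * B / \<epsilon>" if y: "0 < y" "y \<le> x0" for y
  proof -
    have "\<sigma> * f y - \<epsilon> / 2 * S y \<le> \<sigma> * f x0 - \<epsilon> / 2 * S x0"
    proof (rule DERIV_nonneg_imp_nondecreasing[OF y(2)])
      fix x assume x: "y \<le> x" "x \<le> x0"
      then have xx: "x \<in> {0<..<1}" using y x0 by auto
      have "0 \<le> s x * (\<sigma> * \<phi> x - \<epsilon> / 2)"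
        using \<sigma>\<phi>[of x] S.pos[OF xx] x y by (auto intro!: mult_nonneg_nonneg)
      moreover have "((\<lambda>x. \<sigma> * f x - \<epsilon> / 2 * S x) has_real_derivative s x * (\<sigma> * \<phi> x - \<epsilon> / 2)) (at x)"
        by (auto intro!: derivative_eq_intros f[OF xx] S.prim[OF xx] simp: algebra_simps)
      ultimately show "\<exists>z. ((\<lambda>x. \<sigma> * f x - \<epsilon> / 2 * S x) has_real_derivative z) (at x) \<and> 0 \<le> z" by blast
    qed
    moreover have "\<bar>\<sigma> * f x0\<bar> \<le> B" "\<bar>\<sigma> * f y\<bar> \<le> B"
      using B[of x0] B[of y] \<sigma> x0 y by (auto simp: abs_mult)
    ultimately have "\<epsilon> / 2 * (S x0 - S y) \<le> 2 * B" by (simp add: algebra_simps abs_le_iff)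
    then show ?thesis using \<open>0 < \<epsilon>\<close> by (simp add: field_simps)
  qed
  have "0 \<le> 4 * B / \<epsilon>" using BC \<open>0 < \<epsilon>\<close> by simp
  \<comment> \<open>The unboundedness of S is measured from c; the shift S(c) - S(x0) measures it
    from x0. If y lies above x0, monotonicity of S already contradicts the choice.\<close>
  obtain y where y: "y \<in> {0<..<c}" "S c - S x0 + 4 * B / \<epsilon> < S c - S y" using unb by blast
  show False
  proof (cases "y \<le> x0")
    case True
    then show False using bound[of y] y by auto
  next
    case False
    then have "S x0 \<le> S y" using S.prim_le[of x0 y] x0 y c by auto
    then show False using y \<open>0 \<le> 4 * B / \<epsilon>\<close> by auto
  qed
qed

text \<open>The mirror image of the lower case under x -> 1 - x, which reverses the sign of f' and
  hence of the flux.\<close>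

lemma flux_vanishes_upper:
  fixes \<phi> f h :: "real \<Rightarrow> real"
  assumes S: "density_primitive s S" and M: "density_primitive m M"
    and f: "\<And>x. x \<in> {0<..<1} \<Longrightarrow> (f has_real_derivative s x * \<phi> x) (at x)"
    and \<phi>: "\<And>x. x \<in> {0<..<1} \<Longrightarrow> (\<phi> has_real_derivative 2 * m x * h x) (at x)"
    and B: "\<And>x. x \<in> {0<..<1} \<Longrightarrow> \<bar>f x\<bar> \<le> B"
    and C: "\<And>x. x \<in> {0<..<1} \<Longrightarrow> \<bar>h x\<bar> \<le> C"
    and L: "(M \<longlongrightarrow> L) (at_left 1)"
    and c: "c \<in> {0<..<1}" and unb: "\<And>K. \<exists>y\<in>{c<..<1}. K < S y - S c"
  shows "(\<phi> \<longlongrightarrow> 0) (at_left 1)"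
proof -
  have "((\<lambda>x. - \<phi> (1 - x)) \<longlongrightarrow> 0) (at_right 0)"
  proof (rule flux_vanishes_lower[OF density_primitive_reflect[OF S] density_primitive_reflect[OF M]])
    fix x :: real assume x: "x \<in> {0<..<1}"
    then have x': "1 - x \<in> {0<..<1}" by auto
    show "((\<lambda>x. f (1 - x)) has_real_derivative s (1 - x) * - \<phi> (1 - x)) (at x)"
      using DERIV_reflect[OF f[OF x']] by simp
    show "((\<lambda>x. - \<phi> (1 - x)) has_real_derivative 2 * m (1 - x) * h (1 - x)) (at x)"
      using DERIV_minus[OF DERIV_reflect[OF \<phi>[OF x']]] by simp
    show "\<bar>f (1 - x)\<bar> \<le> B" "\<bar>h (1 - x)\<bar> \<le> C" using B[OF x'] C[OF x'] .
  next
    show "((\<lambda>x. - M (1 - x)) \<longlongrightarrow> - L) (at_right 0)"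
      by (intro tendsto_minus filterlim_compose[OF L filterlim_reflect(1)])
    show "1 - c \<in> {0<..<1}" using c by auto
    fix K
    obtain y where "y \<in> {c<..<1}" "K < S y - S c" using unb by blast
    then show "\<exists>y\<in>{0<..<1 - c}. K < - S (1 - (1 - c)) - - S (1 - y)"
      by (intro bexI[of _ "1 - y"]) auto
  qed
  from tendsto_minus[OF filterlim_compose[OF this filterlim_reflect(2)]] show ?thesis by simp
qed

text \<open>Near a positive maximum p the function d is positive, so \<phi> is strictly increasing.
  It tends to 0 at p, by d'(p) = 0 in the interior and by the flux condition at an end. Hence \<phi>
  > 0 just to the right of p, or \<phi> < 0 just to the left when p = 1, and d grows beyond its
  maximum.\<close>

lemma maximum_principle:
  fixes d \<phi> :: "real \<Rightarrow> real"
  assumes s: "\<And>x. x \<in> {0<..<1} \<Longrightarrow> 0 < s x" and m: "\<And>x. x \<in> {0<..<1} \<Longrightarrow> 0 < m x"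
    and cont: "continuous_on {0..1} d"
    and d: "\<And>x. x \<in> {0<..<1} \<Longrightarrow> (d has_real_derivative s x * \<phi> x) (at x)"
    and \<phi>: "\<And>x. x \<in> {0<..<1} \<Longrightarrow> (\<phi> has_real_derivative m x * d x) (at x)"
    and low: "(\<phi> \<longlongrightarrow> 0) (at_right 0)" and upp: "(\<phi> \<longlongrightarrow> 0) (at_left 1)"
    and x: "x \<in> {0..1}"
  shows "d x \<le> 0"
proof (rule ccontr)
  assume "\<not> d x \<le> 0"
  obtain p where p: "p \<in> {0..1}" and max: "\<And>y. y \<in> {0..1} \<Longrightarrow> d y \<le> d p"
    using continuous_attains_sup[OF compact_Icc _ cont] by auto
  have "0 < d p" using max[OF x] \<open>\<not> d x \<le> 0\<close> by linarith
  then obtain e where e: "0 < e" and de: "\<And>y. y \<in> {0..1} \<Longrightarrow> \<bar>y - p\<bar> < e \<Longrightarrow> 0 < d y"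
  proof -
    have "\<exists>e>0. \<forall>y\<in>{0..1}. dist y p < e \<longrightarrow> dist (d y) (d p) < d p"
      using cont p \<open>0 < d p\<close> by (auto simp: continuous_on_iff)
    then show ?thesis using that by (fastforce simp: dist_real_def)
  qed
  have \<phi>_mono: "\<phi> y < \<phi> z" if "0 < y" "y < z" "z < 1" "\<bar>y - p\<bar> < e" "\<bar>z - p\<bar> < e" for y z
  proof (rule DERIV_pos_imp_increasing[OF that(2)])
    fix u assume u: "y \<le> u" "u \<le> z"
    then have "u \<in> {0<..<1}" "0 < d u" using that by (auto intro!: de simp: abs_if split: if_splits)
    then show "\<exists>z. (\<phi> has_real_derivative z) (at u) \<and> 0 < z" using \<phi>[of u] m[of u] by (intro exI) auto
  qed
  show False
  proof (cases "p < 1")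
    case True
    have lim: "(\<phi> \<longlongrightarrow> 0) (at_right p)"
    proof (cases "p = 0")
      case False
      then have pp: "p \<in> {0<..<1}" using p True by auto
      have "s p * \<phi> p = 0"
      proof (rule DERIV_local_max[OF d[OF pp]])
        show "0 < min p (1 - p)" using pp by auto
        show "\<forall>y. \<bar>p - y\<bar> < min p (1 - p) \<longrightarrow> d y \<le> d p"
          by (auto intro!: max simp: abs_if split: if_splits)
      qed
      then have "\<phi> p = 0" using s[OF pp] by simp
      moreover have "isCont \<phi> p" using \<phi>[OF pp] by (rule DERIV_isCont)
      ultimately show ?thesis by (metis continuous_within filterlim_at_split)
    qed (use low in simp)
    have pos: "0 < \<phi> y" if y: "p < y" "y < p + e" "y < 1" for y
    proof -
      \<comment> \<open>Passing to the limit gives only a weak inequality at the midpoint z; strict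
        monotonicity from z to y makes it strict.\<close>
      define z where "z = (p + y) / 2"
      have "0 \<le> \<phi> z"
      proof (rule tendsto_upperbound[OF lim])
        show "\<forall>\<^sub>F u in at_right p. \<phi> u \<le> \<phi> z"
          unfolding eventually_at_right_field
          using p y by (intro exI[of _ z]) (auto simp: z_def intro!: less_imp_le[OF \<phi>_mono])
      qed simp
      also have "\<phi> z < \<phi> y" using p y by (intro \<phi>_mono) (auto simp: z_def field_simps)
      finally show ?thesis .
    qed
    define q where "q = min (p + e) 1"
    define y where "y = (p + q) / 2"
    have y: "p < y" "y < p + e" "y < 1" using True e by (auto simp: y_def q_def min_def field_simps)
    have "d p < d y"
    proof (rule DERIV_pos_imp_increasing_open[OF y(1)])
      fix u assume u: "p < u" "u < y"
      then have "u \<in> {0<..<1}" "0 < \<phi> u" using p y by (auto intro!: pos)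
      then show "\<exists>z. (d has_real_derivative z) (at u) \<and> 0 < z" using d[of u] s[of u] by (intro exI) auto
    qed (use cont p y in \<open>auto intro: continuous_on_subset\<close>)
    then show False using max[of y] p y by auto
  next
    case False
    then have "p = 1" using p by simp
    have neg: "\<phi> y < 0" if y: "1 - e < y" "y < 1" "0 < y" for y
    proof -
      define z where "z = (1 + y) / 2"
      have "\<phi> y < \<phi> z" using y \<open>p = 1\<close> by (intro \<phi>_mono) (auto simp: z_def abs_if field_simps)
      also have "\<phi> z \<le> 0"
      proof (rule tendsto_lowerbound[OF upp])
        show "\<forall>\<^sub>F u in at_left 1. \<phi> z \<le> \<phi> u"
          unfolding eventually_at_left_field
          using y \<open>p = 1\<close> by (intro exI[of _ z]) (auto simp: z_def intro!: less_imp_le[OF \<phi>_mono])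
      qed simp
      finally show ?thesis .
    qed
    define q where "q = Max {0, 1 - e}"
    define y where "y = (1 + q) / 2"
    have y: "1 - e < y" "y < 1" "0 < y" using e by (auto simp: y_def q_def max_def field_simps)
    have "d 1 < d y"
    proof (rule DERIV_neg_imp_decreasing_open[OF y(2)])
      fix u assume u: "y < u" "u < 1"
      then have "u \<in> {0<..<1}" "\<phi> u < 0" using y by (auto intro!: neg)
      then show "\<exists>z. (d has_real_derivative z) (at u) \<and> z < 0"
        using d[of u] s[of u] by (intro exI[of _ "s u * \<phi> u"]) (auto simp: mult_less_0_iff)
    qed (use cont y in \<open>auto intro: continuous_on_subset\<close>)
    then show False using max[of y] y \<open>p = 1\<close> by auto
  qed
qed

text \<open>The system is linear, so the maximum principle applies to d and to -d. This is the
  injectivity of 1 - A under vanishing flux.\<close>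

lemma zero_of_flux_equation:
  fixes d \<phi> :: "real \<Rightarrow> real"
  assumes "\<And>x. x \<in> {0<..<1} \<Longrightarrow> 0 < s x" "\<And>x. x \<in> {0<..<1} \<Longrightarrow> 0 < m x"
    and "continuous_on {0..1} d"
    and "\<And>x. x \<in> {0<..<1} \<Longrightarrow> (d has_real_derivative s x * \<phi> x) (at x)"
    and "\<And>x. x \<in> {0<..<1} \<Longrightarrow> (\<phi> has_real_derivative m x * d x) (at x)"
    and "(\<phi> \<longlongrightarrow> 0) (at_right 0)" "(\<phi> \<longlongrightarrow> 0) (at_left 1)"
    and "x \<in> {0..1}"
  shows "d x = 0"
proof -
  have "d x \<le> 0" by (rule maximum_principle[OF assms])
  moreover have "- d x \<le> 0"
  proof (rule maximum_principle[where s=s and m=m and d="\<lambda>x. - d x" and \<phi>="\<lambda>x. - \<phi> x"])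
    show "((\<lambda>x. - \<phi> x) \<longlongrightarrow> 0) (at_right 0)" "((\<lambda>x. - \<phi> x) \<longlongrightarrow> 0) (at_left 1)"
      using assms(6,7) by (auto dest: tendsto_minus)
    show "((\<lambda>x. - d x) has_real_derivative s x * - \<phi> x) (at x)" if "x \<in> {0<..<1}" for x
      using DERIV_minus[OF assms(4)[OF that]] by simp
    show "((\<lambda>x. - \<phi> x) has_real_derivative m x * - d x) (at x)" if "x \<in> {0<..<1}" for x
      using DERIV_minus[OF assms(5)[OF that]] by simp
  qed (use assms in \<open>auto intro!: continuous_intros\<close>)
  ultimately show ?thesis by simp
qed

section \<open>Smooth step functions\<close>

lemma DERIV_max_power:
  "((\<lambda>u::real. max 0 u ^ (n + 2)) has_real_derivative real (n + 2) * max 0 u ^ (n + 1)) (at u)"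
proof (cases u "0::real" rule: linorder_cases)
  case less
  have "((\<lambda>u. 0) has_real_derivative 0) (at u)" by simp
  moreover have "\<forall>\<^sub>F v in nhds u. 0 = max 0 v ^ (n + 2)"
    using eventually_nhds_in_open[of "{..<0}" u] less by (auto elim!: eventually_mono)
  ultimately show ?thesis using less
    by (subst DERIV_cong_ev[OF refl _ refl, symmetric, where f="\<lambda>u. 0"]) auto
next
  case greater
  have "((\<lambda>u. u ^ (n + 2)) has_real_derivative real (n + 2) * u ^ (n + 1)) (at u)"
    using DERIV_pow[of "n + 2" u] by simp
  moreover have "\<forall>\<^sub>F v in nhds u. v ^ (n + 2) = max 0 v ^ (n + 2)"
    using eventually_nhds_in_open[of "{0<..}" u] greater by (auto elim!: eventually_mono)
  ultimately show ?thesis using greater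
    by (subst DERIV_cong_ev[OF refl _ refl, symmetric, where f="\<lambda>u. u ^ (n + 2)"]) auto
next
  case equal
  have "((\<lambda>h::real. max 0 h ^ (n + 1)) \<longlongrightarrow> max 0 0 ^ (n + 1)) (at 0)"
    by (intro tendsto_intros)
  then have "((\<lambda>h::real. max 0 h ^ (n + 1)) \<longlongrightarrow> 0) (at 0)" by simp
  \<comment> \<open>At the kink the difference quotient is the positive part to the power n + 1,
    whose exponent is still positive, so it tends to 0 from both sides.\<close>
  then have "((\<lambda>h::real. max 0 h ^ (n + 2) / h) \<longlongrightarrow> 0) (at 0)"
  proof (rule Lim_transform_eventually)
    show "\<forall>\<^sub>F h in at (0::real). max 0 h ^ (n + 1) = max 0 h ^ (n + 2) / h"
      by (auto simp: eventually_at_filter max_def)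
  qed
  then show ?thesis using equal by (simp add: DERIV_def)
qed

text \<open>A step from 0 to 1 across [\<alpha>, \<alpha> + w]. The cube of the positive part is
  C^2, so the inner one glues smoothly at \<alpha> and the outer one at \<alpha> + w. Two continuous
  derivatives are needed for A of the step to be continuous.\<close>

definition step :: "real \<Rightarrow> real \<Rightarrow> real \<Rightarrow> real" where
  "step \<alpha> w x = 1 - max 0 (1 - max 0 ((x - \<alpha>) / w) ^ 3) ^ 3"

definition step' :: "real \<Rightarrow> real \<Rightarrow> real \<Rightarrow> real" where
  "step' \<alpha> w x = 9 / w * max 0 (1 - max 0 ((x - \<alpha>) / w) ^ 3) ^ 2 * max 0 ((x - \<alpha>) / w) ^ 2"

definition step'' :: "real \<Rightarrow> real \<Rightarrow> real \<Rightarrow> real" where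
  "step'' \<alpha> w x = 18 / w\<^sup>2 * max 0 (1 - max 0 ((x - \<alpha>) / w) ^ 3) ^ 2 * max 0 ((x - \<alpha>) / w)
     - 54 / w\<^sup>2 * max 0 (1 - max 0 ((x - \<alpha>) / w) ^ 3) * max 0 ((x - \<alpha>) / w) ^ 4"

lemma DERIV_max_cube: "((\<lambda>u::real. max 0 u ^ 3) has_real_derivative 3 * max 0 u ^ 2) (at u)"
  using DERIV_max_power[of 1 u] by (simp add: numeral_eq_Suc)

lemma DERIV_max_square: "((\<lambda>u::real. max 0 u ^ 2) has_real_derivative 2 * max 0 u) (at u)"
  using DERIV_max_power[of 0 u] by (simp add: numeral_eq_Suc)

lemma DERIV_step:
  assumes "0 < w"
  shows "(step \<alpha> w has_real_derivative step' \<alpha> w x) (at x)"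
    and "(step' \<alpha> w has_real_derivative step'' \<alpha> w x) (at x)"
proof -
  let ?v = "\<lambda>x. (x - \<alpha>) / w"
  have v: "(?v has_real_derivative 1 / w) (at x)"
    using assms by (auto intro!: derivative_eq_intros)
  have c: "((\<lambda>x. 1 - max 0 (?v x) ^ 3) has_real_derivative - (3 * max 0 (?v x) ^ 2 * (1 / w))) (at x)"
    using DERIV_diff[OF DERIV_const[of 1] DERIV_chain2[OF DERIV_max_cube v]] by simp
  show "(step \<alpha> w has_real_derivative step' \<alpha> w x) (at x)"
    unfolding step_def[abs_def] step'_def
    by (rule DERIV_cong[OF DERIV_diff[OF DERIV_const[of 1] DERIV_chain2[OF DERIV_max_cube c]]]) simp
  have "((\<lambda>x. 9 / w * (max 0 (1 - max 0 (?v x) ^ 3) ^ 2 * max 0 (?v x) ^ 2)) has_real_derivative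
      9 / w * ((2 * max 0 (1 - max 0 (?v x) ^ 3) * - (3 * max 0 (?v x) ^ 2 * (1 / w))) * max 0 (?v x) ^ 2
        + (2 * max 0 (?v x) * (1 / w)) * max 0 (1 - max 0 (?v x) ^ 3) ^ 2)) (at x)"
    by (intro DERIV_cmult DERIV_mult DERIV_chain2[OF DERIV_max_square c] DERIV_chain2[OF DERIV_max_square v])
  moreover have "step' \<alpha> w = (\<lambda>x. 9 / w * (max 0 (1 - max 0 (?v x) ^ 3) ^ 2 * max 0 (?v x) ^ 2))"
    by (simp add: fun_eq_iff step'_def)
  ultimately show "(step' \<alpha> w has_real_derivative step'' \<alpha> w x) (at x)"
  proof (elim DERIV_cong ssubst)
    have "9 / w * ((2 * a * - (3 * b ^ 2 * (1 / w))) * b ^ 2 + (2 * b * (1 / w)) * a ^ 2)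
        = 18 / w\<^sup>2 * a ^ 2 * b - 54 / w\<^sup>2 * a * b ^ 4" for a b :: real
      using assms by (simp add: field_simps power2_eq_square eval_nat_numeral)
    then show "9 / w * ((2 * max 0 (1 - max 0 (?v x) ^ 3) * - (3 * max 0 (?v x) ^ 2 * (1 / w))) * max 0 (?v x) ^ 2
        + (2 * max 0 (?v x) * (1 / w)) * max 0 (1 - max 0 (?v x) ^ 3) ^ 2) = step'' \<alpha> w x"
      unfolding step''_def .
  qed
qed

lemma step_lower:
  assumes "0 < w" "x \<le> \<alpha>"
  shows "step \<alpha> w x = 0" "step' \<alpha> w x = 0" "step'' \<alpha> w x = 0"
proof -
  have "max 0 ((x - \<alpha>) / w) = 0" using assms by (simp add: max_def field_simps)
  then show "step \<alpha> w x = 0" "step' \<alpha> w x = 0" "step'' \<alpha> w x = 0"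
    by (simp_all add: step_def step'_def step''_def)
qed

lemma step_upper:
  assumes "0 < w" "\<alpha> + w \<le> x"
  shows "step \<alpha> w x = 1" "step' \<alpha> w x = 0" "step'' \<alpha> w x = 0"
proof -
  have "1 \<le> (x - \<alpha>) / w" using assms by (simp add: field_simps)
  then have "1 \<le> max 0 ((x - \<alpha>) / w) ^ 3" by (intro one_le_power) simp
  then have "max 0 (1 - max 0 ((x - \<alpha>) / w) ^ 3) = 0" by simp
  then show "step \<alpha> w x = 1" "step' \<alpha> w x = 0" "step'' \<alpha> w x = 0"
    by (simp_all only: step_def step'_def step''_def) simp_all
qed

lemma step_le_1: "step \<alpha> w x \<le> 1"
  by (simp add: step_def)

lemma step'_nonneg: "0 < w \<Longrightarrow> 0 \<le> step' \<alpha> w x"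
  by (simp add: step'_def)

lemma step'_pos:
  assumes "\<alpha> < x" "x < \<alpha> + w"
  shows "0 < step' \<alpha> w x"
proof -
  have "0 < w" using assms by simp
  then have v: "0 < (x - \<alpha>) / w" "(x - \<alpha>) / w < 1" using assms by (auto simp: field_simps)
  then have v3: "((x - \<alpha>) / w) ^ 3 < 1" by (intro power_strict_mono[of _ 1, simplified]) auto
  then have "0 < (1 - ((x - \<alpha>) / w) ^ 3)\<^sup>2" by (intro zero_less_power) simp
  moreover have "0 < ((x - \<alpha>) / w)\<^sup>2" using v by (intro zero_less_power)
  moreover have "step' \<alpha> w x = 9 / w * (1 - ((x - \<alpha>) / w) ^ 3)\<^sup>2 * ((x - \<alpha>) / w)\<^sup>2"
    using v v3 by (simp add: step'_def max_def)
  ultimately show ?thesis using \<open>0 < w\<close> by (simp only: mult_pos_pos divide_pos_pos zero_less_numeral)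
qed

lemma continuous_step:
  "continuous_on A (step \<alpha> w)" "continuous_on A (step' \<alpha> w)" "continuous_on A (step'' \<alpha> w)"
  unfolding step_def[abs_def] step'_def[abs_def] step''_def[abs_def] divide_inverse
  by (intro continuous_intros)+

section \<open>The domain of the generator\<close>

text \<open>Turns the integrals against speed and scale measure in the boundary classification into
  Lebesgue integrals on the line, where the primitives apply.\<close>

lemma nn_integral_density_unit_interval:
  fixes w g :: "real \<Rightarrow> real"
  assumes w: "continuous_on {0<..<1} w" and g: "continuous_on {0<..<1} g"
    and A: "A \<subseteq> {0<..<1}" "A \<in> sets borel"
  shows "(\<integral>\<^sup>+\<eta>\<in>A. ennreal (g \<eta>) \<partial>density (restrict_space lborel {0<..<1}) (\<lambda>x. ennreal (w x)))
    = (\<integral>\<^sup>+\<eta>\<in>A. ennreal (w \<eta>) * ennreal (g \<eta>) \<partial>lborel)"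
proof -
  let ?R = "restrict_space lborel {0<..<1::real}"
  have sets: "sets ?R = sets (restrict_space borel {0<..<1})"
    by (simp add: sets_restrict_space)
  have m: "(\<lambda>x. ennreal (h x)) \<in> borel_measurable ?R" if "continuous_on {0<..<1} h" for h :: "real \<Rightarrow> real"
  proof -
    have "h \<in> borel_measurable (restrict_space borel {0<..<1})"
      using that by (rule borel_measurable_continuous_on_restrict)
    then have "h \<in> borel_measurable ?R" using sets by (simp cong: measurable_cong_sets)
    then show ?thesis by simp
  qed
  have "(\<lambda>x. indicator A x :: ennreal) \<in> borel_measurable ?R"
    using A(2) by (intro measurable_restrict_space1 borel_measurable_indicator) simp
  then have "(\<lambda>\<eta>. ennreal (g \<eta>) * indicator A \<eta>) \<in> borel_measurable ?R"
    using m[OF g] by (intro borel_measurable_times_ennreal)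
  then have "(\<integral>\<^sup>+\<eta>\<in>A. ennreal (g \<eta>) \<partial>density ?R (\<lambda>x. ennreal (w x)))
     = (\<integral>\<^sup>+\<eta>. ennreal (w \<eta>) * (ennreal (g \<eta>) * indicator A \<eta>) * indicator {0<..<1} \<eta> \<partial>lborel)"
    by (simp add: nn_integral_density m[OF w] nn_integral_restrict_space)
  also have "\<dots> = (\<integral>\<^sup>+\<eta>\<in>A. ennreal (w \<eta>) * ennreal (g \<eta>) \<partial>lborel)"
    using A(1) by (intro nn_integral_cong) (auto simp: indicator_def)
  finally show ?thesis .
qed

text \<open>Contains what \<open>X\<close> and its dual have in common; the assumption on the
  boundaries concerns \<open>X\<close> alone and is added later.\<close>

locale diffusion_coefficients =
  fixes X :: "'w diffusion"
  assumes drift_cont: "continuous_on {0<..<1} (drift X)"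
    and diff_cont: "continuous_on {0<..<1} (diffusivity X)"
    and diff_pos: "\<And>x. x \<in> {0<..<1} \<Longrightarrow> 0 < diffusivity X x"
begin

lemma diff_nz: "x \<in> {0<..<1} \<Longrightarrow> diffusivity X x \<noteq> 0"
  using diff_pos by fastforce

lemma scale_density_pos [simp]: "0 < scale_density X x"
  by (simp add: scale_density_def)

lemma scale_density_nz [simp]: "scale_density X x \<noteq> 0"
  by (metis less_irrefl scale_density_pos)

lemma DERIV_scale_density:
  assumes x: "x \<in> {0<..<1}"
  shows "(scale_density X has_real_derivative - (2 * drift X x / diffusivity X x) * scale_density X x) (at x)"
proof -
  have "continuous_on {0<..<1} (\<lambda>x. 2 * drift X x / diffusivity X x)"
    using diff_nz by (intro continuous_intros drift_cont diff_cont) auto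
  from DERIV_LBINT[OF this _ x, of "1/2"]
  have "((\<lambda>x. exp (- (LBINT y=ereal (1/2)..ereal x. 2 * drift X y / diffusivity X y)))
      has_real_derivative exp (- (LBINT y=ereal (1/2)..ereal x. 2 * drift X y / diffusivity X y))
         * - (2 * drift X x / diffusivity X x)) (at x)"
    by (intro DERIV_chain2[OF DERIV_exp] DERIV_minus) simp
  then show ?thesis
    unfolding scale_density_def[abs_def] by (simp only: mult.commute)
qed

lemma continuous_scale_density: "continuous_on {0<..<1} (scale_density X)"
  using DERIV_scale_density by (meson DERIV_isCont continuous_at_imp_continuous_on)

lemma continuous_speed_density: "continuous_on {0<..<1} (speed_density X)"
  unfolding speed_density_def[abs_def]
  using diff_nz by (intro continuous_intros continuous_scale_density diff_cont) auto

lemma speed_density_pos: "x \<in> {0<..<1} \<Longrightarrow> 0 < speed_density X x"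
  using diff_pos by (simp add: speed_density_def)

lemma scale_primitive: "density_primitive (scale_density X) (scale_fun X)"
  unfolding scale_fun_def[abs_def]
  by unfold_locales (auto intro!: continuous_scale_density DERIV_LBINT)

lemma speed_primitive: "density_primitive (speed_density X) (speed_fun X)"
  unfolding speed_fun_def[abs_def]
  by unfold_locales (auto intro!: continuous_speed_density DERIV_LBINT speed_density_pos)

lemma feller_functionals:
  assumes "x \<in> {0<..<1}"
  shows "feller_N X Lower x = lower_functional (speed_density X) (scale_fun X) x"
    and "feller_N X Upper x = upper_functional (speed_density X) (scale_fun X) x"
    and "feller_Sigma X Lower x = lower_functional (scale_density X) (speed_fun X) x"
    and "feller_Sigma X Upper x = upper_functional (scale_density X) (speed_fun X) x"
  unfolding feller_N.simps feller_Sigma.simps speed_measure_def scale_measure_def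
    lower_functional_def upper_functional_def
  using assms
  by (auto intro!: nn_integral_density_unit_interval continuous_intros continuous_scale_density
      continuous_speed_density density_primitive.continuous_prim[OF scale_primitive]
      density_primitive.continuous_prim[OF speed_primitive])

text \<open>Feller's form of the generator, half of d/dM d/dS: the terms with the drift come from
  s'/s = -2a/b. Since \<open>u1\<close> and \<open>u2\<close> are arbitrary, it applies also to
  differences of solutions.\<close>

lemma DERIV_flux:
  assumes x: "x \<in> {0<..<1}" and "(u1 has_real_derivative u2) (at x)"
  shows "((\<lambda>x. u1 x / scale_density X x) has_real_derivative
     2 * speed_density X x * (1/2 * diffusivity X x * u2 + drift X x * u1 x)) (at x)"
  by (rule DERIV_cong[OF DERIV_divide[OF assms(2) DERIV_scale_density[OF x]]])
     (use diff_nz[OF x] in \<open>auto simp: speed_density_def field_simps\<close>)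

end

lemma C2_on_interiorD:
  assumes "C2_on_interior f" "x \<in> {0<..<1}"
  shows "(f has_real_derivative deriv f x) (at x)"
    and "(deriv f has_real_derivative deriv (deriv f) x) (at x)"
proof -
  have "\<exists>D. (h has_real_derivative D) (at x)" if "h C1_differentiable_on {0<..<1}" for h
    using that assms(2) unfolding C1_differentiable_on_def has_real_derivative_iff_has_vector_derivative by blast
  then have "f field_differentiable at x" "deriv f field_differentiable at x"
    using assms(1) by (auto simp: C2_on_interior_def field_differentiable_def)
  then show "(f has_real_derivative deriv f x) (at x)"
    "(deriv f has_real_derivative deriv (deriv f) x) (at x)"
    by (auto simp: DERIV_deriv_iff_field_differentiable)
qed

locale stationary_diffusion =
  fixes X :: "'w diffusion"
  assumes feller_diffusion: "feller_diffusion X"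
    and boundary: "\<And>e. reflecting_boundary X e \<or> entrance_boundary X e"
begin

sublocale feller_process X
  using feller_diffusion by unfold_locales (simp add: feller_diffusion_def)

sublocale diffusion_coefficients X
  using feller_diffusion by unfold_locales (auto simp: feller_diffusion_def)

lemma gen_dom_DERIV:
  assumes "f \<in> gen_dom X" "x \<in> {0<..<1}"
  shows "(f has_real_derivative deriv f x) (at x)"
    and "(deriv f has_real_derivative deriv (deriv f) x) (at x)"
    and "gen X f x = 1/2 * diffusivity X x * deriv (deriv f) x + drift X x * deriv f x"
  using assms feller_diffusion C2_on_interiorD[of f x] by (auto simp: feller_diffusion_def)

section \<open>Finite speed mass and the stationary distribution\<close>

lemma feller_N_finite: "x \<in> {0<..<1} \<Longrightarrow> feller_N X e x < \<infinity>"
  using boundary[of e] by (auto simp: reflecting_boundary_def regular_boundary_def entrance_boundary_def)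

lemma speed_finite_lower: "x \<in> {0<..<1} \<Longrightarrow> (\<integral>\<^sup>+\<eta>\<in>{0<..x}. ennreal (speed_density X \<eta>) \<partial>lborel) < \<infinity>"
  using feller_N_finite[of x Lower]
  by (intro lower_functional_finiteD[OF speed_primitive scale_primitive]) (auto simp: feller_functionals simp del: feller_N.simps feller_Sigma.simps)

lemma speed_finite_upper: "x \<in> {0<..<1} \<Longrightarrow> (\<integral>\<^sup>+\<eta>\<in>{x..<1}. ennreal (speed_density X \<eta>) \<partial>lborel) < \<infinity>"
  using feller_N_finite[of x Upper]
  by (intro upper_functional_finiteD[OF speed_primitive scale_primitive]) (auto simp: feller_functionals simp del: feller_N.simps feller_Sigma.simps)

definition mass :: real where "mass = measure (speed_measure X) {0<..<1}"

lemma emeasure_speed: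
  "emeasure (speed_measure X) {0<..<1} = (\<integral>\<^sup>+\<eta>\<in>{0<..<1}. ennreal (speed_density X \<eta>) \<partial>lborel)"
proof -
  have "{0<..<1} \<in> sets (restrict_space lborel {0<..<1::real})"
    by (auto simp: sets_restrict_space image_iff intro!: bexI[of _ "{0<..<1}"])
  then show ?thesis
    using nn_integral_density_unit_interval[OF continuous_speed_density continuous_on_const[of _ 1], of "{0<..<1}"]
    by (simp add: speed_measure_def)
qed

lemma emeasure_speed_finite: "emeasure (speed_measure X) {0<..<1} < \<infinity>"
proof -
  have "(\<integral>\<^sup>+\<eta>\<in>{0<..<1}. ennreal (speed_density X \<eta>) \<partial>lborel)
     \<le> (\<integral>\<^sup>+\<eta>. ennreal (speed_density X \<eta>) * indicator {0<..1/2} \<eta>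
           + ennreal (speed_density X \<eta>) * indicator {1/2..<1} \<eta> \<partial>lborel)"
    by (intro nn_integral_mono) (auto simp: indicator_def)
  also have "\<dots> = (\<integral>\<^sup>+\<eta>\<in>{0<..1/2}. ennreal (speed_density X \<eta>) \<partial>lborel)
      + (\<integral>\<^sup>+\<eta>\<in>{1/2..<1}. ennreal (speed_density X \<eta>) \<partial>lborel)"
    by (intro nn_integral_add measurable_on_unit_interval_lborel continuous_speed_density) auto
  also have "\<dots> < \<infinity>" using speed_finite_lower[of "1/2"] speed_finite_upper[of "1/2"] by simp
  finally show ?thesis unfolding emeasure_speed .
qed

lemma mass_pos: "0 < mass"
proof -
  interpret m: density_primitive "speed_density X" "speed_fun X" by (rule speed_primitive)
  have "0 < ennreal (speed_fun X (3/4) - speed_fun X (1/4))"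
    using m.prim_less[of "1/4" "3/4"] by simp
  also have "\<dots> = (\<integral>\<^sup>+\<eta>\<in>{1/4..3/4}. ennreal (speed_density X \<eta>) \<partial>lborel)"
    by (rule m.nn_integral_prim[symmetric]) auto
  also have "\<dots> \<le> (\<integral>\<^sup>+\<eta>\<in>{0<..<1}. ennreal (speed_density X \<eta>) \<partial>lborel)"
    by (intro nn_integral_mono mult_left_mono) (auto simp: indicator_def)
  finally have "0 < emeasure (speed_measure X) {0<..<1}" unfolding emeasure_speed .
  then show ?thesis
    using emeasure_speed_finite unfolding mass_def measure_def by (simp add: enn2real_positive_iff)
qed


lemma stat_density_eq: "stat_density X x = speed_density X x / mass"
  by (simp add: stat_density_def mass_def)

lemma stat_density_pos: "x \<in> {0<..<1} \<Longrightarrow> 0 < stat_density X x"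
  using mass_pos speed_density_pos by (simp add: stat_density_eq)

lemma continuous_stat_density: "continuous_on {0<..<1} (stat_density X)"
  unfolding stat_density_eq[abs_def] using mass_pos by (intro continuous_intros continuous_speed_density) auto

lemma integrable_stat_density: "set_integrable lborel {0<..<1} (stat_density X)"
proof -
  have "set_integrable lborel {0<..<1} (speed_density X)"
    unfolding set_integrable_def
  proof (rule integrableI_bounded)
    show "(\<lambda>x. indicator {0<..<1} x *\<^sub>R speed_density X x) \<in> borel_measurable lborel"
      using borel_measurable_continuous_on_indicator[OF _ continuous_speed_density] by simp
    have "(\<integral>\<^sup>+x. ennreal (norm (indicator {0<..<1} x *\<^sub>R speed_density X x)) \<partial>lborel)
        = (\<integral>\<^sup>+\<eta>\<in>{0<..<1}. ennreal (speed_density X \<eta>) \<partial>lborel)"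
      using speed_density_pos by (intro nn_integral_cong) (auto simp: indicator_def less_imp_le)
    then show "(\<integral>\<^sup>+x. ennreal (norm (indicator {0<..<1} x *\<^sub>R speed_density X x)) \<partial>lborel) < \<infinity>"
      using emeasure_speed_finite unfolding emeasure_speed by simp
  qed
  then show ?thesis unfolding stat_density_eq[abs_def] by simp
qed

lemma stat_primitive: "density_primitive (stat_density X) (stat_cdf X)"
  unfolding stat_cdf_def[abs_def]
  by unfold_locales
     (auto intro!: continuous_stat_density DERIV_LBINT_0 integrable_stat_density stat_density_pos)

lemma continuous_stat_cdf: "continuous_on {0..1} (stat_cdf X)"
  unfolding stat_cdf_def[abs_def] by (rule continuous_LBINT[OF integrable_stat_density])

lemma stat_cdf_0 [simp]: "stat_cdf X 0 = 0"
  by (simp add: stat_cdf_def zero_ereal_def[symmetric])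

lemma stat_cdf_less: "0 \<le> x \<Longrightarrow> x < y \<Longrightarrow> y \<le> 1 \<Longrightarrow> stat_cdf X x < stat_cdf X y"
  by (rule DERIV_pos_imp_increasing_open)
     (auto intro!: continuous_on_subset[OF continuous_stat_cdf] stat_density_pos
        density_primitive.prim[OF stat_primitive] exI)

lemma stat_cdf_le: "0 \<le> x \<Longrightarrow> x \<le> y \<Longrightarrow> y \<le> 1 \<Longrightarrow> stat_cdf X x \<le> stat_cdf X y"
  using stat_cdf_less[of x y] by (cases "x = y") auto

lemma stat_cdf_pos: "0 < x \<Longrightarrow> x \<le> 1 \<Longrightarrow> 0 < stat_cdf X x"
  using stat_cdf_less[of 0 x] by simp

lemma tendsto_stat_cdf: "(stat_cdf X \<longlongrightarrow> 0) (at_right 0)" "(stat_cdf X \<longlongrightarrow> stat_cdf X 1) (at_left 1)"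
  using continuous_stat_cdf
  by (auto simp: continuous_on_Icc_at_rightD continuous_on_Icc_at_leftD dest: continuous_on_Icc_at_rightD)

text \<open>For a reflecting boundary this is the definition. At an entrance boundary, \<Sigma> is
  infinite while the speed mass is finite, which forces an unbounded scale function, and the results
  on bounded functions apply.\<close>

lemma flux_vanishes:
  assumes f: "f \<in> gen_dom X"
  shows "((\<lambda>x. deriv f x / scale_density X x) \<longlongrightarrow> 0) (inward_filter e)"
proof (cases "reflecting_boundary X e")
  case True
  then show ?thesis using f by (auto simp: reflecting_boundary_def)
next
  case False
  then have ent: "entrance_boundary X e" using boundary by blast
  let ?\<phi> = "\<lambda>x. deriv f x / scale_density X x"
  obtain B where B: "\<forall>x\<in>{0..1}. \<bar>f x\<bar> \<le> B"
    using continuous_bounded_interval[OF gen_domD(1)[OF f]] by blast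
  obtain C where C: "\<forall>x\<in>{0..1}. \<bar>gen X f x\<bar> \<le> C"
    using continuous_bounded_interval[OF gen_domD(2)[OF f]] by blast
  have df: "(f has_real_derivative scale_density X x * ?\<phi> x) (at x)" if "x \<in> {0<..<1}" for x
    using gen_dom_DERIV(1)[OF f that] by simp
  \<comment> \<open>The speed density is traded for the stationary density, with \<open>mass\<close>
    moved into the source term, because \<open>stat_cdf\<close> has known limits at both
    ends.\<close>
  have d\<phi>: "(?\<phi> has_real_derivative 2 * stat_density X x * (mass * gen X f x)) (at x)" if "x \<in> {0<..<1}" for x
    using DERIV_flux[OF that gen_dom_DERIV(2)[OF f that]] gen_dom_DERIV(3)[OF f that] mass_pos
    by (simp add: stat_density_eq mult.assoc)
  have bounds: "\<bar>f x\<bar> \<le> B" "\<bar>mass * gen X f x\<bar> \<le> mass * C" if "x \<in> {0<..<1}" for x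
    using B C that mass_pos by (auto simp: abs_mult)
  interpret s: density_primitive "scale_density X" "scale_fun X" by (rule scale_primitive)
  have half: "1/2 \<in> {0<..<1::real}" by simp
  show ?thesis
  proof (cases e)
    case Lower
    have "lower_functional (scale_density X) (speed_fun X) (1/2) = \<infinity>"
      using ent half Lower by (auto simp: entrance_boundary_def feller_functionals simp del: feller_N.simps feller_Sigma.simps)
    then have inf: "(\<integral>\<^sup>+\<eta>\<in>{0<..1/2}. ennreal (scale_density X \<eta>) \<partial>lborel) = \<infinity>"
      by (intro lower_functional_infiniteD[OF scale_primitive speed_primitive] speed_finite_lower) auto
    have "\<exists>y\<in>{0<..<1/2}. K < scale_fun X (1/2) - scale_fun X y" for K
    proof (rule ccontr)
      assume *: "\<not> ?thesis"
      \<comment> \<open>The maximum with 0 is needed because K may be negative while the difference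
        is 0 at y = 1/2.\<close>
      have "scale_fun X (1/2) - scale_fun X y \<le> max 0 K" if "0 < y" "y \<le> 1/2" for y
      proof (cases "y = 1/2")
        case False
        then have "y \<in> {0<..<1/2}" using that by auto
        then have "\<not> K < scale_fun X (1/2) - scale_fun X y" using * by blast
        then show ?thesis by simp
      next
        case True
        show ?thesis unfolding True by simp
      qed
      then have "(\<integral>\<^sup>+\<eta>\<in>{0<..1/2}. ennreal (scale_density X \<eta>) \<partial>lborel) \<le> ennreal (max 0 K)"
        by (intro s.nn_integral_lower_le) auto
      then show False using inf by (simp add: top_unique)
    qed
    then show ?thesis
      using flux_vanishes_lower[OF scale_primitive stat_primitive df d\<phi> bounds tendsto_stat_cdf(1) half] Lower
      by simp
  next
    case Upper
    have "upper_functional (scale_density X) (speed_fun X) (1/2) = \<infinity>"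
      using ent half Upper by (auto simp: entrance_boundary_def feller_functionals simp del: feller_N.simps feller_Sigma.simps)
    then have "(\<integral>\<^sup>+\<eta>\<in>{1/2..<1}. ennreal (scale_density X \<eta>) \<partial>lborel) = \<infinity>"
      by (intro upper_functional_infiniteD[OF scale_primitive speed_primitive] speed_finite_upper) auto
    then have inf: "(\<integral>\<^sup>+\<eta>\<in>{0<..1/2}. ennreal (scale_density X (1 - \<eta>)) \<partial>lborel) = \<infinity>"
      by (subst (asm) nn_integral_reflect) (auto intro: continuous_scale_density)
    interpret r: density_primitive "\<lambda>x. scale_density X (1 - x)" "\<lambda>x. - scale_fun X (1 - x)"
      by (rule density_primitive_reflect[OF scale_primitive])
    have "\<exists>y\<in>{1/2<..<1}. K < scale_fun X y - scale_fun X (1/2)" for K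
    proof (rule ccontr)
      assume *: "\<not> ?thesis"
      have "- scale_fun X (1 - 1/2) - - scale_fun X (1 - y) \<le> max 0 K" if "0 < y" "y \<le> 1/2" for y
      proof (cases "y = 1/2")
        case False
        then have "1 - y \<in> {1/2<..<1}" using that by auto
        then have "\<not> K < scale_fun X (1 - y) - scale_fun X (1/2)" using * by blast
        then show ?thesis by simp
      next
        case True
        show ?thesis unfolding True by simp
      qed
      then have "(\<integral>\<^sup>+\<eta>\<in>{0<..1/2}. ennreal (scale_density X (1 - \<eta>)) \<partial>lborel) \<le> ennreal (max 0 K)"
        by (intro r.nn_integral_lower_le) auto
      then show False using inf by (simp add: top_unique)
    qed
    then show ?thesis
      using flux_vanishes_upper[OF scale_primitive stat_primitive df d\<phi> bounds tendsto_stat_cdf(2) half] Upper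
      by simp
  qed
qed

text \<open>Here v is Au, extended continuously to the boundary. The resolvent R of u - v satisfies
  (1 - A) R = u - v = (1 - A) u, so u - R solves the homogeneous equation with vanishing flux and is
  0. The domain element R agrees with u on [0,1], where alone functions matter.\<close>

lemma gen_dom_exists:
  assumes u: "continuous_on {0..1} u" and v: "continuous_on {0..1} v"
    and u1: "\<And>x. x \<in> {0<..<1} \<Longrightarrow> (u has_real_derivative u1 x) (at x)"
    and u2: "\<And>x. x \<in> {0<..<1} \<Longrightarrow> (u1 has_real_derivative u2 x) (at x)"
    and eq: "\<And>x. x \<in> {0<..<1} \<Longrightarrow> v x = 1/2 * diffusivity X x * u2 x + drift X x * u1 x"
    and flux: "\<And>e. ((\<lambda>x. u1 x / scale_density X x) \<longlongrightarrow> 0) (inward_filter e)"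
  obtains f where "f \<in> gen_dom X" "\<And>x. x \<in> {0..1} \<Longrightarrow> f x = u x"
proof
  let ?h = "\<lambda>x. u x - v x"
  let ?R = "resolvent ?h"
  have h: "continuous_on {0..1} ?h" using u v by (intro continuous_intros)
  show R: "?R \<in> gen_dom X" by (rule resolvent_equation(1)[OF h])
  have genR: "gen X ?R x = ?R x - ?h x" if "x \<in> {0..1}" for x
    by (rule resolvent_equation(2)[OF h that])
  fix x :: real assume x: "x \<in> {0..1}"
  have "u x - ?R x = 0"
  proof (rule zero_of_flux_equation[where s="scale_density X" and m="\<lambda>x. 2 * speed_density X x"
        and d="\<lambda>x. u x - ?R x" and \<phi>="\<lambda>x. (u1 x - deriv ?R x) / scale_density X x", OF _ _ _ _ _ _ _ x])
    fix y :: real assume y: "y \<in> {0<..<1}"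
    show "0 < scale_density X y" "0 < 2 * speed_density X y" using speed_density_pos[OF y] by auto
    show "((\<lambda>x. u x - ?R x) has_real_derivative scale_density X y * ((u1 y - deriv ?R y) / scale_density X y)) (at y)"
      using DERIV_diff[OF u1[OF y] gen_dom_DERIV(1)[OF R y]] by simp
    have "1/2 * diffusivity X y * (u2 y - deriv (deriv ?R) y) + drift X y * (u1 y - deriv ?R y)
        = v y - gen X ?R y"
      using eq[OF y] gen_dom_DERIV(3)[OF R y] by (simp add: algebra_simps)
    also have "\<dots> = u y - ?R y" using genR[of y] y by simp
    finally show "((\<lambda>x. (u1 x - deriv ?R x) / scale_density X x) has_real_derivative
        2 * speed_density X y * (u y - ?R y)) (at y)"
      using DERIV_flux[OF y DERIV_diff[OF u2[OF y] gen_dom_DERIV(2)[OF R y]]] by simp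
  next
    show "continuous_on {0..1} (\<lambda>x. u x - ?R x)"
      using u continuous_resolvent[OF h] by (intro continuous_intros)
    have "((\<lambda>x. (u1 x - deriv ?R x) / scale_density X x) \<longlongrightarrow> 0) (inward_filter e)" for e
      using tendsto_diff[OF flux flux_vanishes[OF R], of e] by (simp add: diff_divide_distrib)
    from this[of Lower] this[of Upper]
    show "((\<lambda>x. (u1 x - deriv ?R x) / scale_density X x) \<longlongrightarrow> 0) (at_right 0)"
      "((\<lambda>x. (u1 x - deriv ?R x) / scale_density X x) \<longlongrightarrow> 0) (at_left 1)" by simp_all
  qed
  then show "?R x = u x" by simp
qed

text \<open>The step is constant near both ends, so its flux is eventually 0 and A of it extends by
  0, whatever the coefficients do at the boundary.\<close>

lemma step_in_gen_dom:
  assumes "0 < \<alpha>" "0 < w" "\<alpha> + w < 1"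
  obtains f where "f \<in> gen_dom X" "\<And>x. x \<in> {0..1} \<Longrightarrow> f x = step \<alpha> w x"
proof -
  let ?v = "\<lambda>x. if x \<in> {0<..<1} then 1/2 * diffusivity X x * step'' \<alpha> w x + drift X x * step' \<alpha> w x else 0"
  \<comment> \<open>An open cover of [0,1]: on the outer two sets the function vanishes, on (0,1) it
    is the differential expression.\<close>
  have "continuous_on ({0<..<1} \<union> ({..<\<alpha>} \<union> {\<alpha> + w<..})) ?v"
  proof (intro continuous_on_open_Un)
    have "continuous_on {0<..<1} (\<lambda>x. 1/2 * diffusivity X x * step'' \<alpha> w x + drift X x * step' \<alpha> w x)"
      by (intro continuous_intros diff_cont drift_cont continuous_step)
    then show "continuous_on {0<..<1} ?v" by (rule continuous_on_eq) simp
    have 0: "continuous_on A (\<lambda>x. 0 :: real)" for A :: "real set" by simp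
    show "continuous_on {..<\<alpha>} ?v"
      by (rule continuous_on_eq[OF 0]) (use step_lower[OF assms(2)] in auto)
    show "continuous_on {\<alpha> + w<..} ?v"
      by (rule continuous_on_eq[OF 0]) (use step_upper[OF assms(2)] in auto)
  qed auto
  then have v: "continuous_on {0..1} ?v"
    by (rule continuous_on_subset) (use assms in auto)
  have "((\<lambda>x. step' \<alpha> w x / scale_density X x) \<longlongrightarrow> 0) (inward_filter e)" for e
  proof (rule tendsto_eventually)
    show "\<forall>\<^sub>F x in inward_filter e. step' \<alpha> w x / scale_density X x = 0"
    proof (cases e)
      case Lower
      have "\<forall>\<^sub>F x in at_right 0. step' \<alpha> w x / scale_density X x = 0"
        unfolding eventually_at_right_field
        using assms step_lower(2)[OF assms(2)] by (intro exI[of _ \<alpha>]) auto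
      then show ?thesis using Lower by simp
    next
      case Upper
      have "\<forall>\<^sub>F x in at_left 1. step' \<alpha> w x / scale_density X x = 0"
        unfolding eventually_at_left_field
        using assms step_upper(2)[OF assms(2)] by (intro exI[of _ "\<alpha> + w"]) auto
      then show ?thesis using Upper by simp
    qed
  qed
  then show ?thesis
    using gen_dom_exists[OF continuous_step(1) v DERIV_step(1)[OF assms(2)] DERIV_step(2)[OF assms(2)]] that
    by auto
qed

end

section \<open>The coefficients of the dual\<close>

context stationary_diffusion
begin

section \<open>The link and its derivative\<close>

definition weighted :: "(real \<Rightarrow> real) \<Rightarrow> real \<Rightarrow> real" where
  "weighted f x = (LBINT y=0..ereal x. stat_density X y * f y)"

text \<open>The reversed hazard rate of the stationary distribution, the logarithmic derivative of
  \<Pi>.\<close>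

definition hazard :: "real \<Rightarrow> real" where
  "hazard x = stat_density X x / stat_cdf X x"

lemma link_eq: "x \<noteq> 0 \<Longrightarrow> link X f x = weighted f x / stat_cdf X x"
proof -
  assume "x \<noteq> 0"
  have "(LBINT y=0..ereal x. stat_density X y / stat_cdf X x * f y)
      = (LBINT y=0..ereal x. 1 / stat_cdf X x * (stat_density X y * f y))"
    by (intro interval_integral_cong) simp
  then show ?thesis using \<open>x \<noteq> 0\<close>
    by (simp only: link_def weighted_def interval_lebesgue_integral_mult_right if_False) simp
qed

lemma continuous_on_interior: "continuous_on {0..1} f \<Longrightarrow> continuous_on {0<..<1::real} f"
  by (erule continuous_on_subset) auto

lemma integrable_weighted:
  assumes f: "continuous_on {0..1} f"
  shows "set_integrable lborel {0<..<1} (\<lambda>y. stat_density X y * f y)"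
proof -
  obtain B where "0 \<le> B" and B: "\<forall>x\<in>{0..1}. \<bar>f x\<bar> \<le> B"
    using continuous_bounded_interval[OF f] by blast
  have "integrable lborel (\<lambda>x. B * (indicator {0<..<1} x *\<^sub>R stat_density X x))"
    using integrable_stat_density by (intro integrable_mult_right) (simp add: set_integrable_def)
  then show ?thesis unfolding set_integrable_def
  proof (rule Bochner_Integration.integrable_bound)
    have "continuous_on {0<..<1} (\<lambda>y. stat_density X y * f y)"
      by (intro continuous_intros continuous_stat_density continuous_on_interior f)
    then have "(\<lambda>x. indicator {0<..<1} x *\<^sub>R (stat_density X x * f x)) \<in> borel_measurable borel"
      by (rule borel_measurable_continuous_on_indicator[rotated]) simp
    then show "(\<lambda>x. indicator {0<..<1} x *\<^sub>R (stat_density X x * f x)) \<in> borel_measurable lborel"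
      by simp
    show "AE x in lborel. norm (indicator {0<..<1} x *\<^sub>R (stat_density X x * f x))
        \<le> norm (B * (indicator {0<..<1} x *\<^sub>R stat_density X x))"
    proof (rule AE_I2)
      fix x
      show "norm (indicator {0<..<1} x *\<^sub>R (stat_density X x * f x))
        \<le> norm (B * (indicator {0<..<1} x *\<^sub>R stat_density X x))"
      proof (cases "x \<in> {0<..<1}")
        case True
        then have "\<bar>f x\<bar> \<le> B" using B by auto
        then have "\<bar>stat_density X x\<bar> * \<bar>f x\<bar> \<le> \<bar>stat_density X x\<bar> * B" by (intro mult_left_mono) auto
        then show ?thesis using True \<open>0 \<le> B\<close> by (simp add: abs_mult mult.commute)
      qed simp
    qed
  qed
qed

lemma DERIV_weighted:
  assumes f: "continuous_on {0..1} f" and "x \<in> {0<..<1}"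
  shows "(weighted f has_real_derivative stat_density X x * f x) (at x)"
  unfolding weighted_def[abs_def]
  by (intro DERIV_LBINT_0[of "\<lambda>y. stat_density X y * f y"] continuous_intros continuous_stat_density
      continuous_on_interior f integrable_weighted assms(2))

lemma continuous_weighted: "continuous_on {0..1} f \<Longrightarrow> continuous_on {0..1} (weighted f)"
  unfolding weighted_def[abs_def] by (intro continuous_LBINT integrable_weighted)

lemma weighted_0 [simp]: "weighted f 0 = 0"
  by (simp add: weighted_def zero_ereal_def[symmetric])

lemma hazard_pos: "x \<in> {0<..<1} \<Longrightarrow> 0 < hazard x"
  using stat_density_pos[of x] stat_cdf_pos[of x] by (simp add: hazard_def)

text \<open>The quotient rule for (\<integral>\<pi> f)/\<Pi>. It explains why the gap between f and
  \<Lambda>f governs all that follows.\<close>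

lemma DERIV_link:
  assumes f: "continuous_on {0..1} f" and x: "x \<in> {0<..<1}"
  shows "(link X f has_real_derivative hazard x * (f x - link X f x)) (at x)"
proof -
  have P: "stat_cdf X x \<noteq> 0" using stat_cdf_pos[of x] x by simp
  have "((\<lambda>x. weighted f x / stat_cdf X x) has_real_derivative hazard x * (f x - link X f x)) (at x)"
    by (rule DERIV_cong[OF DERIV_divide[OF DERIV_weighted[OF f x] density_primitive.prim[OF stat_primitive x] P]])
       (use x P in \<open>simp add: hazard_def link_eq field_simps\<close>)
  moreover have "\<forall>\<^sub>F u in nhds x. weighted f u / stat_cdf X u = link X f u"
    using eventually_nhds_in_open[of "{0<..<1}" x] x by (auto elim!: eventually_mono simp: link_eq)
  ultimately show ?thesis by (simp add: DERIV_cong_ev)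
qed

text \<open>The integral of \<pi> Af from 0 and the flux divided by 2 \<open>mass\<close> have the
  same derivative and both tend to 0 at 0, so they coincide. Dividing by \<Pi> gives the first
  claim; letting the flux vanish at 1 gives the second, the stationarity of \<Pi>.\<close>

lemma link_gen:
  assumes f: "f \<in> gen_dom X"
  shows "x \<in> {0<..<1} \<Longrightarrow> link X (gen X f) x = 1/2 * diffusivity X x * hazard x * deriv f x"
    and "link X (gen X f) 1 = 0"
proof -
  let ?\<phi> = "\<lambda>x. deriv f x / scale_density X x"
  let ?D = "\<lambda>x. weighted (gen X f) x - ?\<phi> x / (2 * mass)"
  have c: "continuous_on {0..1} (gen X f)" by (rule gen_domD(2)[OF f])
  have D: "(?D has_real_derivative 0) (at x)" if x: "x \<in> {0<..<1}" for x
  proof -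
    have "(?D has_real_derivative stat_density X x * gen X f x - 2 * speed_density X x * gen X f x / (2 * mass)) (at x)"
      using DERIV_flux[OF x gen_dom_DERIV(2)[OF f x]] gen_dom_DERIV(3)[OF f x]
      by (intro DERIV_diff DERIV_weighted[OF c x] DERIV_cdivide) simp
    then show ?thesis by (simp add: stat_density_eq)
  qed
  have W: "(weighted (gen X f) \<longlongrightarrow> 0) (at_right 0)" "(weighted (gen X f) \<longlongrightarrow> weighted (gen X f) 1) (at_left 1)"
    using continuous_on_Icc_at_rightD[OF continuous_weighted[OF c]]
      continuous_on_Icc_at_leftD[OF continuous_weighted[OF c]] by auto
  have \<phi>: "(?\<phi> \<longlongrightarrow> 0) (at_right 0)" "(?\<phi> \<longlongrightarrow> 0) (at_left 1)"
    using flux_vanishes[OF f, of Lower] flux_vanishes[OF f, of Upper] by simp_all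
  have D0: "?D x = 0" if x: "x \<in> {0<..<1}" for x
  proof -
    have "(?D \<longlongrightarrow> 0 - 0 / (2 * mass)) (at_right 0)"
      by (intro tendsto_intros W(1) \<phi>(1)) (use mass_pos in auto)
    moreover have "?D y = ?D x" if "0 < y" "y < 1" for y
      by (rule DERIV_isconst3[of 0 1 y x ?D]) (use x that D in auto)
    then have "\<forall>\<^sub>F y in at_right 0. ?D y = ?D x"
      unfolding eventually_at_right_field by (intro exI[of _ 1]) auto
    ultimately have "((\<lambda>y::real. ?D x) \<longlongrightarrow> 0) (at_right 0)"
      using filterlim_cong[OF refl refl, of ?D "\<lambda>_. ?D x"] by auto
    then show ?thesis by (simp add: tendsto_const_iff)
  qed
  show "link X (gen X f) x = 1/2 * diffusivity X x * hazard x * deriv f x" if x: "x \<in> {0<..<1}"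
    using D0[OF x] x mass_pos diff_nz[OF x] stat_cdf_pos[of x]
    by (simp add: link_eq hazard_def stat_density_eq speed_density_def field_simps)
  have "((\<lambda>x. ?\<phi> x / (2 * mass)) \<longlongrightarrow> 0 / (2 * mass)) (at_left 1)"
    by (intro tendsto_intros \<phi>(2)) (use mass_pos in auto)
  moreover have "\<forall>\<^sub>F y in at_left 1. ?\<phi> y / (2 * mass) = weighted (gen X f) y"
    unfolding eventually_at_left_field using D0 by (intro exI[of _ 0]) auto
  ultimately have "(weighted (gen X f) \<longlongrightarrow> 0) (at_left 1)"
    using filterlim_cong[OF refl refl, of "\<lambda>x. ?\<phi> x / (2 * mass)" "weighted (gen X f)"] by auto
  then have "weighted (gen X f) 1 = 0"
    by (intro tendsto_unique[OF _ W(2)]) simp_all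
  then show "link X (gen X f) 1 = 0" by (simp add: link_eq)
qed

text \<open>Comparison of derivatives from \<alpha> on, where the weighted integral starts at 0:
  \<Pi> minus it has derivative \<pi> (1 - f), and f \<Pi> minus it has derivative f' \<Pi>, both
  nonnegative. The second bound will separate \<Lambda>f from f beyond the step, the third gives
  that \<Lambda>f is at most f.\<close>

lemma weighted_step:
  assumes a: "0 < \<alpha>" "0 < w" "\<alpha> + w < 1" and f: "continuous_on {0..1} f"
    and step: "\<And>x. x \<in> {0..1} \<Longrightarrow> f x = step \<alpha> w x"
  shows "0 \<le> x \<Longrightarrow> x \<le> \<alpha> \<Longrightarrow> weighted f x = 0"
    and "\<alpha> \<le> x \<Longrightarrow> x < 1 \<Longrightarrow> weighted f x \<le> stat_cdf X x - stat_cdf X \<alpha>"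
    and "0 \<le> x \<Longrightarrow> x < 1 \<Longrightarrow> weighted f x \<le> f x * stat_cdf X x"
proof -
  have low: "weighted f x = 0" if "0 \<le> x" "x \<le> \<alpha>" for x
  proof -
    have "weighted f x = (LBINT y=0..ereal x. 0)"
      unfolding weighted_def using that a step step_lower(1)[OF a(2)]
      by (intro interval_integral_cong) (auto simp: einterval_def zero_ereal_def min_def max_def split: if_splits)
    then show ?thesis by simp
  qed
  then show "0 \<le> x \<Longrightarrow> x \<le> \<alpha> \<Longrightarrow> weighted f x = 0" .
  show "weighted f x \<le> stat_cdf X x - stat_cdf X \<alpha>" if x: "\<alpha> \<le> x" "x < 1"
  proof -
    have "stat_cdf X \<alpha> - weighted f \<alpha> \<le> stat_cdf X x - weighted f x"
    proof (rule DERIV_nonneg_imp_nondecreasing[OF x(1)])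
      fix y assume "\<alpha> \<le> y" "y \<le> x"
      then have y: "y \<in> {0<..<1}" using a x by auto
      have "0 \<le> stat_density X y * (1 - f y)"
        using step[of y] step_le_1[of \<alpha> w y] y stat_density_pos[OF y] by auto
      moreover have "((\<lambda>y. stat_cdf X y - weighted f y) has_real_derivative stat_density X y * (1 - f y)) (at y)"
        using DERIV_diff[OF density_primitive.prim[OF stat_primitive y] DERIV_weighted[OF f y]]
        by (simp add: algebra_simps)
      ultimately show "\<exists>z. ((\<lambda>y. stat_cdf X y - weighted f y) has_real_derivative z) (at y) \<and> 0 \<le> z" by blast
    qed
    then show ?thesis using low[of \<alpha>] a by simp
  qed
  show "weighted f x \<le> f x * stat_cdf X x" if x: "0 \<le> x" "x < 1"
  proof (cases "x \<le> \<alpha>")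
    case True
    then show ?thesis using low[of x] x step[of x] a step_lower(1)[OF a(2) True] by simp
  next
    case False
    have "step \<alpha> w \<alpha> * stat_cdf X \<alpha> - weighted f \<alpha> \<le> step \<alpha> w x * stat_cdf X x - weighted f x"
    proof (rule DERIV_nonneg_imp_nondecreasing[where f="\<lambda>y. step \<alpha> w y * stat_cdf X y - weighted f y"])
      show "\<alpha> \<le> x" using False by simp
      fix y assume "\<alpha> \<le> y" "y \<le> x"
      then have y: "y \<in> {0<..<1}" using a x by auto
      have "0 \<le> step' \<alpha> w y * stat_cdf X y"
        using step'_nonneg[OF a(2)] stat_cdf_pos[of y] y by (intro mult_nonneg_nonneg) auto
      moreover have "((\<lambda>y. step \<alpha> w y * stat_cdf X y - weighted f y) has_real_derivative step' \<alpha> w y * stat_cdf X y) (at y)"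
        using DERIV_diff[OF DERIV_mult[OF DERIV_step(1)[OF a(2), of \<alpha>] density_primitive.prim[OF stat_primitive y]] DERIV_weighted[OF f y]]
          step[of y] y by (simp add: algebra_simps)
      ultimately show "\<exists>z. ((\<lambda>y. step \<alpha> w y * stat_cdf X y - weighted f y) has_real_derivative z) (at y) \<and> 0 \<le> z" by blast
    qed
    then show ?thesis using low[of \<alpha>] a step[of x] x step_lower(1)[OF a(2), of \<alpha>] by simp
  qed
qed

end

locale dual_pair = stationary_diffusion X
  for X :: "'w diffusion" +
  fixes Xs :: "'v diffusion"
  assumes C1: "diffusivity X C1_differentiable_on {0<..<1}"
    and dual: "strong_stationary_dual Xs X"
begin

sublocale dual: feller_process Xs
  using dual by unfold_locales (simp add: strong_stationary_dual_def feller_diffusion_def)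

sublocale dual: diffusion_coefficients Xs
  using dual by unfold_locales (auto simp: strong_stationary_dual_def feller_diffusion_def)

lemma dual_gen_dom_DERIV:
  assumes "f \<in> gen_dom Xs" "x \<in> {0<..<1}"
  shows "(f has_real_derivative deriv f x) (at x)"
    and "(deriv f has_real_derivative deriv (deriv f) x) (at x)"
    and "gen Xs f x = 1/2 * diffusivity Xs x * deriv (deriv f) x + drift Xs x * deriv f x"
  using assms dual C2_on_interiorD[of f x] by (auto simp: strong_stationary_dual_def feller_diffusion_def)

lemma link_in_gen_dom: "f \<in> gen_dom X \<Longrightarrow> link X f \<in> gen_dom Xs"
  using dual by (simp add: strong_stationary_dual_def)

lemma link_intertwines: "f \<in> gen_dom X \<Longrightarrow> x \<in> {0..1} \<Longrightarrow> gen Xs (link X f) x = link X (gen X f) x"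
  using dual by (simp add: strong_stationary_dual_def)

section \<open>Identification of the dual coefficients\<close>

lemma DERIV_diffusivity:
  assumes "x \<in> {0<..<1}"
  shows "(diffusivity X has_real_derivative deriv (diffusivity X) x) (at x)"
proof -
  have "\<exists>D. (diffusivity X has_real_derivative D) (at x)"
    using C1 assms unfolding C1_differentiable_on_def has_real_derivative_iff_has_vector_derivative by blast
  then show ?thesis by (metis DERIV_imp_deriv)
qed

text \<open>As \<pi> is proportional to 1/(s b), its logarithmic derivative is 2a/b - b'/b. The
  differentiability of b enters here.\<close>

lemma DERIV_stat_density:
  assumes x: "x \<in> {0<..<1}"
  shows "(stat_density X has_real_derivative
    stat_density X x * (2 * drift X x / diffusivity X x - deriv (diffusivity X) x / diffusivity X x)) (at x)"
proof -
  have "((\<lambda>x. inverse (scale_density X x * diffusivity X x) / mass) has_real_derivative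
     stat_density X x * (2 * drift X x / diffusivity X x - deriv (diffusivity X) x / diffusivity X x)) (at x)"
    by (rule DERIV_cong[OF DERIV_cdivide[OF DERIV_inverse'[OF DERIV_mult[OF DERIV_scale_density[OF x] DERIV_diffusivity[OF x]]]]])
       (use diff_nz[OF x] mass_pos in \<open>auto simp: stat_density_eq speed_density_def field_simps\<close>)
  then show ?thesis
    unfolding stat_density_eq[abs_def] speed_density_def[abs_def] by (simp add: inverse_eq_divide)
qed

lemma DERIV_hazard:
  assumes x: "x \<in> {0<..<1}"
  shows "(hazard has_real_derivative
    hazard x * (2 * drift X x / diffusivity X x - deriv (diffusivity X) x / diffusivity X x - hazard x)) (at x)"
proof -
  have P: "stat_cdf X x \<noteq> 0" using stat_cdf_pos[of x] x by simp
  have "((\<lambda>x. stat_density X x / stat_cdf X x) has_real_derivative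
    hazard x * (2 * drift X x / diffusivity X x - deriv (diffusivity X) x / diffusivity X x - hazard x)) (at x)"
    by (rule DERIV_cong[OF DERIV_divide[OF DERIV_stat_density[OF x] density_primitive.prim[OF stat_primitive x] P]])
       (use P in \<open>simp add: hazard_def field_simps\<close>)
  then show ?thesis by (simp add: hazard_def[abs_def])
qed

text \<open>The two derivatives of \<Lambda>f follow from (\<Lambda>f)' = \<open>hazard\<close> (f -
  \<Lambda>f), with \<open>h1\<close> the derivative of \<open>hazard\<close>. The identity is
  linear in the pair (\<open>d\<close>, f'(x)), so each test function yields one equation for the
  unknown coefficients.\<close>

lemma intertwining_at:
  assumes f: "f \<in> gen_dom X" and x: "x \<in> {0<..<1}"
  defines "d \<equiv> f x - link X f x"
  defines "h1 \<equiv> hazard x * (2 * drift X x / diffusivity X x - deriv (diffusivity X) x / diffusivity X x - hazard x)"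
  shows "1/2 * diffusivity X x * hazard x * deriv f x
    = 1/2 * diffusivity Xs x * (h1 * d + hazard x * (deriv f x - hazard x * d)) + drift Xs x * (hazard x * d)"
proof -
  have c: "continuous_on {0..1} f" by (rule gen_domD(1)[OF f])
  have deriv1: "deriv (link X f) y = hazard y * (f y - link X f y)" if "y \<in> {0<..<1}" for y
    by (rule DERIV_imp_deriv[OF DERIV_link[OF c that]])
  have "((\<lambda>y. hazard y * (f y - link X f y)) has_real_derivative
      h1 * d + (deriv f x - hazard x * d) * hazard x) (at x)"
    unfolding d_def h1_def
    by (intro DERIV_mult DERIV_diff DERIV_hazard[OF x] gen_dom_DERIV(1)[OF f x] DERIV_link[OF c x])
  moreover have "\<forall>\<^sub>F y in nhds x. hazard y * (f y - link X f y) = deriv (link X f) y"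
    using eventually_nhds_in_open[of "{0<..<1}" x] x deriv1 by (auto elim!: eventually_mono)
  ultimately have "(deriv (link X f) has_real_derivative h1 * d + (deriv f x - hazard x * d) * hazard x) (at x)"
    by (simp add: DERIV_cong_ev)
  then have "deriv (deriv (link X f)) x = h1 * d + hazard x * (deriv f x - hazard x * d)"
    by (simp add: DERIV_imp_deriv mult.commute)
  moreover have "link X (gen X f) x = gen Xs (link X f) x"
    using link_intertwines[OF f, of x] x by simp
  ultimately show ?thesis
    using dual_gen_dom_DERIV(3)[OF link_in_gen_dom[OF f] x] link_gen(1)[OF f x] deriv1[OF x]
    by (simp add: d_def)
qed

lemma deriv_step:
  assumes "0 < w" "x \<in> {0<..<1}" "\<And>x. x \<in> {0..1} \<Longrightarrow> f x = step \<alpha> w x"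
  shows "deriv f x = step' \<alpha> w x"
proof (rule DERIV_imp_deriv)
  have "\<forall>\<^sub>F y in nhds x. step \<alpha> w y = f y"
    using eventually_nhds_in_open[of "{0<..<1}" x] assms by (auto elim!: eventually_mono)
  then show "(f has_real_derivative step' \<alpha> w x) (at x)"
    using DERIV_step(1)[OF assms(1), of \<alpha> x] by (simp add: DERIV_cong_ev)
qed

text \<open>Two test functions separate the coefficients at a given point: one that is already constant
  there and one that is strictly increasing there.\<close>

lemma dual_coefficients:
  assumes x: "x \<in> {0<..<1}"
  shows "diffusivity Xs x = diffusivity X x"
    and "drift Xs x = 1/2 * deriv (diffusivity X) x - drift X x + diffusivity X x * hazard x"
proof -
  let ?a = "drift X x" and ?b = "diffusivity X x" and ?b' = "deriv (diffusivity X) x" and ?r = "hazard x"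
  let ?as = "drift Xs x" and ?bs = "diffusivity Xs x"
  let ?h1 = "?r * (2 * ?a / ?b - ?b' / ?b - ?r)"
  have r: "?r \<noteq> 0" using hazard_pos[OF x] by simp
  \<comment> \<open>This step is completed at 2x/3, before x, so f'(x) = 0 while \<Lambda>f(x) < 1 =
    f(x).\<close>
  obtain f where f: "f \<in> gen_dom X" "\<And>y. y \<in> {0..1} \<Longrightarrow> f y = step (x / 3) (x / 3) y"
    by (rule step_in_gen_dom[of "x / 3" "x / 3"]) (use x in auto)
  have fx: "f x = 1" "deriv f x = 0"
    using step_upper[of "x/3" "x/3" x] f(2)[of x] deriv_step[OF _ x f(2)] x by auto
  have "weighted f x \<le> stat_cdf X x - stat_cdf X (x / 3)"
    by (rule weighted_step(2)[OF _ _ _ gen_domD(1)[OF f(1)] f(2)]) (use x in auto)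
  also have "\<dots> < stat_cdf X x" using stat_cdf_pos[of "x/3"] x by simp
  finally have "link X f x < f x"
    using fx x stat_cdf_pos[of x] by (simp add: link_eq)
  define d where "d = f x - link X f x"
  have d: "d \<noteq> 0" using \<open>link X f x < f x\<close> by (simp add: d_def)
  have "1/2 * ?bs * (?h1 * d + ?r * (0 - ?r * d)) + ?as * (?r * d) = 0"
    using intertwining_at[OF f(1) x] unfolding fx(2) d_def[symmetric] by simp
  then have "d * (1/2 * ?bs * (?h1 - ?r * ?r) + ?as * ?r) = 0"
    by (simp add: algebra_simps)
  \<comment> \<open>The coefficient of the gap \<open>d\<close> vanishes. Being independent of the
    test function, it also removes the gap from the second equation.\<close>
  then have eq1: "1/2 * ?bs * (?h1 - ?r * ?r) + ?as * ?r = 0" using d by simp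
  \<comment> \<open>This step rises on the interval from x/2 to (x+1)/2, which has x in its
    interior.\<close>
  obtain g where g: "g \<in> gen_dom X" "\<And>y. y \<in> {0..1} \<Longrightarrow> g y = step (x / 2) (1 / 2) y"
    by (rule step_in_gen_dom[of "x / 2" "1 / 2"]) (use x in auto)
  have gx: "deriv g x \<noteq> 0"
    using step'_pos[of "x/2" x "1/2"] deriv_step[OF _ x g(2)] x by simp
  define e where "e = g x - link X g x"
  have "1/2 * ?b * ?r * deriv g x
    = 1/2 * ?bs * (?h1 * e + ?r * (deriv g x - ?r * e)) + ?as * (?r * e)"
    using intertwining_at[OF g(1) x] unfolding e_def[symmetric] .
  also have "\<dots> = e * (1/2 * ?bs * (?h1 - ?r * ?r) + ?as * ?r) + 1/2 * ?bs * ?r * deriv g x"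
    by (simp add: algebra_simps)
  also have "\<dots> = 1/2 * ?bs * ?r * deriv g x" using eq1 by simp
  finally show b: "?bs = ?b" using r gx by simp
  have "?r * (1/2 * ?b * (2 * ?a / ?b - ?b' / ?b - ?r - ?r) + ?as) = 0"
  proof -
    have "?r * (1/2 * ?b * (q - p - ?r - ?r) + ?as) = 1/2 * ?b * (?r * (q - p - ?r) - ?r * ?r) + ?as * ?r" for p q
      by (simp add: algebra_simps)
    then show ?thesis using eq1 unfolding b by (simp only:)
  qed
  then have "1/2 * ?b * (2 * ?a / ?b - ?b' / ?b - ?r - ?r) + ?as = 0" using r by simp
  moreover have "1/2 * ?b * (2 * ?a / ?b - ?b' / ?b - ?r - ?r) = ?a - 1/2 * ?b' - ?b * ?r"
    using diff_nz[OF x] by (simp add: field_simps)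
  ultimately show "?as = 1/2 * ?b' - ?a + ?b * ?r" by linarith
qed

section \<open>Scale and speed of the dual\<close>

definition K :: real where "K = scale_density Xs (1/2) / (stat_density X (1/2) / (stat_cdf X (1/2))\<^sup>2)"

lemma K_pos: "0 < K"
  using stat_density_pos[of "1/2"] stat_cdf_pos[of "1/2"] by (simp add: K_def)

text \<open>The logarithmic derivative -2a*/b* of the dual scale density is 2a/b - b'/b - 2
  \<open>hazard\<close>, which is also that of \<pi>/\<Pi>^2. Hence the quotient is constant, and
  \<open>K\<close> is its value at the base point 1/2.\<close>

lemma dual_scale_density:
  assumes x: "x \<in> {0<..<1}"
  shows "scale_density Xs x = K * stat_density X x / (stat_cdf X x)\<^sup>2"
proof -
  let ?q = "\<lambda>x. scale_density Xs x / (hazard x / stat_cdf X x)"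
  have D: "(?q has_real_derivative 0) (at y)" if y: "y \<in> {0<..<1}" for y
  proof -
    let ?a = "drift X y" and ?b = "diffusivity X y" and ?b' = "deriv (diffusivity X) y" and ?r = "hazard y"
    let ?P = "stat_cdf X y"
    have P: "?P \<noteq> 0" and r: "?r \<noteq> 0" using stat_cdf_pos[of y] hazard_pos[OF y] y by auto
    have b: "?b \<noteq> 0" by (rule diff_nz[OF y])
    have s: "(scale_density Xs has_real_derivative - (?b' / ?b - 2 * ?a / ?b + 2 * ?r) * scale_density Xs y) (at y)"
      by (rule DERIV_cong[OF dual.DERIV_scale_density[OF y]])
         (use b in \<open>simp add: dual_coefficients[OF y] field_simps\<close>)
    have h: "((\<lambda>x. hazard x / stat_cdf X x) has_real_derivative - (?b' / ?b - 2 * ?a / ?b + 2 * ?r) * (?r / ?P)) (at y)"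
    proof (rule DERIV_cong[OF DERIV_divide[OF DERIV_hazard[OF y] density_primitive.prim[OF stat_primitive y] P]])
      have "stat_density X y = ?r * ?P" using P by (simp add: hazard_def)
      then show "(?r * (2 * ?a / ?b - ?b' / ?b - ?r) * ?P - ?r * stat_density X y) / (?P * ?P)
         = - (?b' / ?b - 2 * ?a / ?b + 2 * ?r) * (?r / ?P)"
        using P b by (simp add: field_simps)
    qed
    show ?thesis
      by (rule DERIV_cong[OF DERIV_divide[OF s h]]) (use P r in auto)
  qed
  have "?q x = ?q (1/2)"
    by (rule DERIV_isconst3[of 0 1 x "1/2" ?q]) (use x D in auto)
  also have "\<dots> = K" by (simp add: K_def hazard_def power2_eq_square)
  finally show ?thesis
    using stat_cdf_pos[of x] stat_density_pos[OF x] x by (simp add: hazard_def field_simps power2_eq_square)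
qed

lemma dual_speed_density:
  assumes x: "x \<in> {0<..<1}"
  shows "speed_density Xs x = mass / K * (stat_cdf X x)\<^sup>2 * scale_density X x"
  using diff_nz[OF x] mass_pos K_pos stat_cdf_pos[of x] x
  by (simp add: speed_density_def dual_coefficients(1)[OF x] dual_scale_density[OF x] stat_density_eq field_simps)

text \<open>The density K \<pi>/\<Pi>^2 is the derivative of -K/\<Pi>. The dual scale is thus
  infinite at 0, where \<Pi> vanishes, and bounded at 1.\<close>

lemma dual_scale_fun:
  assumes "x \<in> {0<..<1}" "y \<in> {0<..<1}"
  shows "scale_fun Xs x - scale_fun Xs y = K / stat_cdf X y - K / stat_cdf X x"
proof -
  have "((\<lambda>x. scale_fun Xs x + K / stat_cdf X x) has_real_derivative 0) (at x)" if x: "x \<in> {0<..<1}" for x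
  proof -
    have P: "stat_cdf X x \<noteq> 0" using stat_cdf_pos[of x] x by simp
    show ?thesis
      by (rule DERIV_cong[OF DERIV_add[OF density_primitive.prim[OF dual.scale_primitive x]
              DERIV_divide[OF DERIV_const density_primitive.prim[OF stat_primitive x] P]]])
         (use P in \<open>simp add: dual_scale_density[OF x] field_simps power2_eq_square\<close>)
  qed
  then have "scale_fun Xs x + K / stat_cdf X x = scale_fun Xs y + K / stat_cdf X y"
    using assms by (intro DERIV_isconst3[of 0 1 x y "\<lambda>x. scale_fun Xs x + K / stat_cdf X x"]) auto
  then show ?thesis by simp
qed

end

section \<open>Boundary behaviour of the dual\<close>

lemma nn_integral_le_cmult:
  fixes f g :: "real \<Rightarrow> real"
  assumes "continuous_on {0<..<1} g" "A \<subseteq> {0<..<1}" "A \<in> sets borel" "0 \<le> c"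
    and "\<And>x. x \<in> A \<Longrightarrow> f x \<le> c * g x"
  shows "(\<integral>\<^sup>+x\<in>A. ennreal (f x) \<partial>lborel) \<le> ennreal c * (\<integral>\<^sup>+x\<in>A. ennreal (g x) \<partial>lborel)"
proof -
  have "(\<integral>\<^sup>+x\<in>A. ennreal (f x) \<partial>lborel) \<le> (\<integral>\<^sup>+x. ennreal c * (ennreal (g x) * indicator A x) \<partial>lborel)"
    using assms(4,5)
    by (intro nn_integral_mono) (auto simp: indicator_def ennreal_mult'[symmetric] intro!: ennreal_leI)
  also have "\<dots> = ennreal c * (\<integral>\<^sup>+x\<in>A. ennreal (g x) \<partial>lborel)"
    by (intro nn_integral_cmult measurable_on_unit_interval_lborel assms)
  finally show ?thesis .
qed

lemma nn_integral_finite_bound: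
  fixes f g :: "real \<Rightarrow> real"
  assumes "continuous_on {0<..<1} g" "A \<subseteq> {0<..<1}" "A \<in> sets borel" "0 \<le> c"
    and "\<And>x. x \<in> A \<Longrightarrow> f x \<le> c * g x" and "(\<integral>\<^sup>+x\<in>A. ennreal (g x) \<partial>lborel) < \<infinity>"
  shows "(\<integral>\<^sup>+x\<in>A. ennreal (f x) \<partial>lborel) < \<infinity>"
proof -
  have "ennreal c * (\<integral>\<^sup>+x\<in>A. ennreal (g x) \<partial>lborel) < \<infinity>"
    using assms(6) by (simp add: ennreal_mult_less_top)
  with nn_integral_le_cmult[OF assms(1-5)] show ?thesis by (rule le_less_trans)
qed

lemma lower_functional_mult:
  assumes "density_primitive w W" "0 < x" "x < 1"
  shows "lower_functional w F x = (\<integral>\<^sup>+\<eta>\<in>{0<..x}. ennreal (w \<eta> * (F x - F \<eta>)) \<partial>lborel)"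
  unfolding lower_functional_def using assms density_primitive.pos[OF assms(1)]
  by (intro nn_integral_cong) (auto simp: indicator_def ennreal_mult' less_imp_le)

lemma upper_functional_mult:
  assumes "density_primitive w W" "0 < x" "x < 1"
  shows "upper_functional w F x = (\<integral>\<^sup>+\<eta>\<in>{x..<1}. ennreal (w \<eta> * (F \<eta> - F x)) \<partial>lborel)"
  unfolding upper_functional_def using assms density_primitive.pos[OF assms(1)]
  by (intro nn_integral_cong) (auto simp: indicator_def ennreal_mult' less_imp_le)

text \<open>Tonelli on the triangle y \<le> \<eta> \<le> x, after writing F(x) - F(y) as the
  integral of f over [y,x].\<close>

lemma lower_functional_swap:
  assumes w: "density_primitive w W" and f: "density_primitive f F" and x: "0 < x" "x < 1"
  shows "lower_functional w F x
    = (\<integral>\<^sup>+\<eta>\<in>{0<..x}. ennreal (f \<eta>) * (\<integral>\<^sup>+y\<in>{0<..\<eta>}. ennreal (w y) \<partial>lborel) \<partial>lborel)"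
proof -
  let ?w = "\<lambda>y. ennreal (w y) * indicator {0<..x} y" and ?f = "\<lambda>y. ennreal (f y) * indicator {0<..x} y"
  have [measurable]: "?w \<in> borel_measurable borel" "?f \<in> borel_measurable borel"
    using x by (auto intro!: measurable_on_unit_interval density_primitive.cont[OF w] density_primitive.cont[OF f])
  let ?h = "\<lambda>y \<eta>. ?w y * ?f \<eta> * (if y \<le> \<eta> then 1 else 0)"
  have m: "(\<lambda>(y, \<eta>). ?h y \<eta>) \<in> borel_measurable (lborel \<Otimes>\<^sub>M lborel)"
    by measurable
  have "lower_functional w F x = (\<integral>\<^sup>+y. \<integral>\<^sup>+\<eta>. ?h y \<eta> \<partial>lborel \<partial>lborel)"
    unfolding lower_functional_def
  proof (intro nn_integral_cong)
    fix y
    show "ennreal (w y) * ennreal (F x - F y) * indicator {0<..x} y = (\<integral>\<^sup>+\<eta>. ?h y \<eta> \<partial>lborel)"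
    proof (cases "y \<in> {0<..x}")
      case True
      have "(\<integral>\<^sup>+\<eta>. ?h y \<eta> \<partial>lborel) = (\<integral>\<^sup>+\<eta>. ennreal (w y) * (ennreal (f \<eta>) * indicator {y..x} \<eta>) \<partial>lborel)"
        using True by (intro nn_integral_cong) (auto simp: indicator_def)
      also have "\<dots> = ennreal (w y) * (\<integral>\<^sup>+\<eta>\<in>{y..x}. ennreal (f \<eta>) \<partial>lborel)"
        using True x
        by (intro nn_integral_cmult measurable_on_unit_interval_lborel density_primitive.cont[OF f]) auto
      also have "\<dots> = ennreal (w y) * ennreal (F x - F y)"
        using True x by (subst density_primitive.nn_integral_prim[OF f]) auto
      finally show ?thesis using True by simp
    qed simp
  qed
  also have "\<dots> = (\<integral>\<^sup>+\<eta>. \<integral>\<^sup>+y. ?h y \<eta> \<partial>lborel \<partial>lborel)"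
    using lborel_pair.Fubini'[OF m] by simp
  also have "\<dots> = (\<integral>\<^sup>+\<eta>\<in>{0<..x}. ennreal (f \<eta>) * (\<integral>\<^sup>+y\<in>{0<..\<eta>}. ennreal (w y) \<partial>lborel) \<partial>lborel)"
  proof (intro nn_integral_cong)
    fix \<eta>
    show "(\<integral>\<^sup>+y. ?h y \<eta> \<partial>lborel)
      = ennreal (f \<eta>) * (\<integral>\<^sup>+y\<in>{0<..\<eta>}. ennreal (w y) \<partial>lborel) * indicator {0<..x} \<eta>"
    proof (cases "\<eta> \<in> {0<..x}")
      case True
      have "(\<integral>\<^sup>+y. ?h y \<eta> \<partial>lborel) = (\<integral>\<^sup>+y. ennreal (f \<eta>) * (ennreal (w y) * indicator {0<..\<eta>} y) \<partial>lborel)"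
        using True by (intro nn_integral_cong) (auto simp: indicator_def mult.commute)
      also have "\<dots> = ennreal (f \<eta>) * (\<integral>\<^sup>+y\<in>{0<..\<eta>}. ennreal (w y) \<partial>lborel)"
        using True x
        by (intro nn_integral_cmult measurable_on_unit_interval_lborel density_primitive.cont[OF w]) auto
      finally show ?thesis using True by simp
    qed simp
  qed
  finally show ?thesis .
qed

context dual_pair
begin

lemma stat_cdf_le_nn_integral:
  assumes x: "x \<in> {0<..<1}"
  shows "ennreal (stat_cdf X x) \<le> (\<integral>\<^sup>+y\<in>{0<..x}. ennreal (stat_density X y) \<partial>lborel)"
proof (rule tendsto_upperbound)
  have "((\<lambda>y. stat_cdf X x - stat_cdf X y) \<longlongrightarrow> stat_cdf X x - 0) (at_right 0)"
    by (intro tendsto_intros tendsto_stat_cdf)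
  then show "((\<lambda>y. ennreal (stat_cdf X x - stat_cdf X y)) \<longlongrightarrow> ennreal (stat_cdf X x)) (at_right 0)"
    by (intro tendsto_ennrealI) simp
  show "\<forall>\<^sub>F y in at_right 0. ennreal (stat_cdf X x - stat_cdf X y)
      \<le> (\<integral>\<^sup>+y\<in>{0<..x}. ennreal (stat_density X y) \<partial>lborel)"
    unfolding eventually_at_right_field using x
    by (intro exI[of _ x]) (auto intro!: density_primitive.nn_integral_lower_ge[OF stat_primitive])
qed simp

text \<open>For the dual N, the scale increment is at most K/\<Pi>(\<eta>), which leaves the
  integrand \<open>mass\<close> \<Pi> s; by Tonelli its integral is controlled by the finite N of
  \<open>X\<close> at 0. The dual \<Sigma> is infinite because -K/\<Pi> is unbounded at 0.\<close>

lemma dual_lower_entrance: "entrance_boundary Xs Lower"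
  unfolding entrance_boundary_def
proof (intro ballI conjI)
  fix x :: real assume x: "x \<in> {0<..<1}"
  let ?I = "\<integral>\<^sup>+\<eta>\<in>{0<..x}. ennreal (stat_cdf X \<eta> * scale_density X \<eta>) \<partial>lborel"
  have "?I \<le> (\<integral>\<^sup>+\<eta>\<in>{0<..x}. ennreal (scale_density X \<eta>) * (\<integral>\<^sup>+y\<in>{0<..\<eta>}. ennreal (stat_density X y) \<partial>lborel) \<partial>lborel)"
  proof (intro nn_integral_mono)
    fix \<eta>
    show "ennreal (stat_cdf X \<eta> * scale_density X \<eta>) * indicator {0<..x} \<eta>
      \<le> ennreal (scale_density X \<eta>) * (\<integral>\<^sup>+y\<in>{0<..\<eta>}. ennreal (stat_density X y) \<partial>lborel) * indicator {0<..x} \<eta>"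
    proof (cases "\<eta> \<in> {0<..x}")
      case True
      then have "ennreal (scale_density X \<eta>) * ennreal (stat_cdf X \<eta>)
          \<le> ennreal (scale_density X \<eta>) * (\<integral>\<^sup>+y\<in>{0<..\<eta>}. ennreal (stat_density X y) \<partial>lborel)"
        using x by (intro mult_left_mono stat_cdf_le_nn_integral) auto
      moreover have "ennreal (stat_cdf X \<eta> * scale_density X \<eta>) = ennreal (scale_density X \<eta>) * ennreal (stat_cdf X \<eta>)"
        using scale_density_pos[of \<eta>] by (simp add: mult.commute ennreal_mult' less_imp_le)
      ultimately show ?thesis using True by simp
    qed simp
  qed
  also have "\<dots> = lower_functional (stat_density X) (scale_fun X) x"
    using x by (intro lower_functional_swap[OF stat_primitive scale_primitive, symmetric]) auto
  also have "\<dots> = (\<integral>\<^sup>+\<eta>\<in>{0<..x}. ennreal (stat_density X \<eta> * (scale_fun X x - scale_fun X \<eta>)) \<partial>lborel)"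
    using x by (intro lower_functional_mult[OF stat_primitive]) auto
  also have "\<dots> < \<infinity>"
  proof (rule nn_integral_finite_bound)
    show "continuous_on {0<..<1} (\<lambda>\<eta>. speed_density X \<eta> * (scale_fun X x - scale_fun X \<eta>))"
      by (intro continuous_intros continuous_speed_density density_primitive.continuous_prim[OF scale_primitive])
    show "stat_density X \<eta> * (scale_fun X x - scale_fun X \<eta>)
        \<le> 1 / mass * (speed_density X \<eta> * (scale_fun X x - scale_fun X \<eta>))" for \<eta>
      by (simp add: stat_density_eq)
    show "(\<integral>\<^sup>+\<eta>\<in>{0<..x}. ennreal (speed_density X \<eta> * (scale_fun X x - scale_fun X \<eta>)) \<partial>lborel) < \<infinity>"
      using feller_N_finite[OF x, of Lower] x lower_functional_mult[OF speed_primitive, of x "scale_fun X"]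
      by (simp add: feller_functionals del: feller_N.simps)
  qed (use x mass_pos in auto)
  finally have I: "?I < \<infinity>" .
  have "lower_functional (speed_density Xs) (scale_fun Xs) x
      = (\<integral>\<^sup>+\<eta>\<in>{0<..x}. ennreal (speed_density Xs \<eta> * (scale_fun Xs x - scale_fun Xs \<eta>)) \<partial>lborel)"
    using x by (intro lower_functional_mult[OF dual.speed_primitive]) auto
  also have "\<dots> < \<infinity>"
  proof (rule nn_integral_finite_bound[OF _ _ _ _ _ I])
    show "continuous_on {0<..<1} (\<lambda>\<eta>. stat_cdf X \<eta> * scale_density X \<eta>)"
      by (intro continuous_intros continuous_scale_density density_primitive.continuous_prim[OF stat_primitive])
    fix \<eta> assume \<eta>: "\<eta> \<in> {0<..x}"
    then have \<eta>': "\<eta> \<in> {0<..<1}" using x by auto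
    have P: "0 < stat_cdf X x" "0 < stat_cdf X \<eta>" using stat_cdf_pos x \<eta>' by auto
    have "scale_fun Xs x - scale_fun Xs \<eta> \<le> K / stat_cdf X \<eta>"
      unfolding dual_scale_fun[OF x \<eta>'] using K_pos P by simp
    then have "speed_density Xs \<eta> * (scale_fun Xs x - scale_fun Xs \<eta>) \<le> speed_density Xs \<eta> * (K / stat_cdf X \<eta>)"
      using dual.speed_density_pos[OF \<eta>'] by (intro mult_left_mono) auto
    also have "\<dots> = mass * (stat_cdf X \<eta> * scale_density X \<eta>)"
      unfolding dual_speed_density[OF \<eta>'] using K_pos P by (simp add: field_simps power2_eq_square)
    finally show "speed_density Xs \<eta> * (scale_fun Xs x - scale_fun Xs \<eta>) \<le> mass * (stat_cdf X \<eta> * scale_density X \<eta>)" .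
  qed (use x mass_pos in auto)
  finally show "feller_N Xs Lower x < \<infinity>"
    using x by (simp add: dual.feller_functionals del: feller_N.simps)
  have "\<exists>y\<in>{0<..<x}. B < scale_fun Xs x - scale_fun Xs y" for B
  proof -
    \<comment> \<open>Once \<Pi>(y) < K/c, the value K/\<Pi>(y) exceeds c and hence B + K/\<Pi>(x).
      The absolute value and the summand 1 keep c positive.\<close>
    define c where "c = \<bar>B\<bar> + K / stat_cdf X x + 1"
    have Px: "0 < stat_cdf X x" using stat_cdf_pos x by auto
    have c: "0 < c" using K_pos Px by (simp add: c_def add_nonneg_pos)
    then have "\<forall>\<^sub>F y in at_right 0. stat_cdf X y < K / c"
      using order_tendstoD(2)[OF tendsto_stat_cdf(1)] K_pos by simp
    then obtain e where e: "0 < e" "\<And>y. 0 < y \<Longrightarrow> y < e \<Longrightarrow> stat_cdf X y < K / c"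
      unfolding eventually_at_right_field by auto
    define y where "y = min e x / 2"
    have y: "0 < y" "y < e" "y < x" using e x by (auto simp: y_def)
    then have Py: "0 < stat_cdf X y" "stat_cdf X y < K / c" using e(2) stat_cdf_pos x by auto
    then have "c < K / stat_cdf X y" using c by (simp add: field_simps)
    then have "B < K / stat_cdf X y - K / stat_cdf X x" by (simp add: c_def abs_if split: if_splits)
    then show ?thesis using y x dual_scale_fun[OF x, of y] by (intro bexI[of _ y]) auto
  qed
  then show "feller_Sigma Xs Lower x = \<infinity>"
    using x lower_functional_infiniteI[OF dual.scale_primitive dual.speed_primitive, of x]
    by (simp add: dual.feller_functionals del: feller_Sigma.simps)
qed

text \<open>Near 1 the function \<Pi> lies between positive constants, so the dual speed density is
  comparable with s there, and likewise the dual scale density with m.\<close>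

lemma dual_speed_le:
  assumes "x \<in> {0<..<1}"
  shows "speed_density Xs x \<le> mass / K * (stat_cdf X 1)\<^sup>2 * scale_density X x"
  unfolding dual_speed_density[OF assms]
  using assms mass_pos K_pos stat_cdf_pos[of x] stat_cdf_le[of x 1] less_imp_le[OF scale_density_pos[of x]]
  by (intro mult_right_mono mult_left_mono power_mono) auto

lemma dual_speed_ge:
  assumes "x \<in> {0<..<1}" "y \<in> {0<..<1}" "x \<le> y"
  shows "mass / K * (stat_cdf X x)\<^sup>2 * scale_density X y \<le> speed_density Xs y"
  unfolding dual_speed_density[OF assms(2)]
  using assms mass_pos K_pos stat_cdf_pos[of x] stat_cdf_le[of x y] less_imp_le[OF scale_density_pos[of y]]
  by (intro mult_right_mono mult_left_mono power_mono) auto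

text \<open>With scale and speed interchanged up to constants, the dual \<Sigma> at 1 is bounded by
  a multiple of N of \<open>X\<close> at 1, finite for both kinds of boundary.\<close>

lemma dual_Sigma_upper_finite:
  assumes x: "x \<in> {0<..<1}"
  shows "feller_Sigma Xs Upper x < \<infinity>"
proof -
  define c where "c = mass / K * (stat_cdf X 1)\<^sup>2"
  have c: "0 \<le> c" using mass_pos K_pos by (simp add: c_def)
  have Px: "0 < stat_cdf X x" using stat_cdf_pos x by auto
  have "upper_functional (scale_density Xs) (speed_fun Xs) x
      = (\<integral>\<^sup>+\<eta>\<in>{x..<1}. ennreal (scale_density Xs \<eta> * (speed_fun Xs \<eta> - speed_fun Xs x)) \<partial>lborel)"
    using x by (intro upper_functional_mult[OF dual.scale_primitive]) auto
  also have "\<dots> < \<infinity>"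
  proof (rule nn_integral_finite_bound)
    show "continuous_on {0<..<1} (\<lambda>\<eta>. speed_density X \<eta> * (scale_fun X \<eta> - scale_fun X x))"
      by (intro continuous_intros continuous_speed_density density_primitive.continuous_prim[OF scale_primitive])
    show "(\<integral>\<^sup>+\<eta>\<in>{x..<1}. ennreal (speed_density X \<eta> * (scale_fun X \<eta> - scale_fun X x)) \<partial>lborel) < \<infinity>"
      using feller_N_finite[OF x, of Upper] x upper_functional_mult[OF speed_primitive, of x "scale_fun X"]
      by (simp add: feller_functionals del: feller_N.simps)
    show "0 \<le> K / mass / (stat_cdf X x)\<^sup>2 * c" using c K_pos mass_pos by simp
    fix \<eta> assume \<eta>: "\<eta> \<in> {x..<1}"
    then have \<eta>': "\<eta> \<in> {0<..<1}" and "x \<le> \<eta>" using x by auto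
    have "c * scale_fun X x - speed_fun Xs x \<le> c * scale_fun X \<eta> - speed_fun Xs \<eta>"
    proof (rule DERIV_nonneg_imp_nondecreasing[OF \<open>x \<le> \<eta>\<close>])
      fix y assume "x \<le> y" "y \<le> \<eta>"
      then have y: "y \<in> {0<..<1}" using x \<eta>' by auto
      show "\<exists>z. ((\<lambda>y. c * scale_fun X y - speed_fun Xs y) has_real_derivative z) (at y) \<and> 0 \<le> z"
        using DERIV_diff[OF DERIV_cmult[OF density_primitive.prim[OF scale_primitive y], of c]
            density_primitive.prim[OF dual.speed_primitive y]] dual_speed_le[OF y]
        by (intro exI[of _ "c * scale_density X y - speed_density Xs y"]) (auto simp: c_def)
    qed
    then have 1: "speed_fun Xs \<eta> - speed_fun Xs x \<le> c * (scale_fun X \<eta> - scale_fun X x)"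
      by (simp add: algebra_simps)
    have 2: "scale_density Xs \<eta> \<le> K / mass / (stat_cdf X x)\<^sup>2 * speed_density X \<eta>"
    proof -
      have "(stat_cdf X x)\<^sup>2 \<le> (stat_cdf X \<eta>)\<^sup>2"
        using Px stat_cdf_le[of x \<eta>] x \<eta>' \<open>x \<le> \<eta>\<close> by (intro power_mono) auto
      then have "K * stat_density X \<eta> / (stat_cdf X \<eta>)\<^sup>2 \<le> K * stat_density X \<eta> / (stat_cdf X x)\<^sup>2"
        using K_pos stat_density_pos[OF \<eta>'] Px stat_cdf_pos[of \<eta>] \<eta>' by (intro divide_left_mono) auto
      then show ?thesis unfolding dual_scale_density[OF \<eta>'] by (simp add: stat_density_eq field_simps)
    qed
    have "scale_density Xs \<eta> * (speed_fun Xs \<eta> - speed_fun Xs x)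
        \<le> (K / mass / (stat_cdf X x)\<^sup>2 * speed_density X \<eta>) * (c * (scale_fun X \<eta> - scale_fun X x))"
      using 1 2 K_pos mass_pos speed_density_pos[OF \<eta>'] x \<eta>' \<open>x \<le> \<eta>\<close>
      by (intro mult_mono) (auto simp: density_primitive.prim_le[OF dual.speed_primitive] less_imp_le)
    then show "scale_density Xs \<eta> * (speed_fun Xs \<eta> - speed_fun Xs x)
        \<le> K / mass / (stat_cdf X x)\<^sup>2 * c * (speed_density X \<eta> * (scale_fun X \<eta> - scale_fun X x))"
      by (simp only: ac_simps)
  qed (use x in auto)
  finally show ?thesis
    using x by (simp add: dual.feller_functionals del: feller_Sigma.simps)
qed

text \<open>A finite \<Sigma> of \<open>X\<close> makes s integrable near 1. The dual speed density
  is at most a multiple of s and the dual scale is bounded, so the dual N is finite.\<close>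

lemma dual_upper_regular:
  assumes "regular_boundary X Upper"
  shows "regular_boundary Xs Upper"
  unfolding regular_boundary_def
proof (intro ballI conjI dual_Sigma_upper_finite)
  fix x :: real assume x: "x \<in> {0<..<1}"
  have "upper_functional (scale_density X) (speed_fun X) x < \<infinity>"
    using assms x by (auto simp: regular_boundary_def feller_functionals simp del: feller_Sigma.simps feller_N.simps)
  then have s: "(\<integral>\<^sup>+\<eta>\<in>{x..<1}. ennreal (scale_density X \<eta>) \<partial>lborel) < \<infinity>"
    using x by (intro upper_functional_finiteD[OF scale_primitive speed_primitive]) auto
  have "upper_functional (speed_density Xs) (scale_fun Xs) x
      = (\<integral>\<^sup>+\<eta>\<in>{x..<1}. ennreal (speed_density Xs \<eta> * (scale_fun Xs \<eta> - scale_fun Xs x)) \<partial>lborel)"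
    using x by (intro upper_functional_mult[OF dual.speed_primitive]) auto
  also have "\<dots> < \<infinity>"
  proof (rule nn_integral_finite_bound[OF continuous_scale_density _ _ _ _ s])
    have Px: "0 < stat_cdf X x" using stat_cdf_pos x by auto
    show "0 \<le> mass / K * (stat_cdf X 1)\<^sup>2 * (K / stat_cdf X x)" using mass_pos K_pos Px by simp
    fix \<eta> assume \<eta>: "\<eta> \<in> {x..<1}"
    then have \<eta>': "\<eta> \<in> {0<..<1}" and "x \<le> \<eta>" using x by auto
    have "0 < stat_cdf X \<eta>" using stat_cdf_pos \<eta>' by auto
    then have 1: "scale_fun Xs \<eta> - scale_fun Xs x \<le> K / stat_cdf X x"
      unfolding dual_scale_fun[OF \<eta>' x] using K_pos by simp
    have "speed_density Xs \<eta> * (scale_fun Xs \<eta> - scale_fun Xs x)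
      \<le> (mass / K * (stat_cdf X 1)\<^sup>2 * scale_density X \<eta>) * (K / stat_cdf X x)"
      using 1 dual_speed_le[OF \<eta>'] mass_pos K_pos x \<eta>' \<open>x \<le> \<eta>\<close>
      by (intro mult_mono) (auto simp: density_primitive.prim_le[OF dual.scale_primitive] less_imp_le)
    then show "speed_density Xs \<eta> * (scale_fun Xs \<eta> - scale_fun Xs x)
      \<le> mass / K * (stat_cdf X 1)\<^sup>2 * (K / stat_cdf X x) * scale_density X \<eta>"
      by (simp only: ac_simps)
  qed (use x in auto)
  finally show "feller_N Xs Upper x < \<infinity>"
    using x by (simp add: dual.feller_functionals del: feller_N.simps)
qed

text \<open>If the dual N were finite, the dual speed density would be integrable near 1 and with it
  s. But \<Sigma> of \<open>X\<close> is infinite with finite speed mass, so s is not integrable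
  there.\<close>

lemma dual_upper_exit:
  assumes "entrance_boundary X Upper"
  shows "exit_boundary Xs Upper"
  unfolding exit_boundary_def
proof (intro ballI conjI dual_Sigma_upper_finite)
  fix x :: real assume x: "x \<in> {0<..<1}"
  have "upper_functional (scale_density X) (speed_fun X) x = \<infinity>"
    using assms x by (auto simp: entrance_boundary_def feller_functionals simp del: feller_Sigma.simps feller_N.simps)
  then have s: "(\<integral>\<^sup>+\<eta>\<in>{x..<1}. ennreal (scale_density X \<eta>) \<partial>lborel) = \<infinity>"
    using x by (intro upper_functional_infiniteD[OF scale_primitive speed_primitive] speed_finite_upper) auto
  show "feller_N Xs Upper x = \<infinity>"
  proof (rule ccontr)
    assume "feller_N Xs Upper x \<noteq> \<infinity>"
    then have "upper_functional (speed_density Xs) (scale_fun Xs) x < \<infinity>"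
      using x by (simp add: dual.feller_functionals less_top del: feller_N.simps)
    then have fin: "(\<integral>\<^sup>+\<eta>\<in>{x..<1}. ennreal (speed_density Xs \<eta>) \<partial>lborel) < \<infinity>"
      using x by (intro upper_functional_finiteD[OF dual.speed_primitive dual.scale_primitive]) auto
    have Px: "0 < stat_cdf X x" using stat_cdf_pos x by auto
    define c where "c = mass / K * (stat_cdf X x)\<^sup>2"
    have c: "0 < c" using Px mass_pos K_pos by (simp add: c_def)
    have "(\<integral>\<^sup>+\<eta>\<in>{x..<1}. ennreal (scale_density X \<eta>) \<partial>lborel) < \<infinity>"
    proof (rule nn_integral_finite_bound[OF dual.continuous_speed_density _ _ _ _ fin])
      fix \<eta> assume "\<eta> \<in> {x..<1}"
      then have "c * scale_density X \<eta> \<le> speed_density Xs \<eta>"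
        using dual_speed_ge[OF x, of \<eta>] x by (simp add: c_def)
      then show "scale_density X \<eta> \<le> 1 / c * speed_density Xs \<eta>" using c by (simp add: field_simps)
    qed (use x c in auto)
    then show False using s by simp
  qed
qed

lemma dual_upper_absorbing:
  assumes "regular_boundary X Upper"
  shows "absorbing_boundary Xs Upper"
  unfolding absorbing_boundary_def endpoint.simps
proof
  fix k assume k: "k \<in> gen_dom Xs"
  \<comment> \<open>The step is completed at 1/2, so f = 1 on all of [1/2,1].\<close>
  obtain f where f: "f \<in> gen_dom X" "\<And>x. x \<in> {0..1} \<Longrightarrow> f x = step (1/4) (1/4) x"
    by (rule step_in_gen_dom[of "1/4" "1/4"]) auto
  have cf: "continuous_on {0..1} f" by (rule gen_domD(1)[OF f(1)])
  define g where "g = link X f"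
  have g: "g \<in> gen_dom Xs" unfolding g_def by (rule link_in_gen_dom[OF f(1)])
  have cg: "continuous_on {0..1} g" and ck: "continuous_on {0..1} k"
    using dual.gen_domD(1) g k by auto
  have gen_g: "gen Xs g 1 = 0"
    using link_intertwines[OF f(1), of 1] link_gen(2)[OF f(1)] by (simp add: g_def)
  have dg: "(g has_real_derivative hazard x * (f x - g x)) (at x)" if "x \<in> {0<..<1}" for x
    unfolding g_def by (rule DERIV_link[OF cf that])
  have P1: "0 < stat_cdf X 1" and P4: "0 < stat_cdf X (1/4)" and P2: "0 < stat_cdf X (1/2)"
    by (auto intro: stat_cdf_pos)
  \<comment> \<open>A uniform lower bound for f - g on [1/2,1): there the gap is at least
    \<Pi>(1/4)/\<Pi>(x), the stationary mass not yet reached by the step.\<close>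
  define \<delta> where "\<delta> = stat_cdf X (1/4) / stat_cdf X 1"
  have \<delta>: "0 < \<delta>" using P1 P4 by (simp add: \<delta>_def)
  have f_ge_g: "g x \<le> f x" if x: "x \<in> {0<..<1}" for x
  proof -
    have "weighted f x \<le> f x * stat_cdf X x"
      by (rule weighted_step(3)[OF _ _ _ cf f(2)]) (use x in auto)
    then show ?thesis using x stat_cdf_pos[of x] by (simp add: g_def link_eq divide_le_eq)
  qed
  have f_ge_g': "\<delta> \<le> f x - g x" if x: "1/2 \<le> x" "x < 1" for x
  proof -
    have Px: "0 < stat_cdf X x" using x by (intro stat_cdf_pos) auto
    have "weighted f x \<le> stat_cdf X x - stat_cdf X (1/4)"
      by (rule weighted_step(2)[OF _ _ _ cf f(2)]) (use x in auto)
    then have "g x \<le> (stat_cdf X x - stat_cdf X (1/4)) / stat_cdf X x"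
      using x Px by (simp add: g_def link_eq divide_right_mono)
    also have "\<dots> = 1 - stat_cdf X (1/4) / stat_cdf X x" using Px by (simp add: field_simps)
    also have "stat_cdf X (1/4) / stat_cdf X 1 \<le> stat_cdf X (1/4) / stat_cdf X x"
      using stat_cdf_le[of x 1] x P4 Px by (intro divide_left_mono) auto
    then have "1 - stat_cdf X (1/4) / stat_cdf X x \<le> 1 - \<delta>" by (simp add: \<delta>_def)
    finally show ?thesis using f(2)[of x] step_upper(1)[of "1/4" "1/4" x] x by simp
  qed
  obtain C where "0 \<le> C" and C: "\<forall>x\<in>{0..1}. \<bar>gen Xs k x\<bar> \<le> C"
    using continuous_bounded_interval[OF dual.gen_domD(2)[OF k]] by blast
  obtain Bk where "0 \<le> Bk" and Bk: "\<forall>x\<in>{0..1}. \<bar>k x\<bar> \<le> Bk"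
    using continuous_bounded_interval[OF ck] by blast
  have half: "1/2 \<in> {0<..<1::real}" by simp
  have "upper_functional (speed_density Xs) (scale_fun Xs) (1/2) < \<infinity>"
    using dual_upper_regular[OF assms] half
    by (auto simp: regular_boundary_def dual.feller_functionals simp del: feller_Sigma.simps feller_N.simps)
  then have "(\<integral>\<^sup>+\<eta>\<in>{1/2..<1}. ennreal (speed_density Xs \<eta>) \<partial>lborel) < \<infinity>"
    by (intro upper_functional_finiteD[OF dual.speed_primitive dual.scale_primitive]) auto
  then obtain D where D: "0 \<le> D" "(\<integral>\<^sup>+\<eta>\<in>{1/2..<1}. ennreal (speed_density Xs \<eta>) \<partial>lborel) = ennreal D"
    by (auto elim: less_top_ennreal[THEN iffD1, THEN exE])
  have Ms: "speed_fun Xs y - speed_fun Xs (1/2) \<le> D" if "1/2 \<le> y" "y < 1" for y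
    using density_primitive.nn_integral_upper_ge[OF dual.speed_primitive, of "1/2" y] that D
    by (simp add: ennreal_le_iff)
  let ?\<phi> = "\<lambda>x. deriv k x / scale_density Xs x"
  have d\<phi>: "(?\<phi> has_real_derivative 2 * speed_density Xs x * gen Xs k x) (at x)" if "x \<in> {0<..<1}" for x
    using dual.DERIV_flux[OF that dual_gen_dom_DERIV(2)[OF k that]] dual_gen_dom_DERIV(3)[OF k that] by simp
  define L where "L = \<bar>?\<phi> (1/2)\<bar> + 2 * C * D"
  have L: "0 \<le> L" using D \<open>0 \<le> C\<close> by (simp add: L_def)
  \<comment> \<open>The dual flux of k has derivative 2 m* A*k, with A*k bounded by C and m* of mass
    at most \<open>D\<close> on [1/2,1) by regularity of the dual. The sign \<sigma> treats upper
    and lower bounds at once.\<close>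
  have \<phi>_bound: "\<sigma> * ?\<phi> y \<le> L" if \<sigma>: "\<bar>\<sigma>\<bar> = 1" and y: "1/2 \<le> y" "y < 1" for \<sigma> y
  proof -
    have "2 * C * speed_fun Xs (1/2) - \<sigma> * ?\<phi> (1/2) \<le> 2 * C * speed_fun Xs y - \<sigma> * ?\<phi> y"
    proof (rule DERIV_nonneg_imp_nondecreasing[where f="\<lambda>y. 2 * C * speed_fun Xs y - \<sigma> * ?\<phi> y", OF y(1)])
      fix x assume "1/2 \<le> x" "x \<le> y"
      then have x: "x \<in> {0<..<1}" using y by auto
      have "\<bar>\<sigma> * gen Xs k x\<bar> \<le> C" using C x \<sigma> by (simp add: abs_mult)
      then have "0 \<le> 2 * speed_density Xs x * (C - \<sigma> * gen Xs k x)"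
        using dual.speed_density_pos[OF x] by (auto simp: abs_le_iff)
      moreover have "((\<lambda>x. 2 * C * speed_fun Xs x - \<sigma> * ?\<phi> x) has_real_derivative
          2 * C * speed_density Xs x - \<sigma> * (2 * speed_density Xs x * gen Xs k x)) (at x)"
        by (intro DERIV_diff DERIV_cmult d\<phi>[OF x] density_primitive.prim[OF dual.speed_primitive x])
      ultimately show "\<exists>z. ((\<lambda>x. 2 * C * speed_fun Xs x - \<sigma> * ?\<phi> x) has_real_derivative z) (at x) \<and> 0 \<le> z"
        by (intro exI[of _ "2 * C * speed_density Xs x - \<sigma> * (2 * speed_density Xs x * gen Xs k x)"])
           (simp add: algebra_simps)
    qed
    moreover have "2 * C * (speed_fun Xs y - speed_fun Xs (1/2)) \<le> 2 * C * D"
      using Ms[OF y] \<open>0 \<le> C\<close> by (intro mult_left_mono) auto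
    moreover have "\<sigma> * ?\<phi> (1/2) \<le> \<bar>?\<phi> (1/2)\<bar>"
    proof -
      have "\<sigma> * ?\<phi> (1/2) \<le> \<bar>\<sigma> * ?\<phi> (1/2)\<bar>" by (rule abs_ge_self)
      then show ?thesis using \<sigma> by (simp only: abs_mult mult_1)
    qed
    ultimately show ?thesis unfolding L_def by (simp only: right_diff_distrib)
  qed
  \<comment> \<open>From k' \<le> L s* in absolute value, s* = K \<open>hazard\<close>/\<Pi> with
    \<Pi> at least \<Pi>(1/2), and g' at least \<delta> \<open>hazard\<close>, it follows that the
    slope of k is at most Q times that of g.\<close>
  define Q where "Q = K * L / (stat_cdf X (1/2) * \<delta>)"
  have Q: "0 \<le> Q" using K_pos L P2 \<delta> by (simp add: Q_def)
  have near: "\<sigma> * (k 1 - k y) \<le> Q * (g 1 - g y)" if \<sigma>: "\<bar>\<sigma>\<bar> = 1" and y: "1/2 \<le> y" "y \<le> 1" for \<sigma> y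
  proof -
    have "Q * g y - \<sigma> * k y \<le> Q * g 1 - \<sigma> * k 1"
    proof (rule DERIV_nonneg_imp_increasing_open[where f="\<lambda>y. Q * g y - \<sigma> * k y", OF y(2)])
      show "continuous_on {y..1} (\<lambda>y. Q * g y - \<sigma> * k y)"
        by (rule continuous_on_subset[of "{0..1}"]) (use y in \<open>auto intro!: continuous_intros cg ck\<close>)
      fix x assume "y < x" "x < 1"
      then have x: "x \<in> {0<..<1}" and x2: "1/2 \<le> x" "x < 1" using y by auto
      have Px: "stat_cdf X (1/2) \<le> stat_cdf X x" using x2 by (intro stat_cdf_le) auto
      have "\<sigma> * deriv k x = scale_density Xs x * (\<sigma> * ?\<phi> x)" by simp
      also have "\<dots> \<le> scale_density Xs x * L"
        using \<phi>_bound[OF \<sigma> x2] by (intro mult_left_mono) (auto simp: less_imp_le)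
      also have "\<dots> = (K * L / stat_cdf X x) * hazard x"
        by (simp add: dual_scale_density[OF x] hazard_def power2_eq_square)
      also have "\<dots> \<le> (K * L / stat_cdf X (1/2)) * hazard x"
        using Px P2 K_pos L hazard_pos[OF x]
        by (intro mult_right_mono divide_left_mono) (auto intro: mult_pos_pos less_le_trans)
      also have "\<dots> = Q * (hazard x * \<delta>)" using \<delta> by (simp add: Q_def)
      also have "\<dots> \<le> Q * (hazard x * (f x - g x))"
        using f_ge_g'[OF x2] hazard_pos[OF x] Q by (intro mult_left_mono) auto
      finally have "0 \<le> Q * (hazard x * (f x - g x)) - \<sigma> * deriv k x" by simp
      moreover have "((\<lambda>y. Q * g y - \<sigma> * k y) has_real_derivative
         Q * (hazard x * (f x - g x)) - \<sigma> * deriv k x) (at x)"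
        by (intro DERIV_diff DERIV_cmult dg[OF x] dual_gen_dom_DERIV(1)[OF k x])
      ultimately show "\<exists>z. ((\<lambda>y. Q * g y - \<sigma> * k y) has_real_derivative z) (at x) \<and> 0 \<le> z" by blast
    qed
    then show ?thesis by (simp add: right_diff_distrib)
  qed
  have g_half: "g (1/2) < g 1"
  proof (rule DERIV_pos_imp_increasing_open[of "1/2" 1 g])
    fix x :: real assume x: "1/2 < x" "x < 1"
    then have x': "x \<in> {0<..<1}" by auto
    have "0 < hazard x * (f x - g x)" using hazard_pos[OF x'] f_ge_g'[of x] \<delta> x by (intro mult_pos_pos) auto
    then show "\<exists>z. (g has_real_derivative z) (at x) \<and> 0 < z" using dg[OF x'] by blast
  qed (use cg in \<open>auto intro: continuous_on_subset\<close>)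
  have g_mono: "g y \<le> g (1/2)" if y: "0 \<le> y" "y \<le> 1/2" for y
  proof (rule DERIV_nonneg_imp_increasing_open[of y "1/2" g, OF y(2)])
    fix x assume "y < x" "x < 1/2"
    then have x': "x \<in> {0<..<1}" using y by auto
    have "0 \<le> hazard x * (f x - g x)" using hazard_pos[OF x'] f_ge_g[OF x'] by (intro mult_nonneg_nonneg) auto
    then show "\<exists>z. (g has_real_derivative z) (at x) \<and> 0 \<le> z" using dg[OF x'] by blast
  qed (use cg y in \<open>auto intro: continuous_on_subset\<close>)
  define \<gamma> where "\<gamma> = g 1 - g (1/2)"
  have \<gamma>: "0 < \<gamma>" using g_half by (simp add: \<gamma>_def)
  \<comment> \<open>Below 1/2 slopes are not compared: there k(1) - k is at most 2 \<open>Bk\<close>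
    in absolute value, while g(1) - g is at least \<gamma>.\<close>
  define Q' where "Q' = max Q (2 * Bk / \<gamma>)"
  have dominated: "\<sigma> * (k 1 - k y) \<le> Q' * (g 1 - g y)" if \<sigma>: "\<bar>\<sigma>\<bar> = 1" and y: "y \<in> {0..1}" for \<sigma> y
  proof (cases "1/2 \<le> y")
    case True
    have "g y \<le> g 1"
    proof (rule DERIV_nonneg_imp_increasing_open[of y 1 g])
      fix x assume "y < x" "x < 1"
      then have x': "x \<in> {0<..<1}" using y by auto
      have "0 \<le> hazard x * (f x - g x)" using hazard_pos[OF x'] f_ge_g[OF x'] by (intro mult_nonneg_nonneg) auto
      then show "\<exists>z. (g has_real_derivative z) (at x) \<and> 0 \<le> z" using dg[OF x'] by blast
    qed (use cg y in \<open>auto intro: continuous_on_subset\<close>)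
    then have "Q * (g 1 - g y) \<le> Q' * (g 1 - g y)" by (intro mult_right_mono) (auto simp: Q'_def)
    then show ?thesis using near[OF \<sigma> True] y by auto
  next
    case False
    have "\<sigma> * (k 1 - k y) \<le> \<bar>\<sigma> * (k 1 - k y)\<bar>" by (rule abs_ge_self)
    also have "\<dots> = \<bar>k 1 - k y\<bar>" using \<sigma> by (simp only: abs_mult mult_1)
    also have "\<dots> \<le> 2 * Bk" using Bk[rule_format, of 1] Bk[rule_format, OF y] by (simp add: abs_le_iff)
    also have "\<dots> = 2 * Bk / \<gamma> * \<gamma>" using \<gamma> by simp
    also have "\<dots> \<le> Q' * (g 1 - g y)"
    proof (intro mult_mono)
      show "\<gamma> \<le> g 1 - g y" using g_mono[of y] False y by (simp add: \<gamma>_def)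
      show "0 \<le> Q'" using Q by (simp add: Q'_def)
    qed (use \<gamma> in \<open>auto simp: Q'_def\<close>)
    finally show ?thesis .
  qed
  have one: "1 \<in> {0..1::real}" by simp
  have quotient: "\<sigma> * ((semigroup_op Xs t k 1 - k 1) / t) \<le> Q' * - ((semigroup_op Xs t g 1 - g 1) / t)"
    if \<sigma>: "\<bar>\<sigma>\<bar> = 1" and "0 < t" for \<sigma> t
  proof -
    have t: "0 \<le> t" using that by simp
    \<comment> \<open>The domination is used with -\<sigma>, because the increment of the semigroup
      at 1 is the negative of the mean of k(1) - k.\<close>
    have le: "semigroup_op Xs t (\<lambda>y. (- \<sigma>) * (k 1 - k y)) 1 \<le> semigroup_op Xs t (\<lambda>y. Q' * (g 1 - g y)) 1"
      using dominated[of "- \<sigma>"] \<sigma> by (intro dual.semigroup_op_mono t one continuous_intros cg ck) auto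
    have eq: "semigroup_op Xs t (\<lambda>y. c * (u 1 - u y)) 1 = c * (u 1 - semigroup_op Xs t u 1)"
      if "continuous_on {0..1} u" for c and u :: "real \<Rightarrow> real"
      using that unfolding dual.semigroup_op_cmult
      by (subst dual.semigroup_op_diff[OF t one]) (auto simp: dual.semigroup_op_const[OF t one])
    have "(- \<sigma>) * (k 1 - semigroup_op Xs t k 1) \<le> Q' * (g 1 - semigroup_op Xs t g 1)"
      using le unfolding eq[OF ck] eq[OF cg] .
    then have "(- \<sigma>) * (k 1 - semigroup_op Xs t k 1) / t \<le> Q' * (g 1 - semigroup_op Xs t g 1) / t"
      using t by (rule divide_right_mono)
    then show ?thesis by (simp add: diff_divide_distrib algebra_simps)
  qed
  \<comment> \<open>Letting t tend to 0 leaves -Q' A*g(1) = 0 on the right; the two signs of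
    \<sigma> then give equality.\<close>
  have le: "\<sigma> * gen Xs k 1 \<le> 0" if \<sigma>: "\<bar>\<sigma>\<bar> = 1" for \<sigma>
  proof -
    have "\<sigma> * gen Xs k 1 \<le> Q' * - gen Xs g 1"
    proof (rule tendsto_le)
      show "((\<lambda>t. \<sigma> * ((semigroup_op Xs t k 1 - k 1) / t)) \<longlongrightarrow> \<sigma> * gen Xs k 1) (at_right 0)"
        by (intro tendsto_intros dual.gen_domD(3)[OF k one])
      show "((\<lambda>t. Q' * - ((semigroup_op Xs t g 1 - g 1) / t)) \<longlongrightarrow> Q' * - gen Xs g 1) (at_right 0)"
        by (intro tendsto_intros dual.gen_domD(3)[OF g one])
      show "\<forall>\<^sub>F t in at_right 0. \<sigma> * ((semigroup_op Xs t k 1 - k 1) / t) \<le> Q' * - ((semigroup_op Xs t g 1 - g 1) / t)"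
        using eventually_at_right_less[of 0] by eventually_elim (rule quotient[OF \<sigma>])
    qed simp
    then show ?thesis using gen_g by simp
  qed
  show "gen Xs k 1 = 0" using le[of 1] le[of "-1"] by simp
qed

end

theorem theorem3p8:
  fixes X :: "'w diffusion" and Xs :: "'v diffusion"
  assumes "feller_diffusion X"
    and "regular_diffusion X"
    and "\<And>e. reflecting_boundary X e \<or> entrance_boundary X e"
    and "diffusivity X C1_differentiable_on {0<..<1}"
    and "strong_stationary_dual Xs X"
  shows "(\<forall>f\<in>gen_dom Xs. \<forall>x\<in>{0<..<1}.
            gen Xs f x
            = (1/2 * deriv (diffusivity X) x - drift X x
                 + diffusivity X x * (stat_density X x / stat_cdf X x)) * deriv f x
              + 1/2 * diffusivity X x * deriv (deriv f) x)
       \<and> entrance_boundary Xs Lower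
       \<and> (reflecting_boundary X Upper \<longrightarrow>
            regular_boundary Xs Upper \<and> absorbing_boundary Xs Upper)
       \<and> (entrance_boundary X Upper \<longrightarrow> exit_boundary Xs Upper)"
proof -
  interpret dual_pair X Xs
    using assms by unfold_locales
  have "gen Xs f x
      = (1/2 * deriv (diffusivity X) x - drift X x
           + diffusivity X x * (stat_density X x / stat_cdf X x)) * deriv f x
        + 1/2 * diffusivity X x * deriv (deriv f) x"
    if "f \<in> gen_dom Xs" "x \<in> {0<..<1}" for f x
    using dual_gen_dom_DERIV(3)[OF that] by (simp add: dual_coefficients[OF that(2)] hazard_def)
  moreover have "regular_boundary X Upper" if "reflecting_boundary X Upper"
    using that by (simp add: reflecting_boundary_def)
  ultimately show ?thesis
    using dual_lower_entrance dual_upper_regular dual_upper_absorbing dual_upper_exit by blast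
qed

end
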